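(* Let $\lambda\in[P_{n+l-1}]_{\ge l}$. With respect to any monomial order on $S$ in which $x_1$ is either the smallest or the largest among the variables $x_1,\ldots,x_n$, the set $\{f_T\mid T\in\mathrm{Tab}(l,\rho),\ \rho\in[P_{n+l-1}]_{\ge l},\ \rho\unlhd\lambda\}$ is a Gröbner basis of $I_{l,\lambda}$.
   Context: $K$ is an infinite field, $n,l\ge 1$ are integers, $S=K[x_1,\ldots,x_n]$. $P_m$ is the set of partitions of $m$ (non-increasing sequences of positive integers with sum $m$). The dominance order on $P_m$: for $\lambda=(\lambda_1,\ldots,\lambda_p)$, $\mu=(\mu_1,\ldots,\mu_q)$, $\lambda\unrhd\mu$ (equivalently $\mu\unlhd\lambda$) iff $\lambda_1+\cdots+\lambda_i\ge\mu_1+\cdots+\mu_i$ for $1\le i\le\min\{p,q\}$. $[P_{n+l-1}]_{\ge l}:=\{\lambda\in P_{n+l-1}\mid \lambda_1\ge l\}$. For $\lambda\in[P_{n+l-1}]_{\ge l}$, $\mathrm{Tab}(l,\lambda)$ is the set of bijective fillings $T$ of the squares of the Young diagram of $\lambda$ by the multiset consisting of $l$ copies of $1$ and one copy of each of $2,\ldots,n$, such that no two copies of $1$ lie in the same column. If $a_1,\ldots,a_r$ are the entries of a column from top to bottom, its difference product is $\prod_{1\le i<j\le r}(x_{a_i}-x_{a_j})$; the Specht polynomial $f_T$ is the product of the difference products of all columns of $T$. $I_{l,\lambda}:=(f_T\mid T\in\mathrm{Tab}(l,\lambda))\subset S$. *)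

theory Defs
  imports
    "HOL-Algebra.Ideal"
    "HOL-Library.Poly_Mapping"
    "HOL-Library.Multiset"
    "HOL-Library.FuncSet"
begin

text \<open>
  A monomial is an exponent vector with finite support, so \<open>'k mpoly\<close> is the polynomial ring in
  countably many variables. The ring S = K[x_1,...,x_n] is its subring of polynomials
  that involve only variables with index in \<open>{1..n}\<close>.
\<close>

type_synonym monomial = "nat \<Rightarrow>\<^sub>0 nat"

type_synonym 'k mpoly = "monomial \<Rightarrow>\<^sub>0 'k"

definition var_mon :: "nat \<Rightarrow> monomial" where
  "var_mon i = Poly_Mapping.single i 1"

definition var :: "nat \<Rightarrow> 'k::comm_ring_1 mpoly" where
  "var i = Poly_Mapping.single (var_mon i) 1"

definition monomials :: "nat \<Rightarrow> monomial set" where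
  "monomials n = {m. Poly_Mapping.keys m \<subseteq> {1..n}}"

definition poly_ring :: "nat \<Rightarrow> 'k::comm_ring_1 mpoly ring" where
  "poly_ring n =
    \<lparr>carrier = {p. Poly_Mapping.keys p \<subseteq> monomials n},
     monoid.mult = (*), one = 1, zero = 0, add = (+)\<rparr>"

text \<open>
  \<open>(a, b) \<in> r\<close> means that \<open>a\<close> is less than or equal to \<open>b\<close>. The product of two monomials is the
  sum of their exponent vectors, and the monomial 1 is the zero vector.
\<close>

definition monomial_order :: "nat \<Rightarrow> monomial rel \<Rightarrow> bool" where
  "monomial_order n r \<longleftrightarrow>
     linear_order_on (monomials n) r \<and>
     (\<forall>a\<in>monomials n. (0, a) \<in> r) \<and>
     (\<forall>a\<in>monomials n. \<forall>b\<in>monomials n. \<forall>c\<in>monomials n. (a, b) \<in> r \<longrightarrow> (a + c, b + c) \<in> r)"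

text \<open>The initial monomial is only meaningful for nonzero polynomials.\<close>

definition initial_monomial :: "monomial rel \<Rightarrow> 'k::comm_ring_1 mpoly \<Rightarrow> monomial" where
  "initial_monomial r p =
     (THE m. m \<in> Poly_Mapping.keys p \<and> (\<forall>m'\<in>Poly_Mapping.keys p. (m', m) \<in> r))"

definition initial_ideal :: "nat \<Rightarrow> monomial rel \<Rightarrow> 'k::comm_ring_1 mpoly set \<Rightarrow> 'k mpoly set" where
  "initial_ideal n r F =
     Idl\<^bsub>poly_ring n\<^esub> {Poly_Mapping.single (initial_monomial r f) 1 | f. f \<in> F \<and> f \<noteq> 0}"

definition groebner_basis ::
    "nat \<Rightarrow> monomial rel \<Rightarrow> 'k::comm_ring_1 mpoly set \<Rightarrow> 'k mpoly set \<Rightarrow> bool" where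
  "groebner_basis n r G I \<longleftrightarrow>
     finite G \<and> 0 \<notin> G \<and> G \<subseteq> I \<and> initial_ideal n r G = initial_ideal n r I"

definition partitions :: "nat \<Rightarrow> nat list set" where
  "partitions m = {p. sorted_wrt (\<ge>) p \<and> (\<forall>a\<in>set p. 0 < a) \<and> sum_list p = m}"

definition partitions_ge :: "nat \<Rightarrow> nat \<Rightarrow> nat list set" where
  "partitions_ge m l = {p \<in> partitions m. p \<noteq> [] \<and> l \<le> hd p}"

text \<open>\<open>dominated q p\<close>: the partition \<open>q\<close> is less than or equal to \<open>p\<close> in the dominance order.\<close>

definition dominated :: "nat list \<Rightarrow> nat list \<Rightarrow> bool" where
  "dominated q p \<longleftrightarrow>
     (\<forall>i\<in>{1..min (length q) (length p)}. sum_list (take i q) \<le> sum_list (take i p))"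

text \<open>The square \<open>(i, j)\<close> lies in row \<open>i\<close> and column \<open>j\<close>, both counted from 0.\<close>

definition young_diagram :: "nat list \<Rightarrow> (nat \<times> nat) set" where
  "young_diagram p = {(i, j). i < length p \<and> j < p ! i}"

text \<open>
  A filling is made \<open>undefined\<close> outside the diagram, so that it is determined by its entries.
\<close>

definition Tab :: "nat \<Rightarrow> nat \<Rightarrow> nat list \<Rightarrow> (nat \<times> nat \<Rightarrow> nat) set" where
  "Tab n l p =
     {T \<in> extensional (young_diagram p).
        image_mset T (mset_set (young_diagram p)) = replicate_mset l 1 + mset_set {2..n} \<and>
        (\<forall>i i' j. (i, j) \<in> young_diagram p \<and> (i', j) \<in> young_diagram p \<and>
           T (i, j) = 1 \<and> T (i', j) = 1 \<longrightarrow> i = i')}"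

definition column_difference_product ::
    "nat list \<Rightarrow> (nat \<times> nat \<Rightarrow> nat) \<Rightarrow> nat \<Rightarrow> 'k::comm_ring_1 mpoly" where
  "column_difference_product p T j =
     (\<Prod>(i, i') \<in> {(i, i'). i < i' \<and> (i, j) \<in> young_diagram p \<and> (i', j) \<in> young_diagram p}.
        var (T (i, j)) - var (T (i', j)))"

definition specht_poly :: "nat list \<Rightarrow> (nat \<times> nat \<Rightarrow> nat) \<Rightarrow> 'k::comm_ring_1 mpoly" where
  "specht_poly p T = (\<Prod>j \<in> snd ` young_diagram p. column_difference_product p T j)"

definition specht_ideal :: "nat \<Rightarrow> nat \<Rightarrow> nat list \<Rightarrow> 'k::comm_ring_1 mpoly set" where
  "specht_ideal n l p = Idl\<^bsub>poly_ring n\<^esub> {specht_poly p T | T. T \<in> Tab n l p}"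

end

theory Submission
  imports Defs "HOL-Computational_Algebra.Polynomial"
begin

text \<open>
  Up to sign, the Specht polynomial of a tableau depends only on the multiset of its columns. A
  tableau is therefore replaced by a \<^emph>\<open>column system\<close>: a multiset of sets in which the index 1
  lies in \<open>l\<close> members and every other index in exactly one. Its shape is recorded by its
  \<^emph>\<open>profile\<close>, which sends \<open>i\<close> to the sum of \<open>min i c\<close> over the column lengths \<open>c\<close>, that is, to the
  sum of the first \<open>i\<close> row lengths. The dominance order becomes the pointwise order of profiles.

  The initial monomial of a Specht polynomial is a product over its columns and depends only on the
  order of the variables (\<open>lead_exp\<close>). Let \<open>M\<close> be the set of monomials divisible by the initial
  monomial of a Specht polynomial whose shape is dominated by the given partition. The heart of the
  proof is that every nonzero element \<open>f\<close> of the ideal contains \<^emph>\<open>some\<close> monomial of \<open>M\<close>. This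
  suffices: reduction by Specht polynomials deletes from \<open>f\<close> all monomials of \<open>M\<close> and does not touch
  an initial monomial outside \<open>M\<close>, so an initial monomial outside \<open>M\<close> would survive in a nonzero
  element without monomials in \<open>M\<close> (\<open>initial_monomial_in_leads\<close>). The reduction stops because
  Specht polynomials are homogeneous. What makes this useful is that the monomial of \<open>M\<close> may be
  looked for by splitting off one variable at a time, whatever the monomial order is.

  Suppose that the first variable is the smallest. The type of a point is the partition formed by
  the weights of its sets of equal coordinates, the first coordinate counting \<open>l\<close> times. A Specht
  polynomial that does not vanish at a point has a shape that dominates the type of the point, so
  the elements of the ideal vanish at all points whose type is not dominated by the given
  partition. Let \<open>v\<close> be the largest variable and \<open>d\<close> the degree of \<open>f\<close> in \<open>v\<close>. If the other
  coordinates are fixed, then giving \<open>v\<close> the value of one of the \<open>d + 1\<close> largest classes yields a type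
  that is at least the old type with a box added to row \<open>d + 1\<close>. Where the latter is forbidden, \<open>f\<close>
  has more roots than its degree allows, and its leading coefficient vanishes. By induction the
  leading coefficient contains a monomial divisible by the initial monomial of a column system
  without \<open>v\<close>, and \<open>v\<close> is appended to one of its columns of length at most \<open>d\<close>
  (\<open>vanishing_contains_lead_exp\<close>).

  Suppose that the first variable \<open>u\<close> is the largest. Then \<open>u\<close> is split off first, and counting
  distinct roots is not enough. As a polynomial in \<open>u\<close> alone, a Specht polynomial has a value \<open>x\<close> as a
  root as often as there are columns containing both \<open>u\<close> and a variable of value \<open>x\<close>. Counting
  entries bounds this multiplicity from below by a number \<open>root_mult\<close> that depends only on the type
  of the point, on the weight of \<open>x\<close> and on the shape. These bounds are exactly the numbers that
  describe a horizontal strip of \<open>l\<close> boxes which extends the type to a shape below the given one, and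
  their sum is the exponent of \<open>u\<close> that this strip costs. So if the leading coefficient in \<open>u\<close>
  does not vanish at a point, then the type of the point can be extended by a strip that costs at
  most the degree (\<open>strip_extendable_at_point\<close>). Extendability passes to dominated shapes, so the
  first part, with all weights 1, applies to the leading coefficient, and the copies of \<open>u\<close> are
  placed below the columns of the resulting system (\<open>ideal_contains_lead_exp_largest\<close>).

  That the Specht polynomials of dominated shapes belong to the ideal follows from an
  interpolation identity (\<open>difference_product_exchange\<close>), which moves a box from a longer column to a
  shorter one; all dominance relations arise from such moves (\<open>dominance_induct\<close>).
\<close>

section \<open>Profiles and the dominance order\<close>


text \<open>
  The functions that arise as partial sums of the rows of a partition. Row \<open>i\<close>, counted from 0, has
  length \<open>gap p i\<close>.
\<close>

definition concave_profile :: "(nat \<Rightarrow> nat) \<Rightarrow> bool" where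
  "concave_profile p \<longleftrightarrow> p 0 = 0 \<and> mono p \<and> (\<forall>i. p (Suc (Suc i)) + p i \<le> 2 * p (Suc i))"

definition gap :: "(nat \<Rightarrow> nat) \<Rightarrow> nat \<Rightarrow> nat" where
  "gap p i = p (Suc i) - p i"

lemma concave_profile_zero: "concave_profile p \<Longrightarrow> p 0 = 0"
  by (simp add: concave_profile_def)

lemma concave_profile_mono: "concave_profile p \<Longrightarrow> i \<le> j \<Longrightarrow> p i \<le> p j"
  by (auto simp: concave_profile_def mono_def)

lemma concave_profile_Suc: "concave_profile p \<Longrightarrow> p (Suc i) = p i + gap p i"
  using concave_profile_mono[of p i "Suc i"] by (simp add: gap_def)

lemma gap_Suc_le:
  assumes "concave_profile p"
  shows "gap p (Suc i) \<le> gap p i"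
proof -
  have "p (Suc (Suc i)) + p i \<le> 2 * p (Suc i)"
    using assms by (auto simp: concave_profile_def)
  thus ?thesis
    using concave_profile_Suc[OF assms, of i] concave_profile_Suc[OF assms, of "Suc i"] by simp
qed

lemma gap_antimono:
  assumes "concave_profile p" and "i \<le> j"
  shows "gap p j \<le> gap p i"
  using assms(2) by (induction rule: dec_induct) (use gap_Suc_le[OF assms(1)] order_trans in blast)+

lemma profile_le_gap:
  assumes "concave_profile p"
  shows "p (i + k) \<le> p i + k * gap p i"
proof (induction k)
  case (Suc k)
  have "p (i + Suc k) = p (i + k) + gap p (i + k)"
    using concave_profile_Suc[OF assms, of "i + k"] by simp
  moreover have "gap p (i + k) \<le> gap p i" using gap_antimono[OF assms] by simp
  ultimately show ?case using Suc by simp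
qed simp

lemma profile_ge_gap:
  assumes "concave_profile p" and "i + k \<le> Suc j"
  shows "p i + k * gap p j \<le> p (i + k)"
  using assms(2)
proof (induction k)
  case (Suc k)
  have "p (i + Suc k) = p (i + k) + gap p (i + k)"
    using concave_profile_Suc[OF assms(1), of "i + k"] by simp
  moreover have "gap p j \<le> gap p (i + k)" using gap_antimono[OF assms(1)] Suc.prems by simp
  ultimately show ?case using Suc by simp
qed simp

text \<open>
  The partial sums after a box has been added to row \<open>d\<close> (counted from 0). If the rows directly
  above have the same length, the box goes to the first of them, since the result has to be a
  partition; these are the rows that the comparison of gaps detects.
\<close>

definition add_box :: "nat \<Rightarrow> (nat \<Rightarrow> nat) \<Rightarrow> nat \<Rightarrow> nat" where
  "add_box d p i = p i + of_bool (i \<noteq> 0 \<and> gap p (i - 1) \<le> gap p d)"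

text \<open>
  The only critical case is that the profiles agree at \<open>i\<close> while the box has already been counted for the
  smaller one. Then the smaller profile is linear from \<open>i - 1\<close> to \<open>d + 1\<close>, and concavity
  forces the larger one, squeezed at both ends, to be linear there too.
\<close>

lemma add_box_mono:
  assumes p: "concave_profile p" and q: "concave_profile q" and le: "\<And>i. q i \<le> p i"
  shows "add_box d q i \<le> add_box d p i"
proof (cases "i \<noteq> 0 \<and> gap q (i - 1) \<le> gap q d \<and> q i = p i")
  case True
  then obtain j where i: "i = Suc j" by (cases i) auto
  have "gap p j \<le> gap p d"
  proof (cases "j < d")
    case True
    define c where "c = gap q d"
    have gj: "gap q j = c" using gap_antimono[OF q, of j d] True \<open>i \<noteq> 0 \<and> _\<close> i
      by (simp add: c_def)
    have "gap p j \<le> c"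
      using concave_profile_Suc[OF q, of j] concave_profile_Suc[OF p, of j] le[of j]
        \<open>i \<noteq> 0 \<and> _\<close> i gj by simp
    define k where "k = d - i"
    have dk: "d = i + k" using True i by (simp add: k_def)
    have "q i + (Suc k) * c \<le> q (i + Suc k)"
      using profile_ge_gap[OF q, of i "Suc k" d] dk c_def by simp
    also have "\<dots> \<le> p (i + Suc k)" by (rule le)
    also have "\<dots> = p (i + k) + gap p d" using concave_profile_Suc[OF p, of "i + k"] dk by simp
    also have "\<dots> \<le> p i + k * gap p i + gap p d" using profile_le_gap[OF p] by simp
    finally have "Suc k * c \<le> k * gap p i + gap p d" using \<open>i \<noteq> 0 \<and> _\<close> by simp
    moreover have "k * gap p i \<le> k * c"
      using gap_antimono[OF p, of j i] \<open>gap p j \<le> c\<close> i by simp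
    ultimately have "c \<le> gap p d" by (simp only: mult_Suc)
    thus ?thesis using \<open>gap p j \<le> c\<close> by simp
  next
    case False
    thus ?thesis using gap_antimono[OF p, of d j] by simp
  qed
  thus ?thesis using True i by (simp add: add_box_def)
next
  case False
  thus ?thesis using le[of i] unfolding add_box_def by (auto simp: of_bool_def)
qed

text \<open>
  The sum of the first \<open>i\<close> rows of the diagram with column lengths \<open>N\<close>: a column of length \<open>c\<close> meets
  \<open>min i c\<close> of these rows. Empty columns do not matter.
\<close>

definition profile :: "nat multiset \<Rightarrow> nat \<Rightarrow> nat" where
  "profile N i = (\<Sum>c\<in>#N. min i c)"

lemma profile_simps [simp]:
  "profile {#} i = 0"
  "profile (add_mset c N) i = min i c + profile N i"
  "profile (N + M) i = profile N i + profile M i"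
  "profile (replicate_mset k 0) i = 0"
  by (auto simp: profile_def)

lemma size_filter_as_sum: "size (filter_mset P N) = (\<Sum>c\<in>#N. of_bool (P c))"
  by (induction N) auto

lemma gap_profile: "gap (profile N) i = size {#c \<in># N. i < c#}"
proof -
  have "profile N (Suc i) = profile N i + size {#c \<in># N. i < c#}"
    by (induction N) auto
  thus ?thesis by (simp add: gap_def)
qed

lemma concave_profile_profile: "concave_profile (profile N)"
proof -
  have "mono (profile N)"
    unfolding mono_def by (induction N) (auto simp: add_mono min.coboundedI1)
  moreover have "profile N (Suc (Suc i)) + profile N i \<le> 2 * profile N (Suc i)" for i
  proof (induction N)
    case (add x N)
    have "min (Suc (Suc i)) x + min i x \<le> 2 * min (Suc i) x" by (auto simp: min_def)
    thus ?case using add by (simp del: min_Suc_Suc)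
  qed simp
  moreover have "profile N 0 = 0" by (induction N) auto
  ultimately show ?thesis by (simp add: concave_profile_def)
qed

lemma profile_le_sum: "profile N i \<le> sum_mset N"
  by (induction N) auto

lemma profile_eq_sum: "(\<And>c. c \<in># N \<Longrightarrow> c \<le> i) \<Longrightarrow> profile N i = sum_mset N"
  by (induction N) auto

text \<open>
  Adding a box to row \<open>d\<close> lengthens a column, namely one whose length \<open>d0\<close> is largest among the
  lengths that are at most \<open>d\<close>. If there is none, a new column is started.
\<close>

lemma profile_add_box:
  assumes "d0 \<le> d" and "\<And>c. c \<in># N \<Longrightarrow> c \<le> d \<Longrightarrow> c \<le> d0" and "d0 = 0 \<or> d0 \<in># N"
  shows "add_box d (profile N) i = profile N i + of_bool (d0 < i)"
proof (cases i)
  case (Suc j)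
  have "gap (profile N) j \<le> gap (profile N) d \<longleftrightarrow> d0 \<le> j"
  proof
    assume "d0 \<le> j"
    hence "{#c \<in># N. j < c#} \<subseteq># {#c \<in># N. d < c#}"
    proof (intro filter_mset_mono_strong[OF subset_mset.order_refl])
      fix c assume "c \<in># N" "j < c"
      thus "d < c" using assms(2)[of c] \<open>d0 \<le> j\<close> by (cases "c \<le> d") auto
    qed
    thus "gap (profile N) j \<le> gap (profile N) d"
      unfolding gap_profile by (rule size_mset_mono)
  next
    assume le: "gap (profile N) j \<le> gap (profile N) d"
    show "d0 \<le> j"
    proof (rule ccontr)
      assume "\<not> d0 \<le> j"
      hence d0: "j < d0" "d0 \<in># N" using assms(3) by auto
      have "{#c \<in># N. d < c#} \<subset># {#c \<in># N. j < c#}"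
      proof (rule subset_mset.le_neq_trans)
        show "{#c \<in># N. d < c#} \<subseteq># {#c \<in># N. j < c#}"
          using d0 assms(1) by (intro filter_mset_mono_strong[OF subset_mset.order_refl]) auto
        have "d0 \<notin># {#c \<in># N. d < c#}" "d0 \<in># {#c \<in># N. j < c#}" using d0 assms(1) by auto
        thus "{#c \<in># N. d < c#} \<noteq> {#c \<in># N. j < c#}" by metis
      qed
      hence "size {#c \<in># N. d < c#} < size {#c \<in># N. j < c#}" by (rule mset_subset_size)
      thus False using le by (simp add: gap_profile)
    qed
  qed
  thus ?thesis using Suc by (auto simp: add_box_def)
qed (simp add: add_box_def)

text \<open>
  Choose \<open>i0\<close> where the profile is strictly below \<open>p\<close>, and let \<open>a\<close> and \<open>b\<close> be the column lengths next to \<open>i0\<close>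
  on either side. Between consecutive column lengths the profile is linear, and \<open>p\<close> is concave, so
  the inequality is strict on the whole interval from \<open>b\<close> to \<open>a\<close>. Shortening a column of length \<open>a\<close> and
  lengthening one of length \<open>b\<close> raises the profile by 1 exactly there.
\<close>

lemma dominance_move_exists:
  assumes p: "concave_profile p" and tot: "\<And>i. k \<le> i \<Longrightarrow> p i = sum_mset N"
    and le: "\<And>i. profile N i \<le> p i" and ne: "profile N \<noteq> p"
  obtains R a b where "N + replicate_mset 1 0 = R + {#a, b#} \<or> N = R + {#a, b#}" "b + 2 \<le> a"
    "\<And>i. profile (R + {#a - 1, b + 1#}) i \<le> p i"
proof -
  obtain i0 where i0: "profile N i0 < p i0" using ne le by (metis ext order_le_imp_less_or_eq)
  have "i0 \<noteq> 0" using i0 p by (metis concave_profile_zero less_nat_zero_code)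
  have q: "concave_profile (profile N)" by (rule concave_profile_profile)
  have "\<exists>c. c \<in># N \<and> i0 < c"
  proof (rule ccontr)
    assume "\<not> ?thesis"
    hence "profile N i0 = sum_mset N" by (intro profile_eq_sum) auto
    also have "\<dots> = p (max k i0)" using tot by simp
    also have "\<dots> \<ge> p i0" using concave_profile_mono[OF p] by simp
    finally show False using i0 by simp
  qed
  define a where "a = (LEAST c. c \<in># N \<and> i0 < c)"
  have a: "a \<in># N" "i0 < a"
    using LeastI_ex[OF \<open>\<exists>c. c \<in># N \<and> i0 < c\<close>] by (auto simp: a_def)
  have a_least: "c \<in># N \<Longrightarrow> i0 < c \<Longrightarrow> a \<le> c" for c
    unfolding a_def by (rule Least_le) simp
  define b where "b = Max (insert 0 {c \<in> set_mset N. c < i0})"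
  have fin: "finite (insert 0 {c \<in> set_mset N. c < i0})" by simp
  have "b \<in> insert 0 {c \<in> set_mset N. c < i0}" unfolding b_def by (rule Max_in[OF fin]) simp
  hence b: "b = 0 \<or> b \<in># N" "b < i0" using \<open>i0 \<noteq> 0\<close> by auto
  have b_greatest: "c \<in># N \<Longrightarrow> c < i0 \<Longrightarrow> c \<le> b" for c
    unfolding b_def by (rule Max_ge[OF fin]) simp
  have strict: "profile N i < p i" if "b < i" "i < a" for i
  proof (rule ccontr)
    assume "\<not> profile N i < p i"
    hence eq: "profile N i = p i" using le[of i] by simp
    show False
    proof (cases "i < i0")
      case True
      have gN: "gap (profile N) j = gap (profile N) b" if "b \<le> j" "j < i0" for j
      proof -
        have "{#c \<in># N. j < c#} = {#c \<in># N. b < c#}"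
        proof (rule filter_mset_cong[OF refl])
          fix c assume "c \<in># N"
          thus "(j < c) = (b < c)" using that b_greatest[of c] by (cases "c < i0") auto
        qed
        thus ?thesis by (simp add: gap_profile)
      qed
      define g where "g = gap (profile N) b"
      define m where "m = i - b - 1"
      have m: "i = b + Suc m" using that by (simp add: m_def)
      define m' where "m' = i0 - i"
      have m': "i0 = i + m'" using True by (simp add: m'_def)
      have "p b + Suc m * gap p (b + m) \<le> p i" using profile_ge_gap[OF p, of b "Suc m" "b + m"] m by simp
      also have "p i = profile N i" using eq by simp
      also have "\<dots> \<le> profile N b + Suc m * g"
        using profile_le_gap[OF q, of b "Suc m"] m g_def by simp
      also have "\<dots> \<le> p b + Suc m * g" using le by simp
      finally have g: "gap p (b + m) \<le> g" by (simp only: add_le_cancel_left nat_mult_le_cancel_disj)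
      have "p i0 \<le> p i + m' * gap p i" using profile_le_gap[OF p] m' by simp
      also have "gap p i \<le> g" using gap_antimono[OF p, of "b + m" i] g m by simp
      also have "p i = profile N i" using eq by simp
      also have "profile N i + m' * g \<le> profile N i0"
      proof -
        have "gap (profile N) (i0 - 1) = g" using gN[of "i0 - 1"] b g_def by simp
        thus ?thesis using profile_ge_gap[OF q, of i m' "i0 - 1"] m' by auto
      qed
      finally show False using i0 by simp
    next
      case False
      hence "i0 < i" using eq i0 by (metis linorder_neqE_nat nat_neq_iff)
      have gN: "gap (profile N) j = gap (profile N) i0" if "i0 \<le> j" "j < a" for j
      proof -
        have "{#c \<in># N. j < c#} = {#c \<in># N. i0 < c#}"
        proof (rule filter_mset_cong[OF refl])
          fix c assume "c \<in># N"
          thus "(j < c) = (i0 < c)" using that a_least[of c] by (cases "i0 < c") auto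
        qed
        thus ?thesis by (simp add: gap_profile)
      qed
      define g where "g = gap (profile N) i0"
      define m where "m = i - i0 - 1"
      have m: "i = i0 + Suc m" using \<open>i0 < i\<close> by (simp add: m_def)
      define m' where "m' = a - i - 1"
      have m': "a = i + Suc m'" using \<open>i < a\<close> by (simp add: m'_def)
      have "p i0 + Suc m * gap p (i0 + m) \<le> p i"
        using profile_ge_gap[OF p, of i0 "Suc m" "i0 + m"] m by simp
      also have "p i = profile N i" using eq by simp
      also have "\<dots> \<le> profile N i0 + Suc m * g"
        using profile_le_gap[OF q, of i0 "Suc m"] m g_def by simp
      also have "\<dots> < p i0 + Suc m * g" using i0 by simp
      finally have g: "gap p (i0 + m) < g" by (metis add_less_cancel_left mult_less_cancel1)
      have "p a \<le> p i + Suc m' * gap p i" using profile_le_gap[OF p, of i "Suc m'"] m' by simp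
      also have "gap p i < g" using gap_antimono[OF p, of "i0 + m" i] g m by simp
      hence "p i + Suc m' * gap p i < p i + Suc m' * g" by (metis add_less_cancel_left mult_less_mono2 zero_less_Suc)
      also have "p i = profile N i" using eq by simp
      also have "profile N i + Suc m' * g \<le> profile N a"
      proof -
        have "gap (profile N) (a - 1) = g" using gN[of "a - 1"] a g_def by simp
        thus ?thesis using profile_ge_gap[OF q, of i "Suc m'" "a - 1"] m' by auto
      qed
      finally show False using le[of a] by simp
    qed
  qed
  have ab: "b + 2 \<le> a" using a b by simp
  define N' where "N' = (if b \<in># N then N else N + replicate_mset 1 0)"
  have "b \<in># N'" "a \<in># N'" using a b by (auto simp: N'_def)
  moreover have "a \<noteq> b" using ab by simp
  ultimately obtain R where R: "N' = R + {#a, b#}"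
    by (metis add_mset_add_single insert_noteq_member multi_member_split union_mset_add_mset_right add.right_neutral)
  have "profile (R + {#a - 1, b + 1#}) i \<le> p i" for i
  proof -
    have "profile (R + {#a - 1, b + 1#}) i = profile (R + {#a, b#}) i + of_bool (b < i \<and> i < a)"
      using ab by (auto simp: of_bool_def min_def)
    also have "profile (R + {#a, b#}) i = profile N i"
      unfolding R[symmetric] by (simp add: N'_def)
    finally show ?thesis using le[of i] strict[of i] by (auto simp: of_bool_def)
  qed
  thus ?thesis using that[of R a b] R ab by (auto simp: N'_def split: if_splits)
qed

text \<open>
  A property of column lengths is inherited by dominated ones if it is inherited backwards
  along the moves of a single box. An empty column may have to be supplied first.
\<close>

lemma dominance_induct [consumes 3, case_names equal zero move]:
  assumes p: "concave_profile p" and tot: "\<And>i. k \<le> i \<Longrightarrow> p i = sum_mset N"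
    and le: "\<And>i. profile N i \<le> p i"
    and equal: "\<And>N. profile N = p \<Longrightarrow> Q N"
    and zero: "\<And>N. Q (add_mset 0 N) \<Longrightarrow> Q N"
    and move: "\<And>R a b. b + 2 \<le> a \<Longrightarrow> Q (R + {#a - 1, b + 1#}) \<Longrightarrow> Q (R + {#a, b#})"
  shows "Q N"
  using tot le
proof (induction "\<Sum>i\<le>sum_mset N. p i - profile N i" arbitrary: N rule: less_induct)
  case less
  show ?case
  proof (cases "profile N = p")
    case False
    then obtain R a b where R: "N + replicate_mset 1 0 = R + {#a, b#} \<or> N = R + {#a, b#}"
      and ab: "b + 2 \<le> a" and le': "\<And>i. profile (R + {#a - 1, b + 1#}) i \<le> p i"
      using dominance_move_exists[OF p less.prems] by metis
    have prof: "profile (R + {#a - 1, b + 1#}) i = profile N i + of_bool (b < i \<and> i < a)" for i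
    proof -
      have "profile (R + {#a - 1, b + 1#}) i = profile (R + {#a, b#}) i + of_bool (b < i \<and> i < a)"
        using ab by (auto simp: of_bool_def min_def)
      also have "profile (R + {#a, b#}) i = profile N i"
        using R by (metis add_0_right profile_simps(3,4))
      finally show ?thesis .
    qed
    have sum: "sum_mset (R + {#a - 1, b + 1#}) = sum_mset N"
    proof -
      have "sum_mset (R + {#a - 1, b + 1#}) = sum_mset (R + {#a, b#})" using ab by simp
      also have "\<dots> = sum_mset N"
        using R by (metis add_0_right sum_mset_replicate_mset mult_0_right sum_mset.union)
      finally show ?thesis .
    qed
    have "a \<le> sum_mset N"
    proof -
      have "sum_mset (R + {#a, b#}) = sum_mset N"
        using R by (metis add_0_right sum_mset_replicate_mset mult_0_right sum_mset.union)
      thus ?thesis by simp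
    qed
    hence "b + 1 \<le> sum_mset N" using ab by simp
    have "(\<Sum>i\<le>sum_mset N. p i - profile (R + {#a - 1, b + 1#}) i) < (\<Sum>i\<le>sum_mset N. p i - profile N i)"
    proof (rule sum_strict_mono_ex1)
      show "\<forall>i\<in>{..sum_mset N}. p i - profile (R + {#a - 1, b + 1#}) i \<le> p i - profile N i"
        using prof by auto
      have "p (b + 1) - profile (R + {#a - 1, b + 1#}) (b + 1) < p (b + 1) - profile N (b + 1)"
        using prof[of "b + 1"] le'[of "b + 1"] ab by auto
      thus "\<exists>i\<in>{..sum_mset N}. p i - profile (R + {#a - 1, b + 1#}) i < p i - profile N i"
        using \<open>b + 1 \<le> sum_mset N\<close> by (intro bexI[of _ "b + 1"]) simp_all
    qed simp
    hence "Q (R + {#a - 1, b + 1#})"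
      using less.hyps[of "R + {#a - 1, b + 1#}", unfolded sum, OF _ less.prems(1) le'] by blast
    hence "Q (R + {#a, b#})" using move ab by blast
    thus ?thesis using R zero by (metis add_mset_add_single replicate_mset_0 replicate_mset_Suc One_nat_def)
  qed (simp add: equal)
qed

section \<open>Largest sums over few points\<close>

definition top_sum :: "('x \<Rightarrow> nat) \<Rightarrow> nat \<Rightarrow> nat" where
  "top_sum s i = Max {sum s W | W. finite W \<and> card W \<le> i}"

context
  fixes s :: "'x \<Rightarrow> nat"
  assumes fin: "finite {x. s x \<noteq> 0}"
begin

lemma sum_le_total: "finite W \<Longrightarrow> sum s W \<le> sum s {x. s x \<noteq> 0}"
proof -
  assume W: "finite W"
  have "sum s W = sum s (W \<inter> {x. s x \<noteq> 0})" by (rule sum.mono_neutral_right) (use W in auto)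
  also have "\<dots> \<le> sum s {x. s x \<noteq> 0}" by (rule sum_mono2) (use fin in auto)
  finally show ?thesis .
qed

lemma finite_sums: "finite {sum s W | W. finite W \<and> card W \<le> i}"
  by (rule finite_subset[of _ "{..sum s {x. s x \<noteq> 0}}"]) (use sum_le_total in auto)

lemma sum_le_top_sum: "finite W \<Longrightarrow> card W \<le> i \<Longrightarrow> sum s W \<le> top_sum s i"
  unfolding top_sum_def by (rule Max_ge[OF finite_sums]) auto

lemma top_sum_attained: obtains W where "finite W" "card W \<le> i" "sum s W = top_sum s i"
proof -
  have "top_sum s i \<in> {sum s W | W. finite W \<and> card W \<le> i}"
    unfolding top_sum_def by (rule Max_in[OF finite_sums]) (auto intro!: exI[of _ "{}"])
  thus ?thesis using that by auto
qed

lemma top_sum_le_total: "top_sum s i \<le> sum s {x. s x \<noteq> 0}"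
  by (metis top_sum_attained sum_le_total)

lemma top_sum_eq_total: "card {x. s x \<noteq> 0} \<le> i \<Longrightarrow> top_sum s i = sum s {x. s x \<noteq> 0}"
  by (intro antisym top_sum_le_total sum_le_top_sum fin)

text \<open>
  Moving a point from an optimal set of size \<open>i + 2\<close> to an optimal one of size \<open>i\<close> yields two sets of
  size \<open>i + 1\<close> with the same total.
\<close>

lemma concave_profile_top_sum: "concave_profile (top_sum s)"
proof -
  have mono: "top_sum s i \<le> top_sum s j" if "i \<le> j" for i j
    by (metis that top_sum_attained sum_le_top_sum order_trans)
  have conc: "top_sum s (Suc (Suc i)) + top_sum s i \<le> 2 * top_sum s (Suc i)" for i
  proof -
    obtain V where V: "finite V" "card V \<le> i" "sum s V = top_sum s i" by (rule top_sum_attained)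
    obtain W where W: "finite W" "card W \<le> Suc (Suc i)" "sum s W = top_sum s (Suc (Suc i))"
      by (rule top_sum_attained)
    show ?thesis
    proof (cases "card W \<le> Suc i")
      case True
      hence "sum s W \<le> top_sum s (Suc i)" using W by (intro sum_le_top_sum)
      moreover have "top_sum s i \<le> top_sum s (Suc i)" by (rule mono) simp
      ultimately show ?thesis using W by simp
    next
      case False
      hence "\<not> W \<subseteq> V" using card_mono[OF V(1), of W] V(2) by auto
      then obtain x where x: "x \<in> W" "x \<notin> V" by auto
      have "sum s (insert x V) \<le> top_sum s (Suc i)"
        using V x by (intro sum_le_top_sum) auto
      moreover have "sum s (W - {x}) \<le> top_sum s (Suc i)"
        using W x by (intro sum_le_top_sum) auto
      moreover have "sum s W = s x + sum s (W - {x})" using x W by (simp add: sum.remove)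
      ultimately show ?thesis using V W x by simp
    qed
  qed
  have "top_sum s 0 = 0"
  proof -
    obtain W where W: "finite W" "card W \<le> 0" "sum s W = top_sum s 0" by (rule top_sum_attained)
    thus ?thesis by auto
  qed
  thus ?thesis using mono conc by (simp add: concave_profile_def mono_def)
qed

text \<open>
  Insisting that a set of \<open>i + 1\<close> points contains \<open>x\<close> costs at most the difference between the
  weight of the last point of an optimal set and the weight of \<open>x\<close>.
\<close>

lemma top_sum_swap:
  obtains W where "finite W" "card W \<le> Suc i" "x \<in> W"
    "top_sum s (Suc i) \<le> sum s W + (gap (top_sum s) i - s x)"
proof -
  have g: "top_sum s (Suc i) = top_sum s i + gap (top_sum s) i"
    by (rule concave_profile_Suc[OF concave_profile_top_sum])
  obtain V where V: "finite V" "card V \<le> i" "sum s V = top_sum s i" by (rule top_sum_attained)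
  obtain W where W: "finite W" "card W \<le> Suc i" "sum s W = top_sum s (Suc i)"
    by (rule top_sum_attained)
  show ?thesis
  proof (cases "x \<in> V")
    case False
    thus ?thesis using V g by (intro that[of "insert x V"]) auto
  next
    case xV: True
    show ?thesis
    proof (cases "card W \<le> i")
      case True
      thus ?thesis using W that[of "insert x W"]
        by (metis (no_types, lifting) card_insert_le_m1 card_insert_disjoint finite_insert insertI1 insert_absorb le_SucI
            not_less_eq_eq sum.insert trans_le_add1 trans_le_add2 order_refl)
    next
      case False
      hence "\<not> W \<subseteq> V" using card_mono[OF V(1), of W] V(2) by auto
      then obtain w where w: "w \<in> W" "w \<notin> V" by auto
      have "sum s (W - {w}) \<le> top_sum s i" using W w by (intro sum_le_top_sum) auto
      moreover have "sum s W = s w + sum s (W - {w})" using w W by (simp add: sum.remove)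
      ultimately have "top_sum s (Suc i) \<le> sum s (insert w V)" using V W w by simp
      thus ?thesis using V w xV by (intro that[of "insert w V"]) auto
    qed
  qed
qed

text \<open>
  The points can be listed by decreasing weight, so the gaps are the weights in this order.
  In an infinite type the list may be as long as desired, ending with points of weight 0.
\<close>

lemma top_sum_enumeration:
  assumes "infinite (UNIV :: 'x set)"
  shows "\<exists>xs. length xs = k \<and> distinct xs \<and> (\<forall>i<k. s (xs ! i) = gap (top_sum s) i)"
proof (induction k)
  case (Suc k)
  then obtain xs where xs: "length xs = k" "distinct xs" "\<And>i. i < k \<Longrightarrow> s (xs ! i) = gap (top_sum s) i"
    by auto
  have g: "top_sum s (Suc i) = top_sum s i + gap (top_sum s) i" for i
    by (rule concave_profile_Suc[OF concave_profile_top_sum])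
  have "sum s (set (take i xs)) = top_sum s i" if "i \<le> k" for i
    using that
  proof (induction i)
    case 0
    show ?case by (simp add: concave_profile_zero[OF concave_profile_top_sum])
  next
    case (Suc i)
    have "xs ! i \<notin> set (take i xs)"
      using xs Suc.prems by (auto simp: in_set_conv_nth nth_eq_iff_index_eq)
    thus ?case using Suc xs g[of i] by (simp add: take_Suc_conv_app_nth)
  qed
  from this[of k] have V: "sum s (set xs) = top_sum s k" using xs by simp
  have card: "card (set xs) = k" using xs distinct_card by blast
  obtain W where W: "finite W" "card W \<le> Suc k" "sum s W = top_sum s (Suc k)"
    by (rule top_sum_attained)
  have "\<exists>x. x \<notin> set xs \<and> s x = gap (top_sum s) k"
  proof (cases "W \<subseteq> set xs")
    case True
    obtain x where x: "x \<notin> set xs" using assms by (meson List.finite_set ex_new_if_finite)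
    have "top_sum s (Suc k) \<le> top_sum s k" using True W V sum_mono2[of "set xs" W s] by simp
    hence g0: "gap (top_sum s) k = 0" by (simp add: gap_def)
    have "s x + sum s (set xs) \<le> top_sum s (Suc k)"
      using sum_le_top_sum[of "insert x (set xs)" "Suc k"] x card by simp
    hence "s x = 0" using V g[of k] g0 by simp
    thus ?thesis using x g0 by auto
  next
    case False
    have "\<exists>w. w \<in> W \<and> w \<notin> set xs \<and> (card W \<le> k \<or> card W = Suc k)" using False W by auto
    then obtain w where w: "w \<in> W" "w \<notin> set xs" by auto
    have "sum s (W - {w}) \<le> top_sum s k" using W w by (intro sum_le_top_sum) auto
    moreover have "sum s W = s w + sum s (W - {w})" using w W by (simp add: sum.remove)
    moreover have "s w + sum s (set xs) \<le> top_sum s (Suc k)"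
      using sum_le_top_sum[of "insert w (set xs)" "Suc k"] w card by simp
    ultimately have "s w = gap (top_sum s) k" using V W g[of k] by simp
    thus ?thesis using w by auto
  qed
  then obtain x where x: "x \<notin> set xs" "s x = gap (top_sum s) k" by auto
  have "s ((xs @ [x]) ! i) = gap (top_sum s) i" if "i < Suc k" for i
    using that xs x by (cases "i < k") (auto simp: nth_append less_Suc_eq)
  thus ?case using xs x by (intro exI[of _ "xs @ [x]"]) auto
qed simp

end

text \<open>
  A point that is at least as heavy as the one of rank \<open>d\<close> can be swapped into every optimal set of a
  size at which a box in row \<open>d\<close> is felt.
\<close>

lemma top_sum_add_point:
  assumes fin: "finite {x. s x \<noteq> 0}" and s': "\<And>y. s' y = s y + of_bool (y = x)" and le: "gap (top_sum s) d \<le> s x"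
  shows "add_box d (top_sum s) i \<le> top_sum s' i"
proof -
  have fin': "finite {y. s' y \<noteq> 0}"
    by (rule finite_subset[of _ "insert x {y. s y \<noteq> 0}"]) (use fin s' in auto)
  note up = sum_le_top_sum[OF fin']
  have sum': "sum s' W = sum s W + of_bool (x \<in> W)" if "finite W" for W
    using that by (simp add: s' sum.distrib of_bool_def)
  show ?thesis
  proof (cases "i \<noteq> 0 \<and> gap (top_sum s) (i - 1) \<le> gap (top_sum s) d")
    case True
    then obtain j where j: "i = Suc j" by (cases i) auto
    obtain W where W: "finite W" "card W \<le> Suc j" "x \<in> W"
      "top_sum s (Suc j) \<le> sum s W + (gap (top_sum s) j - s x)" by (rule top_sum_swap[OF fin])
    have "sum s' W \<le> top_sum s' i" using up W j by blast
    thus ?thesis using True W j le sum'[of W] by (simp add: add_box_def)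
  next
    case False
    obtain W where W: "finite W" "card W \<le> i" "sum s W = top_sum s i" by (rule top_sum_attained[OF fin])
    have "sum s' W \<le> top_sum s' i" using up W by blast
    hence "top_sum s i \<le> top_sum s' i" using sum'[of W] W by simp
    thus ?thesis using False by (auto simp: add_box_def)
  qed
qed

abbreviation keys :: "('a \<Rightarrow>\<^sub>0 'b::zero) \<Rightarrow> 'a set" where "keys \<equiv> Poly_Mapping.keys"

abbreviation lookup :: "('a \<Rightarrow>\<^sub>0 'b::zero) \<Rightarrow> 'a \<Rightarrow> 'b" where "lookup \<equiv> Poly_Mapping.lookup"

section \<open>Column systems and types of points\<close>

text \<open>
  The total weight of the variables whose value at \<open>a\<close> is \<open>x\<close>; the type of a point is the partition
  formed by these numbers, given by its partial sums.
\<close>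

definition class_size :: "(nat \<Rightarrow> nat) \<Rightarrow> nat set \<Rightarrow> (nat \<Rightarrow> 'k) \<Rightarrow> 'k \<Rightarrow> nat" where
  "class_size w A a x = (\<Sum>b\<in>{b \<in> A. a b = x}. w b)"

definition point_type :: "(nat \<Rightarrow> nat) \<Rightarrow> nat set \<Rightarrow> (nat \<Rightarrow> 'k) \<Rightarrow> nat \<Rightarrow> nat" where
  "point_type w A a = top_sum (class_size w A a)"

text \<open>
  The columns of the fillings in which \<open>a\<close> occurs \<open>w a\<close> times and no column repeats an entry. Empty
  columns are admitted, so that a new column can be started by lengthening an empty one.
\<close>

definition column_systems :: "(nat \<Rightarrow> nat) \<Rightarrow> nat set \<Rightarrow> nat set multiset set" where
  "column_systems w A =
     {C. (\<forall>X\<in>#C. X \<subseteq> A) \<and> (\<forall>a\<in>A. size {#X \<in># C. a \<in> X#} = w a)}"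

abbreviation lengths :: "nat set multiset \<Rightarrow> nat multiset" where
  "lengths C \<equiv> image_mset card C"

lemma class_size_support: "class_size w A a x \<noteq> 0 \<Longrightarrow> x \<in> a ` A"
proof (rule ccontr)
  assume nz: "class_size w A a x \<noteq> 0" and "x \<notin> a ` A"
  hence e: "{b \<in> A. a b = x} = {}" by auto
  show False using nz unfolding class_size_def e by simp
qed

lemma finite_class_size: "finite A \<Longrightarrow> finite {x. class_size w A a x \<noteq> 0}"
  by (rule finite_subset[of _ "a ` A"]) (use class_size_support in auto)

lemma sum_class_size:
  assumes "finite A" "finite W"
  shows "(\<Sum>x\<in>W. class_size w A a x) = (\<Sum>b\<in>{b \<in> A. a b \<in> W}. w b)"
proof -
  have "(\<Sum>b\<in>{b \<in> A. a b \<in> W}. w b) = (\<Sum>x\<in>W. sum w {b \<in> {b \<in> A. a b \<in> W}. a b = x})"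
    by (rule sum.group[symmetric]) (use assms in auto)
  also have "\<dots> = (\<Sum>x\<in>W. class_size w A a x)"
    unfolding class_size_def by (intro sum.cong) auto
  finally show ?thesis by simp
qed

lemma sum_all_class_sizes:
  assumes "finite A"
  shows "(\<Sum>x | class_size w A a x \<noteq> 0. class_size w A a x) = (\<Sum>b\<in>A. w b)"
proof -
  have "(\<Sum>x | class_size w A a x \<noteq> 0. class_size w A a x) = (\<Sum>x\<in>a ` A. class_size w A a x)"
    by (rule sum.mono_neutral_left) (use assms class_size_support[of w A a] in auto)
  also have "\<dots> = (\<Sum>b\<in>{b \<in> A. a b \<in> a ` A}. w b)" by (rule sum_class_size) (use assms in auto)
  also have "{b \<in> A. a b \<in> a ` A} = A" by auto
  finally show ?thesis .
qed

lemma sum_mset_card_Int: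
  assumes "finite B"
  shows "(\<Sum>b\<in>B. size {#X \<in># C. b \<in> X#}) = (\<Sum>X\<in>#C. card (B \<inter> X))"
proof (induction C)
  case (add X C)
  have "(\<Sum>b\<in>B. size {#Y \<in># add_mset X C. b \<in> Y#})
      = (\<Sum>b\<in>B. of_bool (b \<in> X) + size {#Y \<in># C. b \<in> Y#})"
    by (intro sum.cong) auto
  also have "\<dots> = card (B \<inter> X) + (\<Sum>b\<in>B. size {#Y \<in># C. b \<in> Y#})"
    using assms by (simp add: sum.distrib Int_def)
  finally show ?case using add by simp
qed simp

lemma sum_weights:
  assumes "C \<in> column_systems w A" "finite A" "B \<subseteq> A"
  shows "(\<Sum>b\<in>B. w b) = (\<Sum>X\<in>#C. card (B \<inter> X))"
proof -
  have "(\<Sum>b\<in>B. w b) = (\<Sum>b\<in>B. size {#X \<in># C. b \<in> X#})"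
    using assms by (intro sum.cong) (auto simp: column_systems_def)
  thus ?thesis using sum_mset_card_Int[of B C] finite_subset[OF assms(3,2)] by simp
qed

lemma sum_lengths:
  assumes "C \<in> column_systems w A" "finite A"
  shows "sum_mset (lengths C) = (\<Sum>b\<in>A. w b)"
proof -
  have "(\<Sum>X\<in>#C. card (A \<inter> X)) = (\<Sum>X\<in>#C. card X)"
    using assms by (intro arg_cong[where f = sum_mset] image_mset_cong) (auto simp: column_systems_def Int_absorb1)
  thus ?thesis using sum_weights[OF assms] by simp
qed

lemma profile_image_mset: "profile (image_mset f C) i = (\<Sum>X\<in>#C. min i (f X))"
  by (induction C) auto

lemma finite_column: "C \<in> column_systems w A \<Longrightarrow> finite A \<Longrightarrow> X \<in># C \<Longrightarrow> finite X"
  by (auto simp: column_systems_def intro: finite_subset)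

text \<open>
  If no column repeats a value, then \<open>i\<close> values occur at most \<open>min i (card X)\<close> times in a column \<open>X\<close>.
\<close>

lemma point_type_le_profile:
  assumes C: "C \<in> column_systems w A" and A: "finite A" and inj: "\<And>X. X \<in># C \<Longrightarrow> inj_on a X"
  shows "point_type w A a i \<le> profile (lengths C) i"
proof -
  obtain W where W: "finite W" "card W \<le> i" "sum (class_size w A a) W = top_sum (class_size w A a) i"
    by (rule top_sum_attained[OF finite_class_size[OF A]])
  have "point_type w A a i = (\<Sum>b\<in>{b \<in> A. a b \<in> W}. w b)"
    unfolding point_type_def W(3)[symmetric] by (rule sum_class_size[OF A W(1)])
  also have "\<dots> = (\<Sum>X\<in>#C. card ({b \<in> A. a b \<in> W} \<inter> X))"
    by (rule sum_weights[OF C A]) auto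
  also have "\<dots> \<le> (\<Sum>X\<in>#C. min i (card X))"
  proof (rule sum_mset_mono)
    fix X assume X: "X \<in># C"
    have "finite X" using finite_column[OF C A X] .
    have "card ({b \<in> A. a b \<in> W} \<inter> X) = card (a ` ({b \<in> A. a b \<in> W} \<inter> X))"
      using inj[OF X] by (simp add: card_image inj_on_subset)
    also have "\<dots> \<le> card W" using W by (intro card_mono) auto
    finally show "card ({b \<in> A. a b \<in> W} \<inter> X) \<le> min i (card X)"
      using W card_mono[OF \<open>finite X\<close>, of "{b \<in> A. a b \<in> W} \<inter> X"] by simp
  qed
  finally show ?thesis by (simp add: profile_image_mset)
qed

section \<open>Evaluation of polynomials and leading coefficients\<close>

definition mon_eval :: "(nat \<Rightarrow> 'b::comm_ring_1) \<Rightarrow> monomial \<Rightarrow> 'b" where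
  "mon_eval a m = (\<Prod>i\<in>keys m. a i ^ lookup m i)"

lemma mon_eval_superset:
  "finite B \<Longrightarrow> keys m \<subseteq> B \<Longrightarrow> mon_eval a m = (\<Prod>i\<in>B. a i ^ lookup m i)"
  unfolding mon_eval_def by (rule prod.mono_neutral_left) (auto simp: in_keys_iff)

lemma mon_eval_add: "mon_eval a (m + m') = mon_eval a m * mon_eval a m'"
proof -
  let ?B = "keys m \<union> keys m'"
  have "mon_eval a (m + m') = (\<Prod>i\<in>?B. a i ^ lookup (m + m') i)"
    by (rule mon_eval_superset) (auto simp: keys_add)
  also have "\<dots> = (\<Prod>i\<in>?B. a i ^ lookup m i) * (\<Prod>i\<in>?B. a i ^ lookup m' i)"
    by (simp add: lookup_add power_add prod.distrib)
  also have "\<dots> = mon_eval a m * mon_eval a m'" by (simp add: mon_eval_superset[of ?B])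
  finally show ?thesis .
qed

lemma mon_eval_zero [simp]: "mon_eval a 0 = 1"
  by (simp add: mon_eval_def)

lemma mon_eval_single [simp]: "mon_eval a (Poly_Mapping.single v k) = a v ^ k"
  by (cases "k = 0") (auto simp: mon_eval_def)

lemma poly_mapping_sum_singles:
  "p = (\<Sum>m\<in>keys p. Poly_Mapping.single m (lookup p m))"
proof (rule poly_mapping_eqI)
  fix k
  show "lookup p k =
      lookup (\<Sum>m\<in>keys p. Poly_Mapping.single m (lookup p m)) k"
    by (cases "k \<in> keys p")
      (auto simp: lookup_sum lookup_single when_def in_keys_iff sum.delta')
qed

lemma nonzero_has_key: "p \<noteq> 0 \<Longrightarrow> \<exists>m. m \<in> keys p"
  by (metis in_keys_iff lookup_zero poly_mapping_eqI)

text \<open>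
  Evaluation at values in another ring. It is used both for values in the coefficient field and, with
  constant polynomials as coefficients, for keeping one variable as an indeterminate.
\<close>

locale coeff_hom =
  fixes h :: "'k::comm_ring_1 \<Rightarrow> 'b::comm_ring_1"
  assumes hom_0: "h 0 = 0" and hom_1: "h 1 = 1"
    and hom_add: "h (x + y) = h x + h y" and hom_mult: "h (x * y) = h x * h y"
begin

definition peval :: "(nat \<Rightarrow> 'b) \<Rightarrow> 'k mpoly \<Rightarrow> 'b" where
  "peval a p = (\<Sum>m\<in>keys p. h (lookup p m) * mon_eval a m)"

lemma peval_superset:
  "finite B \<Longrightarrow> keys p \<subseteq> B \<Longrightarrow>
    peval a p = (\<Sum>m\<in>B. h (lookup p m) * mon_eval a m)"
  unfolding peval_def by (rule sum.mono_neutral_left) (auto simp: in_keys_iff hom_0)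

lemma peval_add: "peval a (p + q) = peval a p + peval a q"
proof -
  let ?B = "keys p \<union> keys q"
  have "peval a (p + q) = (\<Sum>m\<in>?B. h (lookup (p + q) m) * mon_eval a m)"
    by (rule peval_superset) (auto simp: keys_add)
  also have "\<dots> = (\<Sum>m\<in>?B. h (lookup p m) * mon_eval a m)
      + (\<Sum>m\<in>?B. h (lookup q m) * mon_eval a m)"
    by (simp add: lookup_add hom_add distrib_right sum.distrib)
  also have "\<dots> = peval a p + peval a q" by (simp add: peval_superset[of ?B])
  finally show ?thesis .
qed

lemma peval_zero [simp]: "peval a 0 = 0"
  by (simp add: peval_def)

lemma peval_single [simp]: "peval a (Poly_Mapping.single m c) = h c * mon_eval a m"
  by (cases "c = 0") (auto simp: peval_def hom_0)

lemma peval_one [simp]: "peval a 1 = 1"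
  using peval_single[of a 0 1] by (simp add: single_one hom_1)

lemma peval_sum: "peval a (sum f B) = (\<Sum>x\<in>B. peval a (f x))"
  by (induction B rule: infinite_finite_induct) (auto simp: peval_add)

lemma peval_mult: "peval a (p * q) = peval a p * peval a q"
proof -
  have sing: "peval a (Poly_Mapping.single m c * q) = h c * mon_eval a m * peval a q" for m c
  proof -
    have "Poly_Mapping.single m c * q = (\<Sum>m'\<in>keys q.
        Poly_Mapping.single (m + m') (c * lookup q m'))"
      by (subst poly_mapping_sum_singles[of q]) (simp add: sum_distrib_left mult_single)
    thus ?thesis
      by (simp add: peval_sum mon_eval_add hom_mult peval_def[of a q] sum_distrib_left mult_ac)
  qed
  have "p * q = (\<Sum>m\<in>keys p. Poly_Mapping.single m (lookup p m) * q)"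
    by (subst poly_mapping_sum_singles[of p]) (simp add: sum_distrib_right)
  thus ?thesis by (simp add: peval_sum sing peval_def[of a p] sum_distrib_right)
qed

lemma peval_uminus: "peval a (- p) = - peval a p"
proof -
  have "peval a p + peval a (- p) = 0" using peval_add[of a p "- p"] by simp
  thus ?thesis by (rule minus_unique[symmetric])
qed

lemma peval_diff: "peval a (p - q) = peval a p - peval a q"
  using peval_add[of a p "- q"] by (simp only: peval_uminus add_uminus_conv_diff)

lemma peval_prod: "peval a (prod f B) = (\<Prod>x\<in>B. peval a (f x))"
  by (induction B rule: infinite_finite_induct) (auto simp: peval_mult)

lemma peval_prod_mset: "peval a (\<Prod>x\<in>#M. f x) = (\<Prod>x\<in>#M. peval a (f x))"
  by (induction M) (auto simp: peval_mult)

lemma peval_var [simp]: "peval a (var i) = a i"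
  by (simp add: var_def var_mon_def hom_1)

end

lemma coeff_hom_id: "coeff_hom (\<lambda>c :: 'k::comm_ring_1. c)"
  by (simp add: coeff_hom_def)

lemma coeff_hom_const: "coeff_hom (\<lambda>c :: 'k::comm_ring_1. [:c:])"
  by (simp add: coeff_hom_def one_pCons)

interpretation id_hom: coeff_hom "\<lambda>c :: 'k::comm_ring_1. c"
  by (rule coeff_hom_id)

interpretation const_hom: coeff_hom "\<lambda>c :: 'k::comm_ring_1. [:c:]"
  by (rule coeff_hom_const)

abbreviation eval_at :: "(nat \<Rightarrow> 'k::comm_ring_1) \<Rightarrow> 'k mpoly \<Rightarrow> 'k" where
  "eval_at \<equiv> id_hom.peval"

text \<open>
  All variables except \<open>v\<close> are evaluated, which leaves a univariate polynomial in \<open>v\<close>.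
\<close>

definition eval_except :: "nat \<Rightarrow> (nat \<Rightarrow> 'k::comm_ring_1) \<Rightarrow> 'k mpoly \<Rightarrow> 'k poly" where
  "eval_except v a = const_hom.peval (\<lambda>i. if i = v then [:0, 1:] else [:a i:])"

lemma poly_eval_except: "poly (eval_except v a f) x = eval_at (a(v := x)) f"
proof -
  have "poly (mon_eval (\<lambda>i. if i = v then [:0, 1:] else [:a i:]) m) x = mon_eval (a(v := x)) m" for m
    unfolding mon_eval_def poly_prod by (rule prod.cong) auto
  thus ?thesis
    unfolding eval_except_def const_hom.peval_def id_hom.peval_def by (simp add: poly_sum)
qed

definition drop_var :: "nat \<Rightarrow> monomial \<Rightarrow> monomial" where
  "drop_var v m = m - Poly_Mapping.single v (lookup m v)"

lemma lookup_drop_var: "lookup (drop_var v m) i = (if i = v then 0 else lookup m i)"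
  by (simp add: drop_var_def lookup_minus lookup_single when_def)

lemma drop_var_add: "m = drop_var v m + Poly_Mapping.single v (lookup m v)"
  by (rule poly_mapping_eqI) (simp add: lookup_add lookup_drop_var lookup_single when_def)

lemma keys_drop_var: "keys (drop_var v m) = keys m - {v}"
  by (auto simp: in_keys_iff lookup_drop_var split: if_splits)

lemma mon_eval_except:
  fixes a :: "nat \<Rightarrow> 'k::comm_ring_1"
  shows "mon_eval (\<lambda>i. if i = v then [:0, 1:] else [:a i:]) m
     = monom (mon_eval a (drop_var v m)) (lookup m v)"
proof -
  have c: "(\<Prod>i\<in>B. [:f i:]) = [:\<Prod>i\<in>B. f i:]" for B and f :: "nat \<Rightarrow> 'k"
    by (induction B rule: infinite_finite_induct) (auto simp: one_pCons)
  have "mon_eval (\<lambda>i. if i = v then [:0, 1:] else [:a i:]) (drop_var v m)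
      = (\<Prod>i\<in>keys (drop_var v m). [:a i ^ lookup (drop_var v m) i:])"
    unfolding mon_eval_def by (intro prod.cong refl) (auto simp: keys_drop_var poly_const_pow)
  also have "\<dots> = [:mon_eval a (drop_var v m):]" by (simp add: c mon_eval_def)
  finally have "mon_eval (\<lambda>i. if i = v then [:0, 1:] else [:a i:]) m
      = [:mon_eval a (drop_var v m):] * [:0, 1:] ^ lookup m v"
    by (subst drop_var_add[of m v]) (simp add: mon_eval_add)
  thus ?thesis by (simp add: monom_altdef)
qed

text \<open>
  The coefficient of the \<open>d\<close>-th power of the variable \<open>v\<close>, as a polynomial in the other variables.
\<close>

definition top_coeff :: "nat \<Rightarrow> nat \<Rightarrow> 'k::comm_ring_1 mpoly \<Rightarrow> 'k mpoly" where
  "top_coeff v d f = (\<Sum>m\<in>{m \<in> keys f. lookup m v = d}.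
     Poly_Mapping.single (drop_var v m) (lookup f m))"

lemma coeff_eval_except:
  "poly.coeff (eval_except v a f) d = eval_at a (top_coeff v d f)"
proof -
  have "poly.coeff (eval_except v a f) d = (\<Sum>m\<in>keys f.
      if lookup m v = d then lookup f m * mon_eval a (drop_var v m) else 0)"
    unfolding eval_except_def const_hom.peval_def
    by (auto simp: mon_eval_except coeff_sum intro!: sum.cong)
  also have "\<dots> = eval_at a (top_coeff v d f)"
    unfolding top_coeff_def id_hom.peval_sum id_hom.peval_single
    by (rule sum.mono_neutral_cong_right) auto
  finally show ?thesis .
qed

lemma keys_top_coeff:
  "keys (top_coeff v d f) = drop_var v ` {m \<in> keys f. lookup m v = d}"
proof -
  have inj: "m = m'" if "drop_var v m = drop_var v m'" "lookup m v = d" "lookup m' v = d" for m m'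
    using that drop_var_add[of m v] drop_var_add[of m' v] by simp
  have L: "lookup (top_coeff v d f) k = (\<Sum>m\<in>{m \<in> keys f. lookup m v = d}.
      if drop_var v m = k then lookup f m else 0)" for k
    by (auto simp: top_coeff_def lookup_sum lookup_single when_def intro!: sum.cong)
  show ?thesis
  proof (intro Set.set_eqI iffI)
    fix k assume "k \<in> keys (top_coeff v d f)"
    hence nz: "(\<Sum>m\<in>{m \<in> keys f. lookup m v = d}.
      if drop_var v m = k then lookup f m else 0) \<noteq> 0" by (simp add: in_keys_iff L)
    show "k \<in> drop_var v ` {m \<in> keys f. lookup m v = d}"
    proof (rule ccontr)
      assume "k \<notin> drop_var v ` {m \<in> keys f. lookup m v = d}"
      hence "(\<Sum>m\<in>{m \<in> keys f. lookup m v = d}.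
        if drop_var v m = k then lookup f m else 0) = 0"
        by (intro sum.neutral) auto
      thus False using nz by contradiction
    qed
  next
    fix k assume "k \<in> drop_var v ` {m \<in> keys f. lookup m v = d}"
    then obtain m where m: "m \<in> keys f" "lookup m v = d" "k = drop_var v m" by auto
    have "lookup (top_coeff v d f) k = (\<Sum>m'\<in>{m \<in> keys f. lookup m v = d}.
      if m' = m then lookup f m' else 0)"
      unfolding L using inj m by (intro sum.cong) auto
    also have "\<dots> = lookup f m" using m by (simp add: sum.delta)
    finally show "k \<in> keys (top_coeff v d f)" using m by (simp add: in_keys_iff)
  qed
qed

definition degree_in :: "nat \<Rightarrow> 'k::comm_ring_1 mpoly \<Rightarrow> nat" where
  "degree_in v f = Max ((\<lambda>m. lookup m v) ` keys f)"

lemma degree_in_ge: "m \<in> keys f \<Longrightarrow> lookup m v \<le> degree_in v f"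
  unfolding degree_in_def by (rule Max_ge) auto

lemma top_coeff_nonzero:
  assumes "f \<noteq> 0"
  shows "top_coeff v (degree_in v f) f \<noteq> 0"
proof -
  have "keys f \<noteq> {}" using nonzero_has_key[OF assms] by auto
  hence "degree_in v f \<in> (\<lambda>m. lookup m v) ` keys f"
    unfolding degree_in_def by (intro Max_in) auto
  hence "keys (top_coeff v (degree_in v f) f) \<noteq> {}" unfolding keys_top_coeff by auto
  thus ?thesis by auto
qed

lemma degree_eval_except: "degree (eval_except v a f) \<le> degree_in v f"
proof (rule degree_le, intro allI impI)
  fix i assume "degree_in v f < i"
  hence e: "{m \<in> keys f. lookup m v = i} = {}" using degree_in_ge[of _ f v] by fastforce
  show "poly.coeff (eval_except v a f) i = 0"
    unfolding coeff_eval_except top_coeff_def e by simp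
qed

section \<open>Polynomials vanishing outside a set of types\<close>

text \<open>
  The exponent of the variable \<open>a\<close> in the initial monomial of the Specht polynomial of \<open>C\<close>: a difference
  of two variables in a column contributes the larger one.
\<close>

definition lead_exp :: "(nat \<Rightarrow> nat \<Rightarrow> bool) \<Rightarrow> nat set multiset \<Rightarrow> nat \<Rightarrow> nat" where
  "lead_exp lt C a = (\<Sum>X\<in>#C. if a \<in> X then card {b \<in> X. lt b a} else 0)"

lemma lead_exp_add_mset [simp]:
  "lead_exp lt (add_mset X C) a = (if a \<in> X then card {b \<in> X. lt b a} else 0) + lead_exp lt C a"
  by (simp add: lead_exp_def)

lemma lead_exp_notin: "C \<in> column_systems w A \<Longrightarrow> a \<notin> A \<Longrightarrow> lead_exp lt C a = 0"
  unfolding lead_exp_def column_systems_def by (auto intro!: sum_mset.neutral)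

lemma column_systems_empty_column:
  "add_mset {} C \<in> column_systems w A \<longleftrightarrow> C \<in> column_systems w A"
  by (auto simp: column_systems_def)

lemma column_systems_insert:
  assumes C: "add_mset X C \<in> column_systems w A" and v: "v \<notin> A" "w v = 1"
  shows "add_mset (insert v X) C \<in> column_systems w (insert v A)"
proof -
  have "{#Y \<in># C. v \<in> Y#} = {#Y \<in># C. False#}"
    using C v(1) by (intro filter_mset_cong) (auto simp: column_systems_def)
  moreover have "size {#Y \<in># add_mset (insert v X) C. a \<in> Y#} = w a" if "a \<in> A" for a
  proof -
    have "a \<noteq> v" using that v by auto
    thus ?thesis using C that by (auto simp: column_systems_def)
  qed
  ultimately show ?thesis using C v by (auto simp: column_systems_def)
qed

lemma lead_exp_insert:
  assumes C: "add_mset X C \<in> column_systems w A" and A: "finite A" and v: "v \<notin> A"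
    and lt: "\<And>b. b \<in> A \<Longrightarrow> lt b v \<and> \<not> lt v b" "\<not> lt v v"
  shows "lead_exp lt (add_mset (insert v X) C) a
    = lead_exp lt (add_mset X C) a + (if a = v then card X else 0)"
proof -
  have XA: "X \<subseteq> A" and CA: "C \<in> column_systems (\<lambda>a. size {#Y \<in># C. a \<in> Y#}) A"
    using C by (auto simp: column_systems_def)
  show ?thesis
  proof (cases "a = v")
    case True
    have "{b \<in> insert v X. lt b v} = X" using XA lt by auto
    moreover have "lead_exp lt C v = 0" by (rule lead_exp_notin[OF CA v])
    ultimately show ?thesis using True XA v by auto
  next
    case False
    have "{b \<in> insert v X. lt b a} = {b \<in> X. lt b a}" if "a \<in> X" using that XA lt by auto
    thus ?thesis using False by auto
  qed
qed

lemma class_size_update: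
  assumes "finite A" "v \<notin> A" "w v = 1"
  shows "class_size w (insert v A) (a(v := x)) y = class_size w A a y + of_bool (y = x)"
proof -
  have "{b \<in> insert v A. (a(v := x)) b = y} = (if y = x then insert v {b \<in> A. a b = y} else {b \<in> A. a b = y})"
    using assms by auto
  thus ?thesis using assms by (simp add: class_size_def)
qed

text \<open>
  Here \<open>\<Phi>\<close> describes a lower set of shapes. The variables are split off from the largest one
  downwards. Only the smallest variable may have a weight other than 1, since the argument for a
  split-off variable adds a single box to the type of a point.
\<close>

lemma vanishing_contains_lead_exp:
  fixes f :: "'k::field mpoly"
  assumes K: "infinite (UNIV :: 'k set)"
    and "distinct (v0 # vs)" and "sorted_wrt lt (v0 # vs)" and asym: "\<And>a b. lt a b \<Longrightarrow> \<not> lt b a"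
    and "\<And>v. v \<in> set vs \<Longrightarrow> w v = 1"
    and "\<And>p q. \<Phi> p \<Longrightarrow> (\<And>i. q i \<le> p i) \<Longrightarrow> \<Phi> q"
    and "\<And>m. m \<in> keys f \<Longrightarrow> keys m \<subseteq> set (v0 # vs)" and "f \<noteq> 0"
    and "\<And>a. \<not> \<Phi> (point_type w (set (v0 # vs)) a) \<Longrightarrow> eval_at a f = 0"
  shows "\<exists>C \<in> column_systems w (set (v0 # vs)). \<Phi> (profile (lengths C)) \<and>
    (\<exists>m \<in> keys f. \<forall>a. lead_exp lt C a \<le> lookup m a)"
  using assms(2,3,5-)
proof (induction vs arbitrary: f \<Phi> rule: rev_induct)
  case Nil
  define C where "C = replicate_mset (w v0) {v0}"
  have "{#X \<in># replicate_mset k {v0}. v0 \<in> X#} = replicate_mset k {v0}" for k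
    by (induction k) auto
  hence C: "C \<in> column_systems w {v0}" by (auto simp: C_def column_systems_def)
  have lead: "lead_exp lt C a = 0" for a
  proof -
    have "\<not> lt v0 v0" using asym by blast
    hence "{b. b = v0 \<and> lt b v0} = {}" by auto
    thus ?thesis by (auto simp: C_def lead_exp_def)
  qed
  obtain m where m: "m \<in> keys f"
    using nonzero_has_key[OF Nil.prems(6)] by auto
  have "\<exists>a. \<Phi> (point_type w {v0} (a :: nat \<Rightarrow> 'k))"
  proof (rule ccontr)
    assume no: "\<not> ?thesis"
    have "eval_except v0 (\<lambda>_. 0) f = 0"
    proof (rule ccontr)
      have "poly (eval_except v0 (\<lambda>_. 0) f) x = 0" for x
        unfolding poly_eval_except using Nil.prems(7) no by simp
      moreover assume "eval_except v0 (\<lambda>_. 0) f \<noteq> 0"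
      ultimately show False using poly_roots_finite[of "eval_except v0 (\<lambda>_. 0) f"] K by simp
    qed
    hence 0: "eval_at (\<lambda>_. 0) (top_coeff v0 (degree_in v0 f) f) = 0" by (simp add: coeff_eval_except[symmetric])
    define g where "g = top_coeff v0 (degree_in v0 f) f"
    have "k = 0" if "k \<in> keys g" for k
    proof -
      obtain m where "m \<in> keys f" "k = drop_var v0 m"
        using \<open>k \<in> keys g\<close> by (auto simp: g_def keys_top_coeff)
      hence "keys k = {}" using Nil.prems(5)[of m] by (auto simp: keys_drop_var)
      thus ?thesis using poly_mapping_sum_singles[of k] by simp
    qed
    moreover have "g \<noteq> 0" unfolding g_def by (rule top_coeff_nonzero[OF Nil.prems(6)])
    ultimately have "keys g = {0}" using nonzero_has_key[of g] by blast
    hence "eval_at (\<lambda>_. 0) g = lookup g 0" "lookup g 0 \<noteq> 0"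
      by (auto simp: id_hom.peval_def in_keys_iff[symmetric])
    thus False using 0 by (simp add: g_def)
  qed
  then obtain a :: "nat \<Rightarrow> 'k" where a: "\<Phi> (point_type w {v0} a)" by auto
  have "profile (lengths C) i \<le> point_type w {v0} a i" for i
  proof (cases i)
    case 0
    have "profile (lengths C) 0 = 0" by (rule concave_profile_zero[OF concave_profile_profile])
    thus ?thesis using 0 by simp
  next
    case (Suc j)
    have "class_size w {v0} a (a v0) = w v0"
    proof -
      have "{b. b = v0 \<and> a b = a v0} = {v0}" by auto
      thus ?thesis by (simp add: class_size_def)
    qed
    hence "w v0 \<le> point_type w {v0} a i"
      using sum_le_top_sum[OF finite_class_size, of "{v0}" "{a v0}" i w a] Suc by (simp add: point_type_def)
    moreover have "profile (lengths C) i \<le> w v0" using profile_le_sum[of "lengths C" i]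
      by (simp add: C_def)
    ultimately show ?thesis by simp
  qed
  hence "\<Phi> (profile (lengths C))" using Nil.prems(4) a by blast
  moreover have "\<forall>a. lead_exp lt C a \<le> lookup m a" using lead by simp
  ultimately show ?case using C m by auto
next
  case (snoc v vs)
  define A where "A = set (v0 # vs)"
  have A: "finite A" "v \<notin> A" "set (v0 # vs @ [v]) = insert v A" and wv: "w v = 1"
    using snoc.prems(1,3) by (auto simp: A_def)
  have lt: "lt b v" "\<not> lt v b" if "b \<in> A" for b
    using that snoc.prems(2) asym by (auto simp: A_def sorted_wrt_append)
  have ltv: "\<not> lt v v" using asym by blast
  define d where "d = degree_in v f"
  define g where "g = top_coeff v d f"
  \<comment> \<open>The shapes that remain allowed after a box has been added to row \<open>d\<close>, closed downwards.\<close>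
  define \<Psi> where "\<Psi> = (\<lambda>q. \<exists>p. concave_profile p \<and> (\<forall>i. q i \<le> p i) \<and> \<Phi> (add_box d p))"
  have "\<exists>C \<in> column_systems w (set (v0 # vs)). \<Psi> (profile (lengths C)) \<and>
    (\<exists>m \<in> keys g. \<forall>a. lead_exp lt C a \<le> lookup m a)"
  proof (rule snoc.IH)
    show "distinct (v0 # vs)" "sorted_wrt lt (v0 # vs)" using snoc.prems(1,2) by (auto simp: sorted_wrt_append)
    show "w v = 1" if "v \<in> set vs" for v using snoc.prems(3) that by auto
    show "\<Psi> q" if "\<Psi> p" "\<And>i. q i \<le> p i" for p q using that unfolding \<Psi>_def by (meson order_trans)
    show "keys m \<subseteq> set (v0 # vs)" if mg: "m \<in> keys g" for m
    proof -
      obtain m' where "m' \<in> keys f" "m = drop_var v m'"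
        using mg by (auto simp: g_def keys_top_coeff)
      thus ?thesis using snoc.prems(5)[of m'] A by (auto simp: keys_drop_var A_def)
    qed
    show "g \<noteq> 0" unfolding g_def d_def by (rule top_coeff_nonzero[OF snoc.prems(6)])
    fix a :: "nat \<Rightarrow> 'k"
    assume "\<not> \<Psi> (point_type w (set (v0 # vs)) a)"
    hence n\<Psi>: "\<not> \<Psi> (point_type w A a)" by (simp add: A_def)
    define s where "s = class_size w A a"
    have fin: "finite {x. s x \<noteq> 0}" unfolding s_def by (rule finite_class_size[OF A(1)])
    have "concave_profile (top_sum s)" by (rule concave_profile_top_sum[OF fin])
    hence n\<Phi>: "\<not> \<Phi> (add_box d (top_sum s))" using n\<Psi> unfolding \<Psi>_def point_type_def s_def by auto
    obtain xs where xs: "length xs = Suc d" "distinct xs" "\<And>i. i < Suc d \<Longrightarrow> s (xs ! i) = gap (top_sum s) i"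
      using top_sum_enumeration[OF fin K, of "Suc d"] by auto
    have root: "poly (eval_except v a f) x = 0" if xxs: "x \<in> set xs" for x
    proof -
      obtain i where i: "i < Suc d" "x = xs ! i" using xxs xs(1) by (auto simp: in_set_conv_nth)
      have "gap (top_sum s) d \<le> s x"
        using i xs(3) gap_antimono[OF \<open>concave_profile (top_sum s)\<close>, of i d] by simp
      hence "add_box d (top_sum s) i \<le> point_type w (insert v A) (a(v := x)) i" for i
        unfolding point_type_def s_def
        by (intro top_sum_add_point[OF fin[unfolded s_def] class_size_update[of A v w, OF A(1,2) wv]])
      hence "\<not> \<Phi> (point_type w (insert v A) (a(v := x)))" using n\<Phi> snoc.prems(4) by blast
      thus ?thesis using snoc.prems(7) A(3) by (simp add: poly_eval_except)
    qed
    have "eval_except v a f = 0"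
    proof (rule poly_eqI_degree)
      show "poly (eval_except v a f) x = poly 0 x" if "x \<in> set xs" for x using root that by simp
      have "card (set xs) = Suc d" using xs distinct_card by metis
      thus "degree (eval_except v a f) < card (set xs)" "degree (0 :: 'k poly) < card (set xs)"
        using degree_eval_except[of v a f] by (auto simp: d_def)
    qed
    thus "eval_at a g = 0" unfolding g_def by (simp add: coeff_eval_except[symmetric])
  qed
  then obtain C m' where C: "C \<in> column_systems w A" and \<Psi>C: "\<Psi> (profile (lengths C))"
    and m': "m' \<in> keys g" "\<And>a. lead_exp lt C a \<le> lookup m' a"
    unfolding A_def by auto
  obtain m where m: "m \<in> keys f" "lookup m v = d" "m' = drop_var v m"
    using m'(1) by (auto simp: g_def keys_top_coeff)
  define L where "L = insert 0 {c \<in> set_mset (lengths C). c \<le> d}"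
  \<comment> \<open>The new variable is appended to a longest column among those of length at most \<open>d\<close>.\<close>
  define d0 where "d0 = Max L"
  have "finite L" "L \<noteq> {}" by (auto simp: L_def)
  hence "d0 \<in> L" unfolding d0_def by (rule Max_in)
  hence d0: "d0 \<le> d" "d0 = 0 \<or> d0 \<in># lengths C" by (auto simp: L_def)
  have d0_max: "c \<le> d0" if "c \<in># lengths C" "c \<le> d" for c
    unfolding d0_def using \<open>finite L\<close> that by (intro Max_ge) (auto simp: L_def)
  have "\<exists>X. card X = d0 \<and> (X \<in># C \<or> X = {})"
  proof (cases "d0 = 0")
    case True
    thus ?thesis by (intro exI[of _ "{}"]) simp
  next
    case False
    thus ?thesis using d0(2) by auto
  qed
  then obtain X where X: "card X = d0" "X \<in># C \<or> X = {}" by blast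
  define C0 where "C0 = C - {#X#}"
  define C1 where "C1 = add_mset X C0"
  have "C1 = C \<or> C1 = add_mset {} C"
    using X(2) by (cases "X \<in># C") (auto simp: C1_def C0_def)
  hence C1: "C1 \<in> column_systems w A" and prof1: "profile (lengths C1) = profile (lengths C)"
    and lead1: "lead_exp lt C1 = lead_exp lt C"
    using C column_systems_empty_column[of C w A] by auto
  have finX: "finite X" using C1 A(1) finite_column[of C1 w A X] by (simp add: C1_def)
  have vX: "v \<notin> X" using C1 A(2) by (auto simp: C1_def column_systems_def)
  define C2 where "C2 = add_mset (insert v X) C0"
  have "C2 \<in> column_systems w (insert v A)"
    unfolding C2_def using column_systems_insert C1 A wv by (simp add: C1_def)
  moreover have "\<Phi> (profile (lengths C2))"
  proof -
    obtain p where p: "concave_profile p" "\<And>i. profile (lengths C) i \<le> p i" "\<Phi> (add_box d p)"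
      using \<Psi>C by (auto simp: \<Psi>_def)
    have "profile (lengths C2) i \<le> add_box d p i" for i
    proof -
      have "profile (lengths C2) i = profile (lengths C1) i + of_bool (d0 < i)"
        using finX vX X(1) by (auto simp: C1_def C2_def min_def)
      also have "\<dots> = add_box d (profile (lengths C)) i"
        using profile_add_box[OF d0(1) d0_max d0(2)] prof1 by simp
      also have "\<dots> \<le> add_box d p i" by (rule add_box_mono[OF p(1) concave_profile_profile p(2)])
      finally show ?thesis .
    qed
    thus ?thesis using snoc.prems(4) p(3) by blast
  qed
  moreover have "lead_exp lt C2 a \<le> lookup m a" for a
  proof -
    have "lead_exp lt C2 a = lead_exp lt C a + (if a = v then d0 else 0)"
      unfolding C2_def lead1[symmetric] unfolding C1_def X(1)[symmetric]
      by (rule lead_exp_insert[OF C1[unfolded C1_def] A(1,2)]) (use lt ltv in auto)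
    also have "\<dots> \<le> lookup m' a + (if a = v then d else 0)" using m'(2)[of a] d0(1) by (cases "a = v") auto
    also have "\<dots> = lookup m a" using m by (simp add: lookup_drop_var)
    finally show ?thesis .
  qed
  ultimately show ?case using A(3) m(1) by auto
qed

section \<open>Ideals of the polynomial ring\<close>

lemma carrier_poly_ring: "carrier (poly_ring n) = {p. keys p \<subseteq> monomials n}"
  by (simp add: poly_ring_def)

lemma poly_ring_simps:
  "x \<otimes>\<^bsub>poly_ring n\<^esub> y = x * y" "x \<oplus>\<^bsub>poly_ring n\<^esub> y = x + y"
  "\<one>\<^bsub>poly_ring n\<^esub> = 1" "\<zero>\<^bsub>poly_ring n\<^esub> = 0"
  by (simp_all add: poly_ring_def)

lemma monomials_add: "a \<in> monomials n \<Longrightarrow> b \<in> monomials n \<Longrightarrow> a + b \<in> monomials n"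
  using keys_add[of a b] by (auto simp: monomials_def)

lemma monomials_zero: "0 \<in> monomials n"
  by (simp add: monomials_def)

lemma poly_ring_closed:
  fixes p q :: "'k::comm_ring_1 mpoly"
  assumes "p \<in> carrier (poly_ring n)" "q \<in> carrier (poly_ring n)"
  shows "p + q \<in> carrier (poly_ring n)" "p * q \<in> carrier (poly_ring n)" "- p \<in> carrier (poly_ring n)"
proof -
  show "p + q \<in> carrier (poly_ring n)"
    using assms keys_add[of p q] by (auto simp: carrier_poly_ring)
  show "p * q \<in> carrier (poly_ring n)"
    using assms keys_mult[of p q] by (fastforce simp: carrier_poly_ring intro: monomials_add)
  have "keys (- p) = keys p" by (auto simp: in_keys_iff)
  thus "- p \<in> carrier (poly_ring n)" using assms by (simp add: carrier_poly_ring)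
qed

lemma one_carrier: "(1 :: 'k::comm_ring_1 mpoly) \<in> carrier (poly_ring n)"
  by (auto simp: carrier_poly_ring monomials_zero)

lemma cring_poly_ring: "cring (poly_ring n :: 'k::comm_ring_1 mpoly ring)"
proof (rule cringI)
  have 0: "(0 :: 'k mpoly) \<in> carrier (poly_ring n)" and 1: "(1 :: 'k mpoly) \<in> carrier (poly_ring n)"
    by (auto simp: carrier_poly_ring monomials_zero)
  show "abelian_group (poly_ring n :: 'k mpoly ring)"
  proof (rule abelian_groupI, unfold poly_ring_simps)
    fix x :: "'k mpoly" assume x: "x \<in> carrier (poly_ring n)"
    show "\<exists>y\<in>carrier (poly_ring n). y + x = 0"
      using poly_ring_closed(3)[OF x x] by (intro bexI[of _ "- x"]) auto
  qed (auto simp: 0 poly_ring_closed algebra_simps)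
  show "comm_monoid (poly_ring n :: 'k mpoly ring)"
    by (rule comm_monoidI, unfold poly_ring_simps) (auto simp: 1 poly_ring_closed algebra_simps)
qed (auto simp: poly_ring_simps algebra_simps)

lemma ideal_poly_ring:
  fixes I :: "'k::comm_ring_1 mpoly set"
  assumes "ideal I (poly_ring n)"
  shows "0 \<in> I" "\<And>f g. f \<in> I \<Longrightarrow> g \<in> I \<Longrightarrow> f + g \<in> I" "\<And>f g. f \<in> I \<Longrightarrow> g \<in> I \<Longrightarrow> f - g \<in> I"
    "\<And>f c. f \<in> I \<Longrightarrow> c \<in> carrier (poly_ring n) \<Longrightarrow> c * f \<in> I" "I \<subseteq> carrier (poly_ring n)"
proof -
  interpret ideal I "poly_ring n" by (rule assms)
  show "0 \<in> I" using additive_subgroup.zero_closed[OF additive_subgroup_axioms] by (simp add: poly_ring_simps)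
  show add: "f + g \<in> I" if "f \<in> I" "g \<in> I" for f g using additive_subgroup.a_closed[OF additive_subgroup_axioms that] by (simp add: poly_ring_simps)
  show m: "c * f \<in> I" if "f \<in> I" "c \<in> carrier (poly_ring n)" for f c
    using I_l_closed[OF that] by (simp add: poly_ring_simps)
  show "I \<subseteq> carrier (poly_ring n)" by (rule a_subset)
  have "(- 1 :: 'k mpoly) \<in> carrier (poly_ring n)"
    using poly_ring_closed(3)[of "1 :: 'k mpoly" n 1] by (auto simp: carrier_poly_ring monomials_zero)
  hence "- g \<in> I" if "g \<in> I" for g using m[OF that, of "- 1"] by simp
  thus "f - g \<in> I" if "f \<in> I" "g \<in> I" for f g using add[of f "- g"] that by simp
qed

lemma ideal_sum:
  fixes I :: "'k::comm_ring_1 mpoly set"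
  assumes "ideal I (poly_ring n)" "\<And>i. i \<in> B \<Longrightarrow> f i \<in> I"
  shows "sum f B \<in> I"
  using assms(2) by (induction B rule: infinite_finite_induct) (auto intro: ideal_poly_ring[OF assms(1)])

lemma ideal_poly_ringI:
  fixes I :: "'k::comm_ring_1 mpoly set"
  assumes "I \<subseteq> carrier (poly_ring n)" "0 \<in> I" "\<And>f g. f \<in> I \<Longrightarrow> g \<in> I \<Longrightarrow> f + g \<in> I"
    "\<And>f c. f \<in> I \<Longrightarrow> c \<in> carrier (poly_ring n) \<Longrightarrow> c * f \<in> I"
  shows "ideal I (poly_ring n)"
proof -
  interpret cring "poly_ring n :: 'k mpoly ring" by (rule cring_poly_ring)
  have one: "(1 :: 'k mpoly) \<in> carrier (poly_ring n)" by (rule one_carrier)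
  show ?thesis
  proof (rule idealI)
    show "ring (poly_ring n :: 'k mpoly ring)" by (rule ring_axioms)
    show "subgroup I (add_monoid (poly_ring n))"
    proof (rule add.subgroupI)
      show "I \<subseteq> carrier (poly_ring n)" "I \<noteq> {}" using assms by auto
      fix a assume a: "a \<in> I"
      have "(- 1 :: 'k mpoly) \<in> carrier (poly_ring n)" using poly_ring_closed(3)[OF one one] .
      hence "- a \<in> I" using assms(4)[OF a, of "- 1"] by simp
      moreover have "\<ominus>\<^bsub>poly_ring n\<^esub> a = - a"
        using a assms(1) poly_ring_closed(3)[of a n a]
        by (intro minus_equality) (auto simp: poly_ring_simps)
      ultimately show "\<ominus>\<^bsub>poly_ring n\<^esub> a \<in> I" by simp
      fix b assume "b \<in> I"
      thus "a \<oplus>\<^bsub>poly_ring n\<^esub> b \<in> I" using a assms(3) by (simp add: poly_ring_simps)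
    qed
    fix a x :: "'k mpoly" assume a: "a \<in> I" and x: "x \<in> carrier (poly_ring n)"
    show "x \<otimes>\<^bsub>poly_ring n\<^esub> a \<in> I" "a \<otimes>\<^bsub>poly_ring n\<^esub> x \<in> I"
      using assms(4)[OF a x] by (simp_all add: poly_ring_simps mult.commute)
  qed
qed

lemma single_carrier: "m \<in> monomials n \<Longrightarrow> Poly_Mapping.single m c \<in> carrier (poly_ring n)"
  by (cases "c = 0") (auto simp: carrier_poly_ring)

lemma var_carrier: "i \<in> {1..n} \<Longrightarrow> var i \<in> carrier (poly_ring n)"
  unfolding var_def by (rule single_carrier) (simp add: monomials_def var_mon_def)

lemma prod_carrier:
  fixes f :: "'x \<Rightarrow> 'k::comm_ring_1 mpoly"
  shows "(\<And>i. i \<in> B \<Longrightarrow> f i \<in> carrier (poly_ring n)) \<Longrightarrow> prod f B \<in> carrier (poly_ring n)"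
  by (induction B rule: infinite_finite_induct)
    (auto intro: poly_ring_closed one_carrier)

lemma prod_mset_carrier:
  fixes f :: "'x \<Rightarrow> 'k::comm_ring_1 mpoly"
  shows "(\<And>i. i \<in># B \<Longrightarrow> f i \<in> carrier (poly_ring n)) \<Longrightarrow> (\<Prod>i\<in>#B. f i) \<in> carrier (poly_ring n)"
  by (induction B) (auto intro: poly_ring_closed one_carrier)

section \<open>Difference products\<close>

text \<open>
  Each difference is oriented so that its initial monomial has coefficient 1.
\<close>

definition difference_product :: "(nat \<Rightarrow> nat \<Rightarrow> bool) \<Rightarrow> nat set \<Rightarrow> 'k::comm_ring_1 mpoly" where
  "difference_product lt X = (\<Prod>a\<in>X. \<Prod>b\<in>{b \<in> X. lt b a}. var a - var b)"

definition system_poly :: "(nat \<Rightarrow> nat \<Rightarrow> bool) \<Rightarrow> nat set multiset \<Rightarrow> 'k::comm_ring_1 mpoly" where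
  "system_poly lt C = (\<Prod>X\<in>#C. difference_product lt X)"

lemma system_poly_simps [simp]:
  "system_poly lt {#} = 1"
  "system_poly lt (add_mset X C) = difference_product lt X * system_poly lt C"
  by (simp_all add: system_poly_def)

lemma difference_product_empty [simp]: "difference_product lt {} = 1"
  by (simp add: difference_product_def)

lemma difference_product_carrier:
  "X \<subseteq> {1..n} \<Longrightarrow> difference_product lt X \<in> carrier (poly_ring n)"
  unfolding difference_product_def diff_conv_add_uminus
  by (intro prod_carrier poly_ring_closed(1) poly_ring_closed(3)[OF var_carrier var_carrier] var_carrier) auto

lemma system_poly_carrier:
  "C \<in> column_systems w {1..n} \<Longrightarrow> system_poly lt C \<in> carrier (poly_ring n)"
  unfolding system_poly_def
  by (intro prod_mset_carrier difference_product_carrier) (auto simp: column_systems_def)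

lemma prod_up_to_sign:
  fixes f g :: "'x \<Rightarrow> 'b::comm_ring_1"
  assumes "\<And>x. x \<in> B \<Longrightarrow> f x = g x \<or> f x = - g x"
  shows "prod f B = prod g B \<or> prod f B = - prod g B"
  using assms
proof (induction B rule: infinite_finite_induct)
  case (insert x B)
  have "f x = g x \<or> f x = - g x" "prod f B = prod g B \<or> prod f B = - prod g B" using insert by auto
  thus ?case using insert.hyps by (elim disjE) simp_all
qed auto

lemma difference_product_insert:
  fixes lt :: "nat \<Rightarrow> nat \<Rightarrow> bool"
  assumes X: "finite X" and i: "i \<notin> X" and asym: "\<And>a b. lt a b \<Longrightarrow> \<not> lt b a"
    and tot: "\<And>a. a \<in> X \<Longrightarrow> lt a i \<or> lt i a"
  obtains e :: "'k::comm_ring_1 mpoly" where "e = 1 \<or> e = - 1"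
    "difference_product lt (insert i X) = e * (difference_product lt X * (\<Prod>j\<in>X. var i - var j))"
proof -
  have nii: "\<not> lt i i" using asym by blast
  define P :: "nat \<Rightarrow> 'k mpoly" where "P = (\<lambda>a. \<Prod>b\<in>{b \<in> X. lt b a}. var a - var b)"
  have "difference_product lt (insert i X)
      = (\<Prod>b\<in>{b \<in> insert i X. lt b i}. var i - var b) * (\<Prod>a\<in>X. \<Prod>b\<in>{b \<in> insert i X. lt b a}. var a - var b)"
    unfolding difference_product_def using X i by simp
  also have "{b \<in> insert i X. lt b i} = {b \<in> X. lt b i}" using nii by auto
  also have "(\<Prod>b\<in>{b \<in> X. lt b i}. var i - var b) = (\<Prod>b\<in>X. if lt b i then var i - var b else 1 :: 'k mpoly)"
    using X by (simp add: prod.If_cases Int_def)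
  also have "(\<Prod>a\<in>X. \<Prod>b\<in>{b \<in> insert i X. lt b a}. var a - var b)
      = (\<Prod>a\<in>X. (if lt i a then var a - var i else 1) * P a)"
  proof (rule prod.cong[OF refl])
    fix a assume "a \<in> X"
    have "{b \<in> insert i X. lt b a} = (if lt i a then insert i {b \<in> X. lt b a} else {b \<in> X. lt b a})" by auto
    thus "(\<Prod>b\<in>{b \<in> insert i X. lt b a}. var a - var b) = (if lt i a then var a - var i else 1) * P a"
      using X i by (simp add: P_def)
  qed
  also have "(\<Prod>b\<in>X. if lt b i then var i - var b else 1) * (\<Prod>a\<in>X. (if lt i a then var a - var i else 1) * P a)
      = difference_product lt X * (\<Prod>a\<in>X. (if lt a i then var i - var a else 1) * (if lt i a then var a - var i else 1))"
    by (simp add: prod.distrib difference_product_def P_def mult_ac)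
  finally have eq: "difference_product lt (insert i X) = difference_product lt X *
      (\<Prod>a\<in>X. (if lt a i then var i - var a else 1) * (if lt i a then var a - var i else 1) :: 'k mpoly)" .
  have "(\<Prod>a\<in>X. (if lt a i then var i - var a else 1) * (if lt i a then var a - var i else 1) :: 'k mpoly)
      = (\<Prod>a\<in>X. var i - var a) \<or>
    (\<Prod>a\<in>X. (if lt a i then var i - var a else 1) * (if lt i a then var a - var i else 1) :: 'k mpoly)
      = - (\<Prod>a\<in>X. var i - var a)"
    by (rule prod_up_to_sign) (use tot asym in \<open>auto dest: asym\<close>)
  thus ?thesis using that[of 1] that[of "- 1"] eq by auto
qed

lemma coeff_prod_linear:
  fixes f :: "'x \<Rightarrow> 'b::idom"
  assumes "finite B"
  shows "degree (\<Prod>j\<in>B. [:- f j, 1:]) = card B"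
    "poly.coeff (\<Prod>j\<in>B. [:- f j, 1:]) (card B) = 1"
proof -
  show d: "degree (\<Prod>j\<in>B. [:- f j, 1:]) = card B"
    by (subst degree_prod_eq_sum_degree) auto
  have "lead_coeff (\<Prod>j\<in>B. [:- f j, 1:]) = (\<Prod>j\<in>B. lead_coeff [:- f j, 1:])"
    by (rule lead_coeff_prod)
  thus "poly.coeff (\<Prod>j\<in>B. [:- f j, 1:]) (card B) = 1" unfolding d by simp
qed

lemma var_inj: "(var i :: 'k::comm_ring_1 mpoly) = var j \<Longrightarrow> i = j"
proof -
  assume "(var i :: 'k mpoly) = var j"
  hence "keys (var i :: 'k mpoly) = keys (var j :: 'k mpoly)" by simp
  hence "keys (var_mon i) = keys (var_mon j)" by (simp add: var_def)
  thus ?thesis by (simp add: var_mon_def)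
qed

text \<open>
  Lagrange interpolation of \<open>h\<close> at the variables of \<open>X\<close>, compared in the leading coefficient. Multiplying by
  the difference product of \<open>X\<close> clears the denominators, so the identity holds in the polynomial ring
  itself.
\<close>

lemma difference_product_interpolation:
  fixes lt :: "nat \<Rightarrow> nat \<Rightarrow> bool" and h :: "'k::idom mpoly poly"
  assumes X: "finite X" and asym: "\<And>a b. lt a b \<Longrightarrow> \<not> lt b a"
    and tot: "\<And>a b. a \<in> X \<Longrightarrow> b \<in> X \<Longrightarrow> a \<noteq> b \<Longrightarrow> lt a b \<or> lt b a"
    and deg: "degree h < card X"
  obtains e :: "nat \<Rightarrow> 'k mpoly" where "\<And>i. e i = 1 \<or> e i = - 1"
    "difference_product lt X * poly.coeff h (card X - 1)
      = (\<Sum>i\<in>X. e i * difference_product lt (X - {i}) * poly h (var i))"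
proof -
  have "\<exists>e :: 'k mpoly. (e = 1 \<or> e = - 1) \<and> (i \<in> X \<longrightarrow> difference_product lt X
      = e * (difference_product lt (X - {i}) * (\<Prod>j\<in>X - {i}. var i - var j)))" for i
  proof (cases "i \<in> X")
    case True
    obtain e :: "'k mpoly" where "e = 1 \<or> e = - 1" "difference_product lt (insert i (X - {i}))
        = e * (difference_product lt (X - {i}) * (\<Prod>j\<in>X - {i}. var i - var j))"
      by (rule difference_product_insert[of "X - {i}" i lt]) (use X asym tot True in auto)
    thus ?thesis using True by (auto simp: insert_absorb)
  qed auto
  then obtain e :: "nat \<Rightarrow> 'k mpoly" where e: "\<And>i. e i = 1 \<or> e i = - 1"
    and dp: "\<And>i. i \<in> X \<Longrightarrow> difference_product lt X
      = e i * (difference_product lt (X - {i}) * (\<Prod>j\<in>X - {i}. var i - var j))" by metis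
  define c where "c = (\<lambda>i. e i * difference_product lt (X - {i}) * poly h (var i))"
  \<comment> \<open>The interpolation polynomial, multiplied by the difference product.\<close>
  define Q where "Q = (\<Sum>i\<in>X. smult (c i) (\<Prod>j\<in>X - {i}. [:- var j, 1:]))"
  have degQ: "degree Q < card X"
  proof -
    have "degree Q \<le> card X - 1"
      unfolding Q_def
    proof (rule degree_sum_le[OF X])
      fix i assume "i \<in> X"
      have "degree (smult (c i) (\<Prod>j\<in>X - {i}. [:- var j, 1:])) \<le> card (X - {i})"
        using degree_smult_le[of "c i" "\<Prod>j\<in>X - {i}. [:- var j, 1:]"]
          coeff_prod_linear(1)[of "X - {i}" "var :: nat \<Rightarrow> 'k mpoly"] X by (simp only: finite_Diff)
      thus "degree (smult (c i) (\<Prod>j\<in>X - {i}. [:- var j, 1:])) \<le> card X - 1"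
        using X \<open>i \<in> X\<close> by simp
    qed
    thus ?thesis using deg by simp
  qed
  have "Q = smult (difference_product lt X) h"
  proof (rule poly_eqI_degree)
    fix x assume "x \<in> (var ` X :: 'k mpoly set)"
    then obtain k where k: "k \<in> X" "x = var k" by auto
    have "poly Q x = (\<Sum>i\<in>X. c i * (\<Prod>j\<in>X - {i}. x - var j))"
      by (simp add: Q_def poly_sum poly_prod)
    also have "\<dots> = (\<Sum>i\<in>X. if i = k then c k * (\<Prod>j\<in>X - {k}. x - var j) else 0)"
    proof (rule sum.cong[OF refl])
      fix i assume "i \<in> X"
      have "(\<Prod>j\<in>X - {i}. x - var j) = 0" if "i \<noteq> k"
        using X k that by (intro prod_zero) (auto intro!: bexI[of _ k])
      thus "c i * (\<Prod>j\<in>X - {i}. x - var j) = (if i = k then c k * (\<Prod>j\<in>X - {k}. x - var j) else 0)" by auto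
    qed
    also have "\<dots> = c k * (\<Prod>j\<in>X - {k}. var k - var j)" using X k by simp
    also have "\<dots> = difference_product lt X * poly h x"
      unfolding dp[OF k(1)] c_def k(2) by (simp add: mult_ac)
    finally show "poly Q x = poly (smult (difference_product lt X) h) x" by simp
  next
    have "card (var ` X :: 'k mpoly set) = card X" by (rule card_image) (auto intro: inj_onI var_inj)
    thus "degree Q < card (var ` X :: 'k mpoly set)"
      "degree (smult (difference_product lt X) h) < card (var ` X :: 'k mpoly set)"
      using degQ deg degree_smult_le[of "difference_product lt X" h] by auto
  qed
  hence "difference_product lt X * poly.coeff h (card X - 1) = poly.coeff Q (card X - 1)" by simp
  also have "\<dots> = (\<Sum>i\<in>X. c i)"
  proof -
    have "poly.coeff (\<Prod>j\<in>X - {i}. [:- var j, 1 :: 'k mpoly:]) (card X - 1) = 1" if "i \<in> X" for i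
      using coeff_prod_linear(2)[of "X - {i}" "var :: nat \<Rightarrow> 'k mpoly"] X that by simp
    thus ?thesis by (simp add: Q_def coeff_sum)
  qed
  finally show ?thesis using that[of e] e by (simp add: c_def)
qed

text \<open>
  Interpolate the polynomial \<open>h\<close> that has degree \<open>card X - 1\<close>, leading coefficient 1, and the variables of \<open>Y\<close>
  among its roots. Each summand moves one entry from \<open>X\<close> to \<open>Y\<close>, and the entries of \<open>Y\<close> itself
  drop out. This is why an index that is common to both columns stays in both.
\<close>

lemma difference_product_exchange:
  fixes lt :: "nat \<Rightarrow> nat \<Rightarrow> bool"
  assumes X: "finite X" and Y: "finite Y" and asym: "\<And>a b. lt a b \<Longrightarrow> \<not> lt b a"
    and tot: "\<And>a b. a \<in> X \<union> Y \<Longrightarrow> b \<in> X \<union> Y \<Longrightarrow> a \<noteq> b \<Longrightarrow> lt a b \<or> lt b a"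
    and card: "card Y < card X"
  obtains e :: "nat \<Rightarrow> 'k::idom mpoly" where "\<And>i. e i = 1 \<or> e i = - 1"
    "difference_product lt X * difference_product lt Y = (\<Sum>i\<in>X - Y. e i * var i ^ (card X - 1 - card Y) *
        (difference_product lt (X - {i}) * difference_product lt (insert i Y)))"
proof -
  define k where "k = card X - 1 - card Y"
  \<comment> \<open>The power of the indeterminate only brings \<open>h\<close> to the degree \<open>card X - 1\<close>.\<close>
  define h :: "'k mpoly poly" where "h = (\<Prod>y\<in>Y. [:- var y, 1:]) * monom 1 k"
  have hx: "poly h x = (\<Prod>y\<in>Y. x - var y) * x ^ k" for x
    by (simp add: h_def poly_prod poly_monom)
  have kc: "card X - 1 = card Y + k" using card by (simp add: k_def)
  have "poly.coeff h (card X - 1) = 1"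
    unfolding h_def kc using coeff_prod_linear(2)[OF Y, of "var :: nat \<Rightarrow> 'k mpoly"]
    by (simp add: mult.commute[of _ "monom 1 k"] coeff_monom_mult)
  have "degree h \<le> card Y + k"
    unfolding h_def using degree_mult_le[of "\<Prod>y\<in>Y. [:- var y, 1 :: 'k mpoly:]" "monom 1 k"]
      coeff_prod_linear(1)[OF Y, of "var :: nat \<Rightarrow> 'k mpoly"] degree_monom_le[of "1 :: 'k mpoly" k] by simp
  hence "degree h < card X" using kc card by simp
  from difference_product_interpolation[of X lt h, OF X asym _ this] tot
  obtain e :: "nat \<Rightarrow> 'k mpoly" where e: "\<And>i. e i = 1 \<or> e i = - 1"
    and eq: "difference_product lt X * poly.coeff h (card X - 1)
      = (\<Sum>i\<in>X. e i * difference_product lt (X - {i}) * poly h (var i))" by blast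
  have "\<exists>d :: 'k mpoly. (d = 1 \<or> d = - 1) \<and> (i \<in> X - Y \<longrightarrow>
      difference_product lt (insert i Y) = d * (difference_product lt Y * (\<Prod>j\<in>Y. var i - var j)))" for i
  proof (cases "i \<in> X - Y")
    case True
    obtain d :: "'k mpoly" where "d = 1 \<or> d = - 1"
      "difference_product lt (insert i Y) = d * (difference_product lt Y * (\<Prod>j\<in>Y. var i - var j))"
    proof (rule difference_product_insert[of Y i lt])
      show "lt a i \<or> lt i a" if "a \<in> Y" for a using tot[of a i] True that by auto
    qed (use Y asym True in auto)
    thus ?thesis by blast
  qed auto
  then obtain d :: "nat \<Rightarrow> 'k mpoly" where d: "\<And>i. d i = 1 \<or> d i = - 1"
    and dp: "\<And>i. i \<in> X - Y \<Longrightarrow>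
      difference_product lt (insert i Y) = d i * (difference_product lt Y * (\<Prod>j\<in>Y. var i - var j))" by metis
  have dd: "d i * d i = 1" for i using d[of i] by auto
  have "difference_product lt X * difference_product lt Y
      = (\<Sum>i\<in>X. e i * difference_product lt (X - {i}) * poly h (var i) * difference_product lt Y)"
    using eq \<open>poly.coeff h (card X - 1) = 1\<close> by (simp add: sum_distrib_right)
  also have "\<dots> = (\<Sum>i\<in>X - Y. e i * difference_product lt (X - {i}) * poly h (var i) * difference_product lt Y)"
  proof (rule sum.mono_neutral_right[OF X])
    have "poly h (var i) = 0" if "i \<in> Y" for i
      unfolding hx using Y that by auto
    thus "\<forall>i\<in>X - (X - Y). e i * difference_product lt (X - {i}) * poly h (var i) * difference_product lt Y = 0" by auto
  qed auto
  also have "\<dots> = (\<Sum>i\<in>X - Y. (e i * d i) * var i ^ k *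
        (difference_product lt (X - {i}) * difference_product lt (insert i Y)))"
  proof (rule sum.cong[OF refl])
    fix i assume i: "i \<in> X - Y"
    have "(e i * d i) * var i ^ k * (difference_product lt (X - {i}) * difference_product lt (insert i Y))
      = (d i * d i) * (e i * difference_product lt (X - {i}) * poly h (var i) * difference_product lt Y)"
      unfolding dp[OF i] hx by (simp only: mult_ac)
    also have "\<dots> = e i * difference_product lt (X - {i}) * poly h (var i) * difference_product lt Y"
      by (simp only: dd mult_1)
    finally show "e i * difference_product lt (X - {i}) * poly h (var i) * difference_product lt Y
      = (e i * d i) * var i ^ k * (difference_product lt (X - {i}) * difference_product lt (insert i Y))"
      by (rule sym)
  qed
  finally show ?thesis using that[of "\<lambda>i. e i * d i"] e d unfolding k_def
    by (metis (no_types, lifting) minus_minus mult_1 mult_minus1)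
qed

section \<open>Specht polynomials of dominated shapes\<close>

lemma column_systems_exchange:
  assumes C: "add_mset X (add_mset Y C) \<in> column_systems w A" and i: "i \<in> X - Y"
  shows "add_mset (X - {i}) (add_mset (insert i Y) C) \<in> column_systems w A"
proof -
  have "size {#Z \<in># add_mset (X - {i}) (add_mset (insert i Y) C). a \<in> Z#} = w a" if "a \<in> A" for a
  proof -
    have "size {#Z \<in># add_mset X (add_mset Y C). a \<in> Z#} = w a" using C that by (auto simp: column_systems_def)
    thus ?thesis using i by (cases "a = i") auto
  qed
  thus ?thesis using C i by (auto simp: column_systems_def)
qed

text \<open>
  By induction along the moves of the dominance order; each move is one application of the exchange
  relation to two columns.
\<close>

lemma system_poly_in_ideal_of_dominating:
  fixes I :: "'k::field mpoly set"
  assumes I: "ideal I (poly_ring n)"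
    and asym: "\<And>a b. lt a b \<Longrightarrow> \<not> lt b a"
    and tot: "\<And>a b. a \<in> {1..n} \<Longrightarrow> b \<in> {1..n} \<Longrightarrow> a \<noteq> b \<Longrightarrow> lt a b \<or> lt b a"
    and p: "concave_profile p" and total: "\<And>i. k \<le> i \<Longrightarrow> p i = (\<Sum>a\<in>{1..n}. w a)"
    and gens: "\<And>C. C \<in> column_systems w {1..n} \<Longrightarrow> profile (lengths C) = p \<Longrightarrow> system_poly lt C \<in> I"
    and C: "C \<in> column_systems w {1..n}" and le: "\<And>i. profile (lengths C) i \<le> p i"
  shows "system_poly lt C \<in> I"
proof -
  have "\<And>i. k \<le> i \<Longrightarrow> p i = sum_mset (lengths C)" using total sum_lengths[OF C] by simp
  define Q where "Q = (\<lambda>N. \<forall>C. C \<in> column_systems w {1..n} \<longrightarrow> lengths C = N \<longrightarrow> system_poly lt C \<in> I)"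
  have "Q (lengths C)"
  proof (rule dominance_induct[where p = p and k = k and Q = Q])
    show "Q N" if "profile N = p" for N using that gens by (auto simp: Q_def)
  next
    fix N assume zero: "Q (add_mset 0 N)"
    show "Q N"
      unfolding Q_def
    proof (intro allI impI)
      fix C' assume C': "C' \<in> column_systems w {1..n}" "lengths C' = N"
      have "system_poly lt (add_mset {} C') \<in> I"
        using zero[unfolded Q_def, rule_format, of "add_mset {} C'"] C'
        by (simp add: column_systems_empty_column)
      thus "system_poly lt C' \<in> I" by simp
    qed
  next
    fix R a b assume ab: "b + 2 \<le> a" and move: "Q (R + {#a - 1, b + 1#})"
    show "Q (R + {#a, b#})"
      unfolding Q_def
    proof (intro allI impI)
      fix C' assume C': "C' \<in> column_systems w {1..n}" "lengths C' = R + {#a, b#}"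
      hence "lengths C' = add_mset a (add_mset b R)" by simp
      then obtain C1 X where 1: "C' = add_mset X C1" "card X = a" "lengths C1 = add_mset b R"
        by (metis msed_map_invR)
      then obtain C2 Y where 2: "C1 = add_mset Y C2" "card Y = b" "lengths C2 = R"
        by (metis msed_map_invR)
      have XY: "X \<subseteq> {1..n}" "Y \<subseteq> {1..n}" using C'(1) 1(1) 2(1) by (auto simp: column_systems_def)
      have fin: "finite X" "finite Y" using XY finite_subset by auto
      have "card Y < card X" using 1(2) 2(2) ab by simp
      have totXY: "lt a b \<or> lt b a" if "a \<in> X \<union> Y" "b \<in> X \<union> Y" "a \<noteq> b" for a b
      proof (rule tot)
        show "a \<in> {1..n}" "b \<in> {1..n}" "a \<noteq> b" using that XY by blast+
      qed
      obtain e :: "nat \<Rightarrow> 'k mpoly" where e: "\<And>i. e i = 1 \<or> e i = - 1"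
        and eq: "difference_product lt X * difference_product lt Y = (\<Sum>i\<in>X - Y. e i * var i ^ (card X - 1 - card Y) *
          (difference_product lt (X - {i}) * difference_product lt (insert i Y)))"
        by (rule difference_product_exchange[of X Y lt, OF fin asym totXY \<open>card Y < card X\<close>]) blast+
      have "e i * var i ^ (card X - 1 - card Y) *
          (difference_product lt (X - {i}) * difference_product lt (insert i Y)) * system_poly lt C2 \<in> I"
        if i: "i \<in> X - Y" for i
      proof -
        have "add_mset (X - {i}) (add_mset (insert i Y) C2) \<in> column_systems w {1..n}"
          using column_systems_exchange[of X Y C2 w "{1..n}" i] C'(1) 1(1) 2(1) i by simp
        moreover have "lengths (add_mset (X - {i}) (add_mset (insert i Y) C2)) = R + {#a - 1, b + 1#}"
          using fin i 1(2) 2(2,3) by simp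
        ultimately have "system_poly lt (add_mset (X - {i}) (add_mset (insert i Y) C2)) \<in> I"
          using move unfolding Q_def by blast
        moreover have "e i * var i ^ (card X - 1 - card Y) \<in> carrier (poly_ring n)"
        proof (rule poly_ring_closed(2))
          show "e i \<in> carrier (poly_ring n)"
            using e[of i] one_carrier poly_ring_closed(3)[OF one_carrier one_carrier] by metis
          have "var i ^ j \<in> carrier (poly_ring n)" for j
            using XY i by (induction j) (auto intro!: poly_ring_closed(2) var_carrier one_carrier)
          thus "(var i :: 'k mpoly) ^ (card X - 1 - card Y) \<in> carrier (poly_ring n)" .
        qed
        ultimately have "e i * var i ^ (card X - 1 - card Y) *
            system_poly lt (add_mset (X - {i}) (add_mset (insert i Y) C2)) \<in> I"
          by (rule ideal_poly_ring(4)[OF I])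
        thus ?thesis by (simp add: mult_ac)
      qed
      hence "(\<Sum>i\<in>X - Y. e i * var i ^ (card X - 1 - card Y) *
          (difference_product lt (X - {i}) * difference_product lt (insert i Y)) * system_poly lt C2) \<in> I"
        by (rule ideal_sum[OF I])
      thus "system_poly lt C' \<in> I"
        unfolding 1(1) 2(1) system_poly_simps mult.assoc[symmetric] eq by (simp add: sum_distrib_right)
    qed
  qed (use p \<open>\<And>i. k \<le> i \<Longrightarrow> p i = sum_mset (lengths C)\<close> le in auto)
  thus ?thesis using C by (simp add: Q_def)
qed

section \<open>Leading monomials and reduction\<close>

definition total_degree :: "monomial \<Rightarrow> nat" where
  "total_degree m = (\<Sum>i\<in>keys m. lookup m i)"

lemma total_degree_add: "total_degree (a + b) = total_degree a + total_degree b"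
proof -
  let ?B = "keys a \<union> keys b"
  have sup: "total_degree m = (\<Sum>i\<in>?B. lookup m i)" if "keys m \<subseteq> ?B" for m
    unfolding total_degree_def by (rule sum.mono_neutral_left) (use that in \<open>auto simp: in_keys_iff\<close>)
  show ?thesis
    using sup[of "a + b"] sup[of a] sup[of b] keys_add[of a b] by (simp add: lookup_add sum.distrib)
qed

lemma finite_bounded_degree: "finite {m \<in> monomials n. total_degree m \<le> D}"
proof -
  let ?S = "{m \<in> monomials n. total_degree m \<le> D}"
  let ?f = "\<lambda>m. restrict (lookup m) {1..n}"
  have "inj_on ?f ?S"
  proof (rule inj_onI)
    fix a b assume a: "a \<in> ?S" and b: "b \<in> ?S" and eq: "?f a = ?f b"
    show "a = b"
    proof (rule poly_mapping_eqI)
      fix i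
      show "lookup a i = lookup b i"
      proof (cases "i \<in> {1..n}")
        case True
        thus ?thesis using fun_cong[OF eq, of i] by simp
      next
        case False
        hence "i \<notin> keys a" "i \<notin> keys b" using a b by (auto simp: monomials_def)
        thus ?thesis by (simp add: in_keys_iff)
      qed
    qed
  qed
  moreover have "?f ` ?S \<subseteq> {1..n} \<rightarrow>\<^sub>E {..D}"
  proof (intro image_subsetI PiE_I)
    fix m i assume m: "m \<in> ?S" and i: "i \<in> {1..n}"
    have "lookup m i \<le> total_degree m"
    proof (cases "i \<in> keys m")
      case True
      thus ?thesis unfolding total_degree_def by (intro member_le_sum) auto
    qed (simp add: in_keys_iff)
    thus "?f m i \<in> {..D}" using m i by simp
  qed auto
  moreover have "finite ({1..n} \<rightarrow>\<^sub>E {..D})" by (intro finite_PiE) auto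
  ultimately show ?thesis by (intro finite_imageD[of ?f ?S]) (rule finite_subset)
qed

locale ordered_monomials =
  fixes n :: nat and r :: "monomial rel"
  assumes mo: "monomial_order n r"
begin

lemma order_in: "(a, b) \<in> r \<Longrightarrow> a \<in> monomials n \<and> b \<in> monomials n"
  using mo by (auto simp: monomial_order_def order_on_defs)

lemma order_refl: "a \<in> monomials n \<Longrightarrow> (a, a) \<in> r"
  using mo by (auto simp: monomial_order_def order_on_defs refl_on_def)

lemma order_antisym: "(a, b) \<in> r \<Longrightarrow> (b, a) \<in> r \<Longrightarrow> a = b"
  using mo by (auto simp: monomial_order_def order_on_defs antisym_def)

lemma order_trans: "(a, b) \<in> r \<Longrightarrow> (b, c) \<in> r \<Longrightarrow> (a, c) \<in> r"
  using mo by (auto simp: monomial_order_def order_on_defs dest: transD)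

lemma order_total: "a \<in> monomials n \<Longrightarrow> b \<in> monomials n \<Longrightarrow> (a, b) \<in> r \<or> (b, a) \<in> r"
  using mo by (cases "a = b") (auto simp: monomial_order_def order_on_defs refl_on_def total_on_def)

lemma order_add:
  "(a, b) \<in> r \<Longrightarrow> (c, d) \<in> r \<Longrightarrow> (a + c, b + d) \<in> r"
proof -
  assume ab: "(a, b) \<in> r" and cd: "(c, d) \<in> r"
  have mono: "(x, y) \<in> r \<Longrightarrow> z \<in> monomials n \<Longrightarrow> (x + z, y + z) \<in> r" for x y z
    using mo order_in unfolding monomial_order_def by blast
  have "(a + c, b + c) \<in> r" using mono[OF ab] order_in[OF cd] by simp
  moreover have "(c + b, d + b) \<in> r" using mono[OF cd] order_in[OF ab] by simp
  ultimately show ?thesis using order_trans by (simp add: add.commute)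
qed

text \<open>
  The common degree is part of the notion because reduction by such a polynomial stops only if it
  does not lead to infinitely many monomials.
\<close>

definition has_lead :: "monomial \<Rightarrow> 'k::comm_ring_1 mpoly \<Rightarrow> bool" where
  "has_lead t f \<longleftrightarrow> lookup f t = 1 \<and>
     (\<forall>m\<in>keys f. (m, t) \<in> r \<and> total_degree m = total_degree t)"

lemma has_lead_one: "has_lead 0 1"
  using order_refl[OF monomials_zero] by (simp add: has_lead_def)

lemma has_lead_mult:
  fixes f g :: "'k::comm_ring_1 mpoly"
  assumes f: "has_lead t f" and g: "has_lead u g"
  shows "has_lead (t + u) (f * g)"
proof -
  define f' where "f' = f - Poly_Mapping.single t 1"
  define g' where "g' = g - Poly_Mapping.single u 1"
  have below: "(m + m', t + u) \<in> r \<and> total_degree (m + m') = total_degree (t + u)"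
    if "m \<in> keys f" "m' \<in> keys g" for m m'
    using that f g order_add by (auto simp: has_lead_def total_degree_add)
  have tu: "t \<in> monomials n" "u \<in> monomials n"
  proof -
    have "t \<in> keys f \<or> (1 :: 'k) = 0" "u \<in> keys g \<or> (1 :: 'k) = 0"
      using f g by (auto simp: has_lead_def in_keys_iff)
    thus "t \<in> monomials n" "u \<in> monomials n" using f g order_in by (auto simp: has_lead_def)
  qed
  have kf: "(m, t) \<in> r \<and> m \<noteq> t" if "m \<in> keys f'" for m
  proof -
    have "lookup f' t = 0" using f by (simp add: f'_def has_lead_def lookup_minus)
    hence "m \<noteq> t" using that by (auto simp: in_keys_iff)
    hence "m \<in> keys f" using that by (simp add: f'_def in_keys_iff lookup_minus lookup_single)
    thus ?thesis using \<open>m \<noteq> t\<close> f by (auto simp: has_lead_def)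
  qed
  have kg: "(m, u) \<in> r \<and> m \<noteq> u" if "m \<in> keys g'" for m
  proof -
    have "lookup g' u = 0" using g by (simp add: g'_def has_lead_def lookup_minus)
    hence "m \<noteq> u" using that by (auto simp: in_keys_iff)
    hence "m \<in> keys g" using that by (simp add: g'_def in_keys_iff lookup_minus lookup_single)
    thus ?thesis using \<open>m \<noteq> u\<close> g by (auto simp: has_lead_def)
  qed
  have "f * g = Poly_Mapping.single (t + u) 1 + Poly_Mapping.single t 1 * g' + f' * g"
    by (simp add: f'_def g'_def algebra_simps mult_single)
  moreover have "t + u \<notin> keys (Poly_Mapping.single t 1 * g')"
  proof
    assume "t + u \<in> keys (Poly_Mapping.single t 1 * g')"
    then obtain m m' where "m \<in> keys (Poly_Mapping.single t (1 :: 'k))"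
      "m' \<in> keys g'" "t + u = m + m'"
      using keys_mult[of "Poly_Mapping.single t (1 :: 'k)" g'] by blast
    thus False using kg[of m'] by simp
  qed
  moreover have "t + u \<notin> keys (f' * g)"
  proof
    assume "t + u \<in> keys (f' * g)"
    then obtain m m' where m: "m \<in> keys f'" "m' \<in> keys g" "t + u = m + m'"
      using keys_mult[of f' g] by blast
    have mu: "(m', u) \<in> r" using m(2) g by (simp add: has_lead_def)
    have "m' \<in> monomials n" using order_in[OF mu] by simp
    hence "(m + m', t + m') \<in> r" using kf[OF m(1)] order_refl by (intro order_add) auto
    moreover have "(t + m', t + u) \<in> r" by (rule order_add[OF order_refl[OF tu(1)] mu])
    ultimately have "m + m' = t + m'" using m(3) order_antisym[of "m + m'" "t + m'"] by simp
    thus False using kf[OF m(1)] by simp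
  qed
  ultimately have "lookup (f * g) (t + u) = 1" by (simp add: lookup_add in_keys_iff)
  moreover have "(m, t + u) \<in> r \<and> total_degree m = total_degree (t + u)"
    if "m \<in> keys (f * g)" for m
    using keys_mult[of f g] that below by blast
  ultimately show ?thesis by (simp add: has_lead_def)
qed

lemma has_lead_prod:
  assumes "\<And>x. x \<in> B \<Longrightarrow> has_lead (t x) (f x)"
  shows "has_lead (sum t B) (prod f B)"
  using assms by (induction B rule: infinite_finite_induct) (auto intro: has_lead_mult simp: has_lead_one)

lemma has_lead_prod_mset:
  assumes "\<And>x. x \<in># B \<Longrightarrow> has_lead (t x) (f x)"
  shows "has_lead (\<Sum>x\<in>#B. t x) (\<Prod>x\<in>#B. f x)"
  using assms by (induction B) (auto intro: has_lead_mult simp: has_lead_one)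

definition less_var :: "nat \<Rightarrow> nat \<Rightarrow> bool" where
  "less_var a b \<longleftrightarrow> a \<noteq> b \<and> (var_mon a, var_mon b) \<in> r"

lemma var_mon_inj: "var_mon a = var_mon b \<longleftrightarrow> a = b"
  by (metis keys_single singleton_inject var_mon_def zero_neq_one)

lemma var_mon_in: "a \<in> {1..n} \<Longrightarrow> var_mon a \<in> monomials n"
  by (simp add: var_mon_def monomials_def)

lemma less_var_asym: "less_var a b \<Longrightarrow> \<not> less_var b a"
  using order_antisym var_mon_inj unfolding less_var_def by blast

lemma less_var_total: "a \<in> {1..n} \<Longrightarrow> b \<in> {1..n} \<Longrightarrow> a \<noteq> b \<Longrightarrow> less_var a b \<or> less_var b a"
  using order_total[OF var_mon_in var_mon_in] unfolding less_var_def by blast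

lemma has_lead_difference:
  assumes "less_var b a"
  shows "has_lead (var_mon a) (var a - var b :: 'k::comm_ring_1 mpoly)"
proof -
  have ba: "(var_mon b, var_mon a) \<in> r" "b \<noteq> a" using assms by (auto simp: less_var_def)
  have deg: "total_degree (var_mon i) = 1" for i by (simp add: total_degree_def var_mon_def)
  have "m = var_mon a \<or> m = var_mon b" if "m \<in> keys (var a - var b :: 'k mpoly)" for m
    using that by (auto simp: in_keys_iff lookup_minus var_def lookup_single when_def split: if_splits)
  moreover have "lookup (var a - var b :: 'k mpoly) (var_mon a) = 1"
    using ba(2) by (simp add: lookup_minus var_def lookup_single when_def var_mon_inj)
  ultimately show ?thesis
    using ba order_refl order_in deg unfolding has_lead_def by metis
qed

definition lead_monomial :: "nat set multiset \<Rightarrow> monomial" where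
  "lead_monomial C = (\<Sum>X\<in>#C. \<Sum>a\<in>X. \<Sum>b\<in>{b \<in> X. less_var b a}. var_mon a)"

lemma has_lead_system_poly: "has_lead (lead_monomial C) (system_poly less_var C)"
  unfolding lead_monomial_def system_poly_def difference_product_def
  by (intro has_lead_prod_mset has_lead_prod has_lead_difference) auto

lemma lookup_lead_monomial:
  assumes "\<And>X. X \<in># C \<Longrightarrow> finite X"
  shows "lookup (lead_monomial C) a = lead_exp less_var C a"
  using assms
proof (induction C)
  case empty
  show ?case by (simp add: lead_monomial_def lead_exp_def)
next
  case (add X C)
  have "lookup (\<Sum>c\<in>X. \<Sum>b\<in>{b \<in> X. less_var b c}. var_mon c) a
      = (\<Sum>c\<in>X. if c = a then card {b \<in> X. less_var b c} else 0)"
    unfolding lookup_sum by (rule sum.cong) (auto simp: var_mon_def lookup_single when_def)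
  also have "\<dots> = (if a \<in> X then card {b \<in> X. less_var b a} else 0)"
    using add.prems[of X] by simp
  finally show ?case using add by (simp add: lead_monomial_def lookup_add)
qed

lemma initial_monomial_has_lead:
  assumes "has_lead t (f :: 'k::comm_ring_1 mpoly)"
  shows "initial_monomial r f = t"
  unfolding initial_monomial_def
proof (rule the_equality)
  have "lookup f t \<noteq> 0" using assms by (simp add: has_lead_def)
  thus t: "t \<in> keys f \<and> (\<forall>m'\<in>keys f. (m', t) \<in> r)"
    using assms by (simp add: has_lead_def in_keys_iff)
  show "m = t" if "m \<in> keys f \<and> (\<forall>m'\<in>keys f. (m', m) \<in> r)" for m
    using that t order_antisym by blast
qed

lemma finite_max_exists:
  assumes "finite B" "B \<noteq> {}" "B \<subseteq> monomials n"
  shows "\<exists>m\<in>B. \<forall>m'\<in>B. (m', m) \<in> r"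
  using assms
proof (induction B rule: finite_ne_induct)
  case (singleton x)
  thus ?case using order_refl by auto
next
  case (insert x B)
  then obtain m where m: "m \<in> B" "\<forall>m'\<in>B. (m', m) \<in> r" by auto
  show ?case
  proof (cases "(x, m) \<in> r")
    case True
    thus ?thesis using m by auto
  next
    case False
    hence "(m, x) \<in> r" using order_total insert.prems m(1) by blast
    hence "\<forall>m'\<in>insert x B. (m', x) \<in> r" using m order_trans order_refl insert.prems by blast
    thus ?thesis by blast
  qed
qed

lemma initial_monomial_max:
  assumes "f \<noteq> (0 :: 'k::comm_ring_1 mpoly)" "f \<in> carrier (poly_ring n)"
  shows "initial_monomial r f \<in> keys f"
    "m \<in> keys f \<Longrightarrow> (m, initial_monomial r f) \<in> r"
proof -
  have "keys f \<noteq> {}" using nonzero_has_key[OF assms(1)] by auto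
  moreover have "keys f \<subseteq> monomials n" using assms(2) by (simp add: carrier_poly_ring)
  ultimately obtain t where t: "t \<in> keys f" "\<forall>m'\<in>keys f. (m', t) \<in> r"
    using finite_max_exists[OF finite_keys] by blast
  have "initial_monomial r f = t"
    unfolding initial_monomial_def by (rule the_equality) (use t order_antisym in blast)+
  thus "initial_monomial r f \<in> keys f"
    "m \<in> keys f \<Longrightarrow> (m, initial_monomial r f) \<in> r" using t by auto
qed

text \<open>
  Repeatedly remove the largest monomial of \<open>f\<close> that lies in \<open>M\<close>. The new monomials are smaller and of
  the same degree, so there are only finitely many of them; a monomial \<open>t\<close> outside \<open>M\<close> above all of \<open>f\<close> is never
  affected.
\<close>

lemma reduce_modulo_leads:
  fixes I :: "'k::comm_ring_1 mpoly set"
  assumes I: "ideal I (poly_ring n)"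
    and M: "\<And>m. m \<in> M \<Longrightarrow> \<exists>g\<in>I. has_lead m g"
    and f: "f \<in> I" "\<And>m. m \<in> keys f \<Longrightarrow> total_degree m \<le> D"
  shows "\<exists>h\<in>I. keys h \<inter> M = {} \<and> (\<forall>t. t \<notin> M \<longrightarrow> (\<forall>m\<in>keys f. (m, t) \<in> r) \<longrightarrow>
    lookup h t = lookup f t)"
  using f
proof (induction "card {m \<in> monomials n. total_degree m \<le> D \<and> (\<exists>t\<in>keys f \<inter> M. (m, t) \<in> r)}"
    arbitrary: f rule: less_induct)
  case less
  let ?B = "\<lambda>f. {m \<in> monomials n. total_degree m \<le> D \<and> (\<exists>t\<in>keys f \<inter> M. (m, t) \<in> r)}"
  have fc: "keys f \<subseteq> monomials n"
    using ideal_poly_ring(5)[OF I] less.prems(1) by (auto simp: carrier_poly_ring)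
  show ?case
  proof (cases "keys f \<inter> M = {}")
    case False
    then obtain u where u: "u \<in> keys f \<inter> M" "\<forall>m\<in>keys f \<inter> M. (m, u) \<in> r"
      using finite_max_exists[of "keys f \<inter> M"] fc by auto
    obtain g where g: "g \<in> I" "has_lead u g" using M u by blast
    define c where "c = lookup f u"
    define f' where "f' = f - Poly_Mapping.single 0 c * g"
    have lookup_cg: "lookup (Poly_Mapping.single 0 c * g) m = c * lookup g m" for m
      unfolding mult_map_scale_conv_mult[symmetric] by (simp add: Poly_Mapping.map.rep_eq when_def)
    have f'I: "f' \<in> I" unfolding f'_def using less.prems(1) g(1)
      by (intro ideal_poly_ring(3,4)[OF I] single_carrier monomials_zero)
    have f'u: "lookup f' u = 0"
      using g(2) unfolding f'_def lookup_minus lookup_cg has_lead_def by (simp add: c_def)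
    have keys: "m \<in> keys f \<or> m \<in> keys g" if "m \<in> keys f'" for m
      using that by (auto simp: f'_def in_keys_iff lookup_minus lookup_cg)
    have kg: "(m, u) \<in> r \<and> total_degree m = total_degree u" if "m \<in> keys g" for m
      using g(2) that by (auto simp: has_lead_def)
    have du: "total_degree u \<le> D" using less.prems(2) u by auto
    have deg: "total_degree m \<le> D" if "m \<in> keys f'" for m
      using keys[OF that] kg less.prems(2) du by fastforce
    have um: "u \<in> monomials n" using u fc by auto
    have below: "(t, u) \<in> r \<and> t \<noteq> u" if "t \<in> keys f' \<inter> M" for t
      using keys[of t] that kg u f'u by (auto simp: in_keys_iff)
    have "?B f' \<subseteq> ?B f - {u}"
    proof
      fix m assume m: "m \<in> ?B f'"
      then obtain t where t: "t \<in> keys f' \<inter> M" "(m, t) \<in> r" by auto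
      have "(m, u) \<in> r" using below[OF t(1)] t(2) order_trans by blast
      moreover have "m \<noteq> u" using below[OF t(1)] t(2) order_antisym by blast
      ultimately show "m \<in> ?B f - {u}" using m u by auto
    qed
    moreover have "u \<in> ?B f" using um du u(1) order_refl by auto
    moreover have "finite (?B f)" by (rule finite_subset[OF _ finite_bounded_degree[of n D]]) auto
    ultimately have "card (?B f') < card (?B f)" by (intro psubset_card_mono psubsetI) blast+
    then obtain h where h: "h \<in> I" "keys h \<inter> M = {}"
      and ht: "\<And>t. t \<notin> M \<Longrightarrow> (\<forall>m\<in>keys f'. (m, t) \<in> r) \<Longrightarrow>
        lookup h t = lookup f' t"
      using less.hyps[of f', OF _ f'I deg] by auto
    have "lookup h t = lookup f t"
      if t: "t \<notin> M" "\<forall>m\<in>keys f. (m, t) \<in> r" for t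
    proof -
      have ut: "(u, t) \<in> r" "u \<noteq> t" using t u by auto
      have "\<forall>m\<in>keys f'. (m, t) \<in> r"
        using keys t(2) kg ut(1) order_trans by blast
      hence "lookup h t = lookup f' t" using ht t(1) by blast
      moreover have "t \<notin> keys g" using kg[of t] ut order_antisym by blast
      ultimately show ?thesis by (simp add: f'_def lookup_minus lookup_cg in_keys_iff)
    qed
    thus ?thesis using h by blast
  qed (use less.prems in blast)
qed

lemma initial_monomial_in_leads:
  fixes I :: "'k::comm_ring_1 mpoly set"
  assumes I: "ideal I (poly_ring n)"
    and M: "\<And>m. m \<in> M \<Longrightarrow> \<exists>g\<in>I. has_lead m g"
    and meets: "\<And>h. h \<in> I \<Longrightarrow> h \<noteq> 0 \<Longrightarrow> keys h \<inter> M \<noteq> {}"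
    and f: "f \<in> I" "f \<noteq> 0"
  shows "initial_monomial r f \<in> M"
proof (rule ccontr)
  assume no: "initial_monomial r f \<notin> M"
  have fc: "f \<in> carrier (poly_ring n)" using ideal_poly_ring(5)[OF I] f by auto
  define D where "D = Max (total_degree ` keys f)"
  have "total_degree m \<le> D" if "m \<in> keys f" for m
    unfolding D_def using that by (intro Max_ge) auto
  from reduce_modulo_leads[OF I M f(1) this] obtain h where h: "h \<in> I" "keys h \<inter> M = {}"
    and eq: "\<forall>t. t \<notin> M \<longrightarrow> (\<forall>m\<in>keys f. (m, t) \<in> r) \<longrightarrow>
      lookup h t = lookup f t" by blast
  have "lookup h (initial_monomial r f) = lookup f (initial_monomial r f)"
    using eq no initial_monomial_max(2)[OF f(2) fc] by blast
  hence "initial_monomial r f \<in> keys h"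
    using initial_monomial_max(1)[OF f(2) fc] by (simp add: in_keys_iff)
  hence "h \<noteq> 0" by auto
  thus False using meets[OF h(1)] h(2) by blast
qed

end

section \<open>Adding a horizontal strip\<close>

text \<open>
  The columns of length in \<open>S\<close>, which may include empty ones, are lengthened by one box each,
  and the result is dominated by \<open>q\<close>. A variable that is larger than all others and is placed in
  these boxes gets the exponent \<open>sum_mset S\<close>.
\<close>

definition strip_extendable :: "(nat \<Rightarrow> nat) \<Rightarrow> nat \<Rightarrow> nat \<Rightarrow> nat multiset \<Rightarrow> bool" where
  "strip_extendable q l d N \<longleftrightarrow> (\<exists>k S U. N + replicate_mset k 0 = S + U \<and> size S = l \<and>
     sum_mset S \<le> d \<and> (\<forall>i. profile (image_mset Suc S + U) i \<le> q i))"

lemma strip_extendable_zero: "strip_extendable q l d (add_mset 0 N) \<Longrightarrow> strip_extendable q l d N"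
  unfolding strip_extendable_def by (metis replicate_mset_Suc union_mset_add_mset_left union_mset_add_mset_right)

text \<open>
  Compare the columns of lengths \<open>a\<close> and \<open>b\<close> with those of lengths \<open>a - 1\<close> and \<open>b + 1\<close>. If both or none of the
  latter are in the strip, then the same is done with the former. If exactly one of them is,
  then it is best to lengthen the column of length \<open>b\<close>: this costs no more, and the resulting shape is
  not larger.
\<close>

lemma strip_extendable_move:
  assumes ab: "b + 2 \<le> a" and ext: "strip_extendable q l d (R + {#a - 1, b + 1#})"
  shows "strip_extendable q l d (R + {#a, b#})"
proof -
  define x where "x = a - 1"
  have x: "a = Suc x" "b < x" using ab by (auto simp: x_def)
  obtain k S U where eq: "add_mset x (add_mset (Suc b) (R + replicate_mset k 0)) = S + U"
    and S: "size S = l" "sum_mset S \<le> d" and le: "\<And>i. profile (image_mset Suc S + U) i \<le> q i"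
    using ext unfolding strip_extendable_def x_def by auto
  have goal: "strip_extendable q l d (R + {#a, b#})"
    if "add_mset (Suc x) (add_mset b (R + replicate_mset k 0)) = S' + U'" "size S' = size S" "sum_mset S' \<le> sum_mset S"
      "\<And>i. profile (image_mset Suc S' + U') i \<le> profile (image_mset Suc S + U) i" for S' U'
  proof -
    have "R + {#a, b#} + replicate_mset k 0 = S' + U'" using that(1) x by simp
    moreover have "profile (image_mset Suc S' + U') i \<le> q i" for i using that(4) le order_trans by blast
    ultimately show ?thesis unfolding strip_extendable_def using that S by (metis order_trans)
  qed
  show ?thesis
  proof (cases "x \<in># S")
    case True
    then obtain S1 where S1: "S = add_mset x S1" by (metis multi_member_split)
    hence eq1: "add_mset (Suc b) (R + replicate_mset k 0) = S1 + U" using eq by simp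
    show ?thesis
    proof (cases "Suc b \<in># S1")
      case True
      then obtain S2 where S2: "S1 = add_mset (Suc b) S2" by (metis multi_member_split)
      show ?thesis
        by (rule goal[of "add_mset (Suc x) (add_mset b S2)" U])
          (use eq1 x in \<open>auto simp: S1 S2 min_def\<close>)
    next
      case False
      hence "Suc b \<in># U" using eq1 by (metis union_iff union_single_eq_member)
      then obtain U1 where U1: "U = add_mset (Suc b) U1" by (metis multi_member_split)
      show ?thesis
        by (rule goal[of "add_mset b S1" "add_mset (Suc x) U1"]) (use eq1 x in \<open>auto simp: S1 U1\<close>)
    qed
  next
    case False
    hence "x \<in># U" using eq by (metis union_iff union_single_eq_member)
    then obtain U1 where U1: "U = add_mset x U1" by (metis multi_member_split)
    hence eq1: "add_mset (Suc b) (R + replicate_mset k 0) = S + U1" using eq by simp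
    show ?thesis
    proof (cases "Suc b \<in># S")
      case True
      then obtain S1 where S1: "S = add_mset (Suc b) S1" by (metis multi_member_split)
      show ?thesis
        by (rule goal[of "add_mset b S1" "add_mset (Suc x) U1"]) (use eq1 x in \<open>auto simp: S1 U1 min_def\<close>)
    next
      case False
      hence "Suc b \<in># U1" using eq1 by (metis union_iff union_single_eq_member)
      then obtain U2 where U2: "U1 = add_mset (Suc b) U2" by (metis multi_member_split)
      show ?thesis
        by (rule goal[of S "add_mset (Suc x) (add_mset b U2)"]) (use eq1 x in \<open>auto simp: U1 U2 min_def\<close>)
    qed
  qed
qed

text \<open>
  Take \<open>e (j - 1) - e j\<close> copies of each positive \<open>j\<close> up to \<open>K\<close>. The formula for the sum is a summation by
  parts.
\<close>

lemma multiset_from_tail_counts: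
  fixes e :: "nat \<Rightarrow> nat"
  assumes "\<And>j. e (Suc j) \<le> e j"
  shows "\<exists>S. size S = e 0 - e K \<and> sum_mset S + K * e K = (\<Sum>j<K. e j) \<and>
    (\<forall>j. count S j \<le> (if j = 0 then 0 else e (j - 1) - e j)) \<and>
    (\<forall>c\<in>#S. c \<le> K) \<and> (\<forall>i\<le>K. size {#s \<in># S. s \<le> i#} = e 0 - e i)"
proof (induction K)
  case (Suc K)
  then obtain S where S: "size S = e 0 - e K" "sum_mset S + K * e K = (\<Sum>j<K. e j)"
    "\<And>j. count S j \<le> (if j = 0 then 0 else e (j - 1) - e j)" "\<And>c. c \<in># S \<Longrightarrow> c \<le> K"
    "\<And>i. i \<le> K \<Longrightarrow> size {#s \<in># S. s \<le> i#} = e 0 - e i" by auto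
  have dec: "e j \<le> e i" if "i \<le> j" for i j using that by (induction rule: dec_induct) (use assms order_trans in blast)+
  define T where "T = replicate_mset (e K - e (Suc K)) (Suc K)"
  have K: "e (Suc K) \<le> e K" "e K \<le> e 0" using dec by auto
  have ft: "{#s \<in># replicate_mset k (Suc K). s \<le> i#} = (if Suc K \<le> i then replicate_mset k (Suc K) else {#})" for k i
    by (induction k) auto
  have "size (S + T) = e 0 - e (Suc K)" using S(1) K by (simp add: T_def)
  moreover have "sum_mset (S + T) + Suc K * e (Suc K) = (\<Sum>j<Suc K. e j)"
  proof -
    have "(e K - e (Suc K)) * Suc K + Suc K * e (Suc K) = Suc K * e K"
      using K by (simp only: mult.commute[of _ "Suc K"] distrib_left[symmetric]) simp
    thus ?thesis using S(2) by (simp add: T_def)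
  qed
  moreover have "count (S + T) j \<le> (if j = 0 then 0 else e (j - 1) - e j)" for j
  proof (cases "j = Suc K")
    case True
    have "count S (Suc K) = 0" using S(4)[of "Suc K"] by (auto simp: count_eq_zero_iff)
    thus ?thesis using True by (simp add: T_def)
  next
    case False
    thus ?thesis using S(3)[of j] by (simp add: T_def)
  qed
  moreover have "\<forall>c\<in>#S + T. c \<le> Suc K"
  proof
    fix c assume "c \<in># S + T"
    thus "c \<le> Suc K" using S(4)[of c] by (auto simp: T_def split: if_splits)
  qed
  moreover have "size {#s \<in># S + T. s \<le> i#} = e 0 - e i" if "i \<le> Suc K" for i
  proof (cases "i = Suc K")
    case True
    have "{#s \<in># S. s \<le> Suc K#} = {#s \<in># S. True#}" by (intro filter_mset_cong refl) (simp add: S(4) le_SucI)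
    thus ?thesis using True S(1) K by (simp add: T_def ft)
  next
    case False
    thus ?thesis using that S(5)[of i] by (simp add: T_def ft)
  qed
  ultimately show ?case by blast
qed (auto intro!: exI[of _ "{#}"])

lemma profile_image_Suc: "profile (image_mset Suc S) i = profile S i + size {#s \<in># S. s < i#}"
  by (induction S) auto

text \<open>
  Here \<open>e j\<close> is the number of lengthened columns that had more than \<open>j\<close> boxes before. They can be
  chosen if there are enough columns of each length; the remaining copies start new columns.
\<close>

lemma strip_extendableI:
  assumes dec: "\<And>j. e (Suc j) \<le> e j" and e0: "e 0 \<le> l" and eK: "e K = 0"
    and diff: "\<And>j. e j - e (Suc j) \<le> gap (profile N) j - gap (profile N) (Suc j)"
    and sum: "(\<Sum>j<K. e j) \<le> d"
    and le: "\<And>i. profile N (Suc i) + l \<le> q (Suc i) + e i"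
  shows "strip_extendable q l d N"
proof -
  obtain S where S: "size S = e 0" "sum_mset S \<le> d"
    "\<And>j. count S j \<le> (if j = 0 then 0 else e (j - 1) - e j)" "\<And>c. c \<in># S \<Longrightarrow> c \<le> K"
    "\<And>i. i \<le> K \<Longrightarrow> size {#s \<in># S. s \<le> i#} = e 0 - e i"
    using multiset_from_tail_counts[of e K, OF dec] eK sum by auto
  have dec': "e j \<le> e i" if "i \<le> j" for i j using that by (induction rule: dec_induct) (use dec order_trans in blast)+
  have cnt: "size {#s \<in># S. s \<le> i#} = e 0 - e i" for i
  proof (cases "i \<le> K")
    case False
    have "{#s \<in># S. s \<le> i#} = {#s \<in># S. True#}" using S(4) False by (intro filter_mset_cong refl) fastforce
    thus ?thesis using S(1) dec'[of K i] False eK by simp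
  qed (use S(5) in auto)
  define S' where "S' = S + replicate_mset (l - e 0) 0"
  have sub: "S' \<subseteq># N + replicate_mset (l - e 0) 0"
  proof -
    have "count S j \<le> count N j" for j
    proof (cases j)
      case 0
      thus ?thesis using S(3)[of j] by simp
    next
      case (Suc i)
      have "size {#c \<in># N. i < c#} = size {#c \<in># N. Suc i < c#} + count N (Suc i)"
        by (induction N) auto
      thus ?thesis using S(3)[of j] diff[of i] Suc by (simp add: gap_profile)
    qed
    hence "S \<subseteq># N" by (rule mset_subset_eqI)
    thus ?thesis by (simp add: S'_def)
  qed
  then obtain U where U: "N + replicate_mset (l - e 0) 0 = S' + U" by (metis subset_mset.add_diff_inverse)
  have "profile (image_mset Suc S' + U) i \<le> q i" for i
  proof (cases i)
    case 0
    thus ?thesis using concave_profile_zero[OF concave_profile_profile, of "image_mset Suc S' + U"] by simp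
  next
    case (Suc j)
    have fr: "{#s \<in># replicate_mset k 0. s < Suc j#} = replicate_mset k (0 :: nat)" for k by (induction k) auto
    have "{#s \<in># S. s < Suc j#} = {#s \<in># S. s \<le> j#}" by (simp add: less_Suc_eq_le)
    hence "size {#s \<in># S'. s < Suc j#} = e 0 - e j + (l - e 0)" by (simp add: S'_def fr cnt)
    hence "profile (image_mset Suc S' + U) (Suc j) = profile (S' + U) (Suc j) + (e 0 - e j + (l - e 0))"
      by (simp only: profile_simps profile_image_Suc)
    also have "profile (S' + U) (Suc j) = profile N (Suc j)" unfolding U[symmetric] by simp
    finally have "profile (image_mset Suc S' + U) (Suc j) = profile N (Suc j) + (e 0 - e j + (l - e 0))" .
    moreover have "e j \<le> e 0" by (rule dec') simp
    ultimately show ?thesis using le[of j] e0 Suc by simp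
  qed
  moreover have "size S' = l" "sum_mset S' \<le> d" using S e0 by (auto simp: S'_def)
  ultimately show ?thesis unfolding strip_extendable_def using U by blast
qed

text \<open>
  A lower bound for the number of columns that contain both the split-off variable, of weight \<open>l\<close>, and
  a variable from a class of size \<open>t\<close>, when \<open>p\<close> is the type of a point and \<open>q\<close> the shape. As a function of
  the rows of \<open>p\<close> it is also the smallest family of strip numbers that meets the
  conditions of \<open>strip_extendableI\<close>: it does not increase from row to row, and it decreases by at most the
  difference of the row lengths.
\<close>

definition root_mult :: "nat \<Rightarrow> (nat \<Rightarrow> nat) \<Rightarrow> (nat \<Rightarrow> nat) \<Rightarrow> nat \<Rightarrow> nat \<Rightarrow> nat" where
  "root_mult K p q l t = Max ((\<lambda>i. (l + p (Suc i)) - (q (Suc i) + (gap p i - t))) ` {..K})"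

lemma root_mult_ge: "i \<le> K \<Longrightarrow> (l + p (Suc i)) - (q (Suc i) + (gap p i - t)) \<le> root_mult K p q l t"
  unfolding root_mult_def by (rule Max_ge) auto

lemma root_mult_le:
  "(\<And>i. i \<le> K \<Longrightarrow> l + p (Suc i) \<le> q (Suc i) + (gap p i - t) + c) \<Longrightarrow> root_mult K p q l t \<le> c"
  unfolding root_mult_def by (subst Max_le_iff) (auto simp: le_diff_conv add.commute add.left_commute)

lemma root_mult_lipschitz:
  assumes "t' \<le> t"
  shows "root_mult K p q l t' \<le> root_mult K p q l t" "root_mult K p q l t \<le> root_mult K p q l t' + (t - t')"
proof -
  show "root_mult K p q l t' \<le> root_mult K p q l t"
  proof (rule root_mult_le)
    fix i assume "i \<le> K"
    from root_mult_ge[OF this, of l p q t] show "l + p (Suc i) \<le> q (Suc i) + (gap p i - t') + root_mult K p q l t"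
      using assms by linarith
  qed
  show "root_mult K p q l t \<le> root_mult K p q l t' + (t - t')"
  proof (rule root_mult_le)
    fix i assume "i \<le> K"
    from root_mult_ge[OF this, of l p q t']
    show "l + p (Suc i) \<le> q (Suc i) + (gap p i - t) + (root_mult K p q l t' + (t - t'))"
      using assms by linarith
  qed
qed

text \<open>
  The classes of the point, listed by decreasing size, are the rows of its type, so summing the
  bounds over the classes gives the cost of the strip that the bounds define.
\<close>

lemma strip_extendable_point_type:
  fixes s :: "'x \<Rightarrow> nat"
  assumes inf: "infinite (UNIV :: 'x set)" and fin: "finite {x. s x \<noteq> 0}"
    and N: "profile N = top_sum s"
    and Ms: "\<And>x. root_mult K (top_sum s) q l (s x) \<le> l" "\<And>x. root_mult K (top_sum s) q l (s x) \<le> s x"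
    and K: "card {x. s x \<noteq> 0} \<le> K" and q: "\<And>i. K \<le> i \<Longrightarrow> q i = l + sum s {x. s x \<noteq> 0}"
    and sum: "\<And>V. finite V \<Longrightarrow> (\<Sum>x\<in>V. root_mult K (top_sum s) q l (s x)) \<le> d"
  shows "strip_extendable q l d N"
proof -
  define p where "p = top_sum s"
  define M where "M = root_mult K p q l"
  have p: "concave_profile p" unfolding p_def by (rule concave_profile_top_sum[OF fin])
  have att: "\<exists>x. s x = gap p j" for j
    using top_sum_enumeration[OF fin inf, of "Suc j"] unfolding p_def by auto
  have gK: "gap p j = 0" if "K \<le> j" for j
    using top_sum_eq_total[OF fin, of j] top_sum_eq_total[OF fin, of "Suc j"] K that
    by (simp add: gap_def p_def)
  show ?thesis
  proof (rule strip_extendableI[where e = "\<lambda>j. M (gap p j)" and K = K])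
    show "M (gap p (Suc j)) \<le> M (gap p j)" for j
      unfolding M_def by (intro root_mult_lipschitz gap_antimono[OF p]) simp
    obtain x where "s x = gap p 0" using att by blast
    thus "M (gap p 0) \<le> l" using Ms(1)[of x] by (simp add: M_def p_def)
    obtain x where "s x = gap p K" using att by blast
    thus "M (gap p K) = 0" using Ms(2)[of x] gK[of K] by (simp add: M_def p_def)
    show "M (gap p j) - M (gap p (Suc j)) \<le> gap (profile N) j - gap (profile N) (Suc j)" for j
      using root_mult_lipschitz(2)[OF gap_antimono[OF p, of j "Suc j"], of K p q l]
      by (simp add: M_def N p_def)
    obtain xs where xs: "length xs = K" "distinct xs" "\<And>i. i < K \<Longrightarrow> s (xs ! i) = gap p i"
      using top_sum_enumeration[OF fin inf, of K] unfolding p_def by auto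
    have "(\<Sum>j<K. M (gap p j)) = (\<Sum>j<K. M (s (xs ! j)))" using xs by simp
    also have "\<dots> = (\<Sum>x\<in>set xs. M (s x))"
    proof -
      have "bij_betw ((!) xs) {..<K} (set xs)" using bij_betw_nth[OF xs(2), of "{..<K}" "set xs"] xs(1) by simp
      thus ?thesis by (rule sum.reindex_bij_betw)
    qed
    also have "\<dots> \<le> d" unfolding M_def p_def by (rule sum) simp
    finally show "(\<Sum>j<K. M (gap p j)) \<le> d" .
    show "profile N (Suc i) + l \<le> q (Suc i) + M (gap p i)" for i
    proof (cases "i \<le> K")
      case True
      have "(l + p (Suc i)) - (q (Suc i) + 0) \<le> M (gap p i)"
        using root_mult_ge[OF True, of l p q "gap p i"] unfolding M_def by simp
      thus ?thesis by (simp add: N p_def)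
    next
      case False
      thus ?thesis using q[of "Suc i"] top_sum_le_total[OF fin, of "Suc i"] by (simp add: N)
    qed
  qed
qed

section \<open>Roots in one variable of Specht polynomials\<close>

definition columns_through :: "nat \<Rightarrow> (nat \<Rightarrow> 'x) \<Rightarrow> 'x \<Rightarrow> nat set multiset \<Rightarrow> nat" where
  "columns_through u a x C = size {#X \<in># C. u \<in> X \<and> x \<in> a ` (X - {u})#}"

text \<open>
  For the last bound, take \<open>i + 1\<close> of the largest classes, one of them being the class of \<open>x\<close>, and
  count the entries that belong to these classes or are equal to \<open>u\<close>. If \<open>u\<close> and \<open>x\<close> were the same value,
  a column \<open>X\<close> would contain at most \<open>min (i + 1) (card X)\<close> of them; each column through both \<open>u\<close> and \<open>x\<close> adds one.
\<close>

lemma columns_through_bounds: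
  fixes a :: "nat \<Rightarrow> 'x"
  assumes C: "C \<in> column_systems w (insert u A)" and A: "finite A" "u \<notin> A"
    and inj: "\<And>X. X \<in># C \<Longrightarrow> inj_on a (X - {u})"
  defines "s \<equiv> class_size w A a"
  shows "columns_through u a x C \<le> w u" "columns_through u a x C \<le> s x"
    "w u + top_sum s (Suc i) \<le> profile (lengths C) (Suc i) + (gap (top_sum s) i - s x) + columns_through u a x C"
proof -
  have wu: "w u = (\<Sum>X\<in>#C. of_bool (u \<in> X))"
    using C by (simp add: column_systems_def size_filter_as_sum[symmetric])
  have ct: "columns_through u a x C = (\<Sum>X\<in>#C. of_bool (u \<in> X \<and> x \<in> a ` (X - {u})))"
    by (simp add: columns_through_def size_filter_as_sum)
  have finA: "finite (insert u A)" using A by simp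
  have XA: "X \<subseteq> insert u A" if "X \<in># C" for X using C that by (auto simp: column_systems_def)
  have weight: "(\<Sum>b\<in>{b \<in> A. a b \<in> W}. w b) = (\<Sum>X\<in>#C. card ({b \<in> A. a b \<in> W} \<inter> X))" for W
    by (rule sum_weights[OF C finA]) auto
  show "columns_through u a x C \<le> w u" unfolding wu ct by (rule sum_mset_mono) auto
  have "columns_through u a x C \<le> (\<Sum>X\<in>#C. card ({b \<in> A. a b \<in> {x}} \<inter> X))"
    unfolding ct
  proof (rule sum_mset_mono)
    fix X assume X: "X \<in># C"
    have "card ({b \<in> A. a b \<in> {x}} \<inter> X) \<noteq> 0" if x: "x \<in> a ` (X - {u})"
    proof -
      have "{b \<in> A. a b \<in> {x}} \<inter> X \<noteq> {}" using x XA[OF X] by auto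
      thus ?thesis using A by simp
    qed
    thus "of_bool (u \<in> X \<and> x \<in> a ` (X - {u})) \<le> card ({b \<in> A. a b \<in> {x}} \<inter> X)"
      by (cases "u \<in> X \<and> x \<in> a ` (X - {u})") (auto simp: Suc_le_eq)
  qed
  also have "\<dots> = s x" unfolding weight[symmetric] by (simp add: s_def class_size_def)
  finally show "columns_through u a x C \<le> s x" .
  obtain W where W: "finite W" "card W \<le> Suc i" "x \<in> W"
    "top_sum s (Suc i) \<le> sum s W + (gap (top_sum s) i - s x)"
    by (rule top_sum_swap[of s i x, OF finite_class_size[OF A(1), of w a, folded s_def]])
  have "sum s W = (\<Sum>X\<in>#C. card ({b \<in> A. a b \<in> W} \<inter> X))"
    unfolding weight[symmetric] s_def by (rule sum_class_size[OF A(1) W(1)])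
  hence "w u + sum s W = (\<Sum>X\<in>#C. of_bool (u \<in> X) + card ({b \<in> A. a b \<in> W} \<inter> X))"
    by (simp add: wu sum_mset.distrib)
  also have "\<dots> \<le> (\<Sum>X\<in>#C. min (Suc i) (card X) + of_bool (u \<in> X \<and> x \<in> a ` (X - {u})))"
  proof (rule sum_mset_mono)
    fix X assume X: "X \<in># C"
    have finX: "finite X" using finite_column[OF C finA X] .
    define Z where "Z = {b \<in> A. a b \<in> W} \<inter> X"
    have Z: "Z \<subseteq> X - {u}" "a ` Z \<subseteq> W" using A(2) by (auto simp: Z_def)
    have cZ: "card Z = card (a ` Z)" using inj_on_subset[OF inj[OF X] Z(1)] by (simp add: card_image)
    have cX: "card Z \<le> card (X - {u})" using finX Z(1) by (intro card_mono) auto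
    have cW: "card Z \<le> card W" unfolding cZ using W(1) Z(2) by (intro card_mono)
    have "of_bool (u \<in> X) + card Z \<le> min (Suc i) (card X) + of_bool (u \<in> X \<and> x \<in> a ` (X - {u}))"
    proof (cases "u \<in> X")
      case True
      have "card X = Suc (card (X - {u}))" using True finX by (rule card.remove[rotated])
      show ?thesis
      proof (cases "x \<in> a ` (X - {u})")
        case True
        thus ?thesis using \<open>card X = _\<close> cX cW W(2) \<open>u \<in> X\<close> by simp
      next
        case False
        hence "a ` Z \<subseteq> W - {x}" using Z by auto
        hence "card Z \<le> card (W - {x})" unfolding cZ using W(1) by (intro card_mono) auto
        moreover have "card W = Suc (card (W - {x}))" using W(3,1) by (rule card.remove[rotated])
        ultimately show ?thesis using \<open>card X = _\<close> cX W(2) \<open>u \<in> X\<close> False by simp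
      qed
    next
      case False
      thus ?thesis using cX cW W(2) by simp
    qed
    thus "of_bool (u \<in> X) + card ({b \<in> A. a b \<in> W} \<inter> X)
      \<le> min (Suc i) (card X) + of_bool (u \<in> X \<and> x \<in> a ` (X - {u}))" by (simp add: Z_def)
  qed
  also have "\<dots> = profile (lengths C) (Suc i) + columns_through u a x C"
    by (simp add: ct sum_mset.distrib profile_image_mset)
  finally show "w u + top_sum s (Suc i) \<le> profile (lengths C) (Suc i) + (gap (top_sum s) i - s x) + columns_through u a x C"
    using W(4) by simp
qed

lemma eval_except_hom:
  "eval_except v a (p + q) = eval_except v a p + eval_except v a q"
  "eval_except v a (p * q) = eval_except v a p * eval_except v a q"
  "eval_except v a 0 = 0"
  by (simp_all add: eval_except_def const_hom.peval_add const_hom.peval_mult)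

text \<open>
  If the polynomial does not vanish identically in \<open>u\<close>, then the values of the other entries of
  the column are distinct, and each of them is a root when \<open>u\<close> belongs to the column.
\<close>

lemma eval_except_difference_product:
  fixes a :: "nat \<Rightarrow> 'k::idom"
  assumes X: "finite X" and asym: "\<And>a b. lt a b \<Longrightarrow> \<not> lt b a"
    and tot: "\<And>a b. a \<in> X \<Longrightarrow> b \<in> X \<Longrightarrow> a \<noteq> b \<Longrightarrow> lt a b \<or> lt b a"
    and nz: "eval_except u a (difference_product lt X) \<noteq> 0"
  shows "inj_on a (X - {u})"
    "u \<in> X \<Longrightarrow> (\<Prod>x\<in>a ` (X - {u}). [:- x, 1:]) dvd eval_except u a (difference_product lt X)"
proof -
  have var: "const_hom.peval (\<lambda>i. if i = u then [:0, 1:] else [:a i:]) (var i) = (if i = u then [:0, 1:] else [:a i:])" for i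
    by simp
  show inj: "inj_on a (X - {u})"
  proof (rule inj_onI, rule ccontr)
    fix b c assume bc: "b \<in> X - {u}" "c \<in> X - {u}" "a b = a c" "b \<noteq> c"
    have "\<exists>b c. b \<in> X - {u} \<and> c \<in> X - {u} \<and> a b = a c \<and> lt b c"
      using tot[of b c] bc by (metis DiffD1)
    then obtain b c where bc: "b \<in> X - {u}" "c \<in> X - {u}" "a b = a c" "lt b c" by blast
    let ?f = "\<lambda>i. if i = u then [:0, 1:] else [:a i:]"
    have "(\<Prod>b\<in>{b \<in> X. lt b c}. ?f c - ?f b) = 0"
    proof (rule prod_zero)
      show "finite {b \<in> X. lt b c}" using X by simp
      have "b \<in> {b \<in> X. lt b c}" "?f c - ?f b = 0" using bc by auto
      thus "\<exists>b\<in>{b \<in> X. lt b c}. ?f c - ?f b = 0" by (rule bexI[rotated])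
    qed
    hence "(\<Prod>c\<in>X. \<Prod>b\<in>{b \<in> X. lt b c}. ?f c - ?f b) = 0"
      using X bc(2) by (intro prod_zero) blast+
    hence "eval_except u a (difference_product lt X) = 0"
      unfolding eval_except_def difference_product_def const_hom.peval_prod const_hom.peval_diff var .
    thus False using nz by contradiction
  qed
  assume u: "u \<in> X"
  obtain e :: "'k mpoly" where e: "difference_product lt (insert u (X - {u}))
      = e * (difference_product lt (X - {u}) * (\<Prod>j\<in>X - {u}. var u - var j))"
    by (rule difference_product_insert[of "X - {u}" u lt]) (use X asym tot u in auto)
  have "eval_except u a (\<Prod>j\<in>X - {u}. var u - var j) = (\<Prod>j\<in>X - {u}. [:- a j, 1:])"
    unfolding eval_except_def const_hom.peval_prod const_hom.peval_diff var
    by (rule prod.cong) auto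
  also have "\<dots> = (\<Prod>x\<in>a ` (X - {u}). [:- x, 1:])" by (simp add: prod.reindex[OF inj] o_def)
  finally have "eval_except u a (difference_product lt X) = eval_except u a e *
      (eval_except u a (difference_product lt (X - {u})) * (\<Prod>x\<in>a ` (X - {u}). [:- x, 1:]))"
    using e u by (simp add: insert_absorb eval_except_hom)
  thus "(\<Prod>x\<in>a ` (X - {u}). [:- x, 1:]) dvd eval_except u a (difference_product lt X)" by simp
qed

lemma eval_except_system_poly:
  fixes a :: "nat \<Rightarrow> 'k::field"
  assumes C: "C \<in> column_systems w A" and A: "finite A" and asym: "\<And>a b. lt a b \<Longrightarrow> \<not> lt b a"
    and tot: "\<And>a b. a \<in> A \<Longrightarrow> b \<in> A \<Longrightarrow> a \<noteq> b \<Longrightarrow> lt a b \<or> lt b a"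
    and V: "finite V" and nz: "eval_except u a (system_poly lt C) \<noteq> 0"
  shows "\<And>X. X \<in># C \<Longrightarrow> inj_on a (X - {u})"
    "(\<Prod>x\<in>V. [:- x, 1:] ^ columns_through u a x C) dvd eval_except u a (system_poly lt C)"
proof -
  have X: "finite X" "X \<subseteq> A" if "X \<in># C" for X
    using that C finite_column[OF C A that] by (auto simp: column_systems_def)
  have ev: "eval_except u a (system_poly lt D) = (\<Prod>X\<in>#D. eval_except u a (difference_product lt X))" for D
    by (simp add: eval_except_def system_poly_def const_hom.peval_prod_mset)
  have nzX: "eval_except u a (difference_product lt X) \<noteq> 0" if XC: "X \<in># C" for X
  proof
    assume "eval_except u a (difference_product lt X) = 0"
    moreover obtain C' where "C = add_mset X C'" using multi_member_split[OF XC] by auto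
    ultimately show False using nz by (simp add: eval_except_hom)
  qed
  have totX: "lt b c \<or> lt c b" if "X \<in># C" "b \<in> X" "c \<in> X" "b \<noteq> c" for X b c
    by (rule tot) (use X(2)[OF that(1)] that in auto)
  show "inj_on a (X - {u})" if "X \<in># C" for X
    by (rule eval_except_difference_product(1)[OF X(1)[OF that] asym totX[OF that] nzX[OF that]])
  have "\<forall>X\<in>#C. (\<Prod>x\<in>V. [:- x, 1:] ^ of_bool (u \<in> X \<and> x \<in> a ` (X - {u}))) dvd eval_except u a (difference_product lt X)"
  proof
    fix X assume XC: "X \<in># C"
    show "(\<Prod>x\<in>V. [:- x, 1:] ^ of_bool (u \<in> X \<and> x \<in> a ` (X - {u}))) dvd eval_except u a (difference_product lt X)"
    proof (cases "u \<in> X")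
      case True
      have "(\<Prod>x\<in>V. [:- x, 1:] ^ of_bool (u \<in> X \<and> x \<in> a ` (X - {u}))) = (\<Prod>x\<in>V \<inter> a ` (X - {u}). [:- x, 1:])"
        using True V by (intro prod.mono_neutral_cong_right) auto
      also have "\<dots> dvd (\<Prod>x\<in>a ` (X - {u}). [:- x, 1:])"
        using X(1)[OF XC] by (intro prod_dvd_prod_subset) auto
      also have "\<dots> dvd eval_except u a (difference_product lt X)"
        by (rule eval_except_difference_product(2)[OF X(1)[OF XC] asym totX[OF XC] nzX[OF XC] True])
      finally show ?thesis .
    qed simp
  qed
  thus "(\<Prod>x\<in>V. [:- x, 1:] ^ columns_through u a x C) dvd eval_except u a (system_poly lt C)"
    unfolding ev
  proof (induction C)
    case (add X C)
    have "(\<Prod>x\<in>V. [:- x, 1:] ^ columns_through u a x (add_mset X C))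
        = (\<Prod>x\<in>V. [:- x, 1:] ^ of_bool (u \<in> X \<and> x \<in> a ` (X - {u}))) * (\<Prod>x\<in>V. [:- x, 1:] ^ columns_through u a x C)"
      unfolding prod.distrib[symmetric] by (rule prod.cong) (auto simp: columns_through_def)
    thus ?case using add by (simp add: mult_dvd_mono)
  qed (simp add: columns_through_def)
qed

lemma image_insert_column_system:
  assumes C: "CS + CU \<in> column_systems w A" and A: "finite A" "u \<notin> A" and wu: "size CS = w u"
    and lt: "\<And>b. b \<in> A \<Longrightarrow> lt b u \<and> \<not> lt u b" "\<not> lt u u"
  shows "image_mset (insert u) CS + CU \<in> column_systems w (insert u A)"
    "lengths (image_mset (insert u) CS + CU) = image_mset Suc (lengths CS) + lengths CU"
    "lead_exp lt (image_mset (insert u) CS + CU) a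
      = lead_exp lt (CS + CU) a + (if a = u then sum_mset (lengths CS) else 0)"
proof -
  have XA: "X \<subseteq> A" if "X \<in># CS + CU" for X using C that by (auto simp: column_systems_def)
  have S: "X \<subseteq> A" if "X \<in># CS" for X using XA that by auto
  have U: "X \<subseteq> A" if "X \<in># CU" for X using XA that by auto
  have "size {#X \<in># image_mset (insert u) CS. b \<in> X#} = size {#X \<in># CS. b \<in> X#}" if "b \<noteq> u" for b
    using that by (induction CS) auto
  moreover have "{#X \<in># CU. u \<in> X#} = {#X \<in># CU. False#}"
    using U A(2) by (intro filter_mset_cong) auto
  moreover have "size {#X \<in># image_mset (insert u) CS. u \<in> X#} = size CS" by (induction CS) auto
  moreover have "b \<noteq> u" if "b \<in> A" for b using that A by auto
  ultimately show "image_mset (insert u) CS + CU \<in> column_systems w (insert u A)"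
    using C wu by (auto simp: column_systems_def)
  show "lengths (image_mset (insert u) CS + CU) = image_mset Suc (lengths CS) + lengths CU"
  proof -
    have "card (insert u X) = Suc (card X)" if "X \<in># CS" for X
      using S[OF that] A finite_subset by (intro card_insert_disjoint) auto
    hence "image_mset (\<lambda>X. card (insert u X)) CS = image_mset (\<lambda>X. Suc (card X)) CS" by (rule image_mset_cong)
    thus ?thesis by (simp add: image_mset.compositionality o_def)
  qed
  have plus: "lead_exp lt (C + D) a = lead_exp lt C a + lead_exp lt D a" for C D by (simp add: lead_exp_def)
  have "lead_exp lt (image_mset (insert u) CS) a = lead_exp lt CS a + (if a = u then sum_mset (lengths CS) else 0)"
    using S
  proof (induction CS)
    case (add X CS)
    have XA: "X \<subseteq> A" using add.prems by simp
    have "(if a \<in> insert u X then card {b \<in> insert u X. lt b a} else 0)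
        = (if a \<in> X then card {b \<in> X. lt b a} else 0) + (if a = u then card X else 0)"
    proof (cases "a = u")
      case True
      have "{b \<in> insert u X. lt b u} = X" using XA lt by auto
      moreover have "u \<notin> X" using XA A by auto
      ultimately show ?thesis using True by simp
    next
      case False
      have "{b \<in> insert u X. lt b a} = {b \<in> X. lt b a}" if "a \<in> X" using that XA lt by auto
      thus ?thesis using False by auto
    qed
    thus ?case using add by auto
  qed (simp add: lead_exp_def)
  thus "lead_exp lt (image_mset (insert u) CS + CU) a
      = lead_exp lt (CS + CU) a + (if a = u then sum_mset (lengths CS) else 0)" by (simp add: plus)
qed

section \<open>Splitting off a largest first variable\<close>

abbreviation shape_generators where
  "shape_generators lt w n q \<equiv> {system_poly lt C | C. C \<in> column_systems w {1..n} \<and> profile (lengths C) = q}"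

lemma genideal_subset_ideal:
  fixes S :: "'k::comm_ring_1 mpoly set"
  assumes "ideal J (poly_ring n)" "S \<subseteq> J"
  shows "Idl\<^bsub>poly_ring n\<^esub> S \<subseteq> J"
proof -
  interpret cring "poly_ring n :: 'k mpoly ring" by (rule cring_poly_ring)
  show ?thesis by (rule genideal_minimal[OF assms])
qed

lemma ideal_genideal:
  fixes S :: "'k::comm_ring_1 mpoly set"
  assumes "S \<subseteq> carrier (poly_ring n)"
  shows "ideal (Idl\<^bsub>poly_ring n\<^esub> S) (poly_ring n)" "S \<subseteq> Idl\<^bsub>poly_ring n\<^esub> S"
proof -
  interpret cring "poly_ring n :: 'k mpoly ring" by (rule cring_poly_ring)
  show "ideal (Idl\<^bsub>poly_ring n\<^esub> S) (poly_ring n)" by (rule genideal_ideal[OF assms])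
  show "S \<subseteq> Idl\<^bsub>poly_ring n\<^esub> S" by (rule genideal_self[OF assms])
qed

lemma zero_in_carrier: "(0 :: 'k::comm_ring_1 mpoly) \<in> carrier (poly_ring n)"
  by (simp add: carrier_poly_ring)

lemma genideal_eval_except_dvd:
  fixes a :: "nat \<Rightarrow> 'k::field"
  assumes S: "S \<subseteq> carrier (poly_ring n)" and dvd: "\<And>g. g \<in> S \<Longrightarrow> D dvd eval_except u a g"
    and f: "f \<in> Idl\<^bsub>poly_ring n\<^esub> S"
  shows "D dvd eval_except u a f"
proof -
  have "ideal {f \<in> carrier (poly_ring n). D dvd eval_except u a f} (poly_ring n)"
    by (rule ideal_poly_ringI)
      (auto simp: eval_except_hom poly_ring_closed zero_in_carrier)
  hence "Idl\<^bsub>poly_ring n\<^esub> S \<subseteq> {f \<in> carrier (poly_ring n). D dvd eval_except u a f}"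
    by (rule genideal_subset_ideal) (use S dvd in auto)
  thus ?thesis using f by auto
qed

text \<open>
  At the point \<open>a\<close>, all generators, hence also \<open>f\<close>, are divisible by the product of the linear factors of the
  values, taken with the multiplicities \<open>root_mult\<close>. So the sum of these is at most the degree of \<open>f\<close>.
\<close>

lemma strip_extendable_at_point:
  fixes f :: "'k::field mpoly" and a :: "nat \<Rightarrow> 'k"
  assumes K: "infinite (UNIV :: 'k set)"
    and asym: "\<And>a b. lt a b \<Longrightarrow> \<not> lt b a"
    and tot: "\<And>a b. a \<in> {1..n} \<Longrightarrow> b \<in> {1..n} \<Longrightarrow> a \<noteq> b \<Longrightarrow> lt a b \<or> lt b a"
    and A: "insert u A = {1..n}" "u \<notin> A"
    and q: "\<And>i. k \<le> i \<Longrightarrow> q i = (\<Sum>b\<in>{1..n}. w b)"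
    and f: "f \<in> Idl\<^bsub>poly_ring n\<^esub> (shape_generators lt w n q)"
    and nz: "eval_except u a f \<noteq> 0"
    and N: "profile N = point_type w A a"
  shows "strip_extendable q (w u) (degree_in u f) N"
proof -
  define s where "s = class_size w A a"
  have finA: "finite A" using A(1) by (metis finite_atLeastAtMost finite_insert)
  have fin: "finite {x. s x \<noteq> 0}" unfolding s_def by (rule finite_class_size[OF finA])
  define K where "K = max k (card {x. s x \<noteq> 0})"
  define M where "M = root_mult K (top_sum s) q (w u)"
  let ?G = "shape_generators lt w n q :: 'k mpoly set"
  have G: "?G \<subseteq> carrier (poly_ring n)" using system_poly_carrier by auto
  have Mle: "M (s x) \<le> columns_through u a x C" "M (s x) \<le> w u" "M (s x) \<le> s x"
    if C: "C \<in> column_systems w {1..n}" "profile (lengths C) = q" "eval_except u a (system_poly lt C) \<noteq> 0" for C x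
  proof -
    have C': "C \<in> column_systems w (insert u A)" using C(1) A(1) by simp
    have inj: "inj_on a (X - {u})" if "X \<in># C" for X
      by (rule eval_except_system_poly(1)[OF C(1) finite_atLeastAtMost asym tot finite.emptyI C(3) that])
    note b = columns_through_bounds[OF C' finA A(2) inj]
    show le: "M (s x) \<le> columns_through u a x C"
      unfolding M_def by (rule root_mult_le) (use b(3)[of _ x] C(2) in \<open>simp add: s_def\<close>)
    show "M (s x) \<le> w u" using le b(1)[of x] by linarith
    show "M (s x) \<le> s x" using le b(2)[of x] by (simp add: s_def)
  qed
  have dvd: "(\<Prod>x\<in>V. [:- x, 1:] ^ M (s x)) dvd eval_except u a f" if V: "finite V" for V
  proof (rule genideal_eval_except_dvd[OF G _ f])
    fix g assume "g \<in> ?G"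
    then obtain C where C: "C \<in> column_systems w {1..n}" "profile (lengths C) = q" "g = system_poly lt C" by auto
    show "(\<Prod>x\<in>V. [:- x, 1:] ^ M (s x)) dvd eval_except u a g"
    proof (cases "eval_except u a g = 0")
      case False
      have "(\<Prod>x\<in>V. [:- x, 1:] ^ M (s x)) dvd (\<Prod>x\<in>V. [:- x, 1:] ^ columns_through u a x C)"
        using Mle(1)[OF C(1,2)] False C(3) by (intro prod_dvd_prod le_imp_power_dvd) auto
      also have "\<dots> dvd eval_except u a g"
        unfolding C(3)
        by (rule eval_except_system_poly(2)[OF C(1) finite_atLeastAtMost asym tot V]) (use False C(3) in auto)
      finally show ?thesis .
    qed simp
  qed
  have "\<exists>C. C \<in> column_systems w {1..n} \<and> profile (lengths C) = q \<and> eval_except u a (system_poly lt C) \<noteq> 0"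
  proof (rule ccontr)
    assume "\<not> ?thesis"
    \<comment> \<open>Divisibility by 0 means vanishing, so not all generators can vanish here.\<close>
    hence "0 dvd eval_except u a f" by (intro genideal_eval_except_dvd[OF G _ f]) auto
    thus False using nz by simp
  qed
  then obtain C where C: "C \<in> column_systems w {1..n}" "profile (lengths C) = q"
    "eval_except u a (system_poly lt C) \<noteq> 0" by blast
  show ?thesis
  proof (rule strip_extendable_point_type[OF K fin, where K = K])
    show "profile N = top_sum s" using N by (simp add: point_type_def s_def)
    show "root_mult K (top_sum s) q (w u) (s x) \<le> w u" "root_mult K (top_sum s) q (w u) (s x) \<le> s x" for x
      using Mle(2,3)[OF C] by (auto simp: M_def)
    show "card {x. s x \<noteq> 0} \<le> K" by (simp add: K_def)
    have "w u + sum s {x. s x \<noteq> 0} = (\<Sum>b\<in>{1..n}. w b)"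
      unfolding A(1)[symmetric] s_def sum_all_class_sizes[OF finA] using finA A(2) by simp
    thus "q i = w u + sum s {x. s x \<noteq> 0}" if "K \<le> i" for i using q[of i] that by (simp add: K_def)
    show "(\<Sum>x\<in>V. root_mult K (top_sum s) q (w u) (s x)) \<le> degree_in u f" if "finite V" for V
    proof -
      have "(\<Sum>x\<in>V. M (s x)) = degree (\<Prod>x\<in>V. [:- x, 1:] ^ M (s x))"
        by (subst degree_prod_eq_sum_degree) (auto simp: degree_power_eq)
      also have "\<dots> \<le> degree (eval_except u a f)" by (rule dvd_imp_degree_le[OF dvd[OF that] nz])
      also have "\<dots> \<le> degree_in u f" by (rule degree_eval_except)
      finally show ?thesis by (simp add: M_def)
    qed
  qed
qed

text \<open>
  The set of types that can be extended by a strip need not be given as a lower set, so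
  \<open>vanishing_contains_lead_exp\<close> is applied to the lower set that it generates, and
  \<open>dominance_induct\<close> brings the strip down to the column system that is found.
\<close>

lemma ideal_contains_lead_exp_largest:
  fixes f :: "'k::field mpoly"
  assumes K: "infinite (UNIV :: 'k set)"
    and dist: "distinct (v0 # vs)" and sorted: "sorted_wrt lt (v0 # vs)"
    and asym: "\<And>a b. lt a b \<Longrightarrow> \<not> lt b a"
    and tot: "\<And>a b. a \<in> {1..n} \<Longrightarrow> b \<in> {1..n} \<Longrightarrow> a \<noteq> b \<Longrightarrow> lt a b \<or> lt b a"
    and A: "insert u (set (v0 # vs)) = {1..n}" "u \<notin> set (v0 # vs)"
    and max: "\<And>b. b \<in> set (v0 # vs) \<Longrightarrow> lt b u"
    and w: "\<And>b. b \<in> set (v0 # vs) \<Longrightarrow> w b = 1"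
    and q: "\<And>i. k \<le> i \<Longrightarrow> q i = (\<Sum>b\<in>{1..n}. w b)"
    and f: "f \<in> Idl\<^bsub>poly_ring n\<^esub> (shape_generators lt w n q)" "f \<noteq> 0"
  shows "\<exists>C \<in> column_systems w {1..n}. (\<forall>i. profile (lengths C) i \<le> q i) \<and>
    (\<exists>m \<in> keys f. \<forall>a. lead_exp lt C a \<le> lookup m a)"
proof -
  define A where "A = set (v0 # vs)"
  have finA: "finite A" and uA: "u \<notin> A" and insA: "insert u A = {1..n}" using A by (auto simp: A_def)
  define d where "d = degree_in u f"
  define g where "g = top_coeff u d f"
  have "shape_generators lt w n q \<subseteq> (carrier (poly_ring n) :: 'k mpoly set)" using system_poly_carrier by auto
  hence "f \<in> carrier (poly_ring n)" using f(1) ideal_genideal(1) ideal_poly_ring(5) by blast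
  hence fk: "keys m \<subseteq> insert u A" if "m \<in> keys f" for m
    using that by (auto simp: carrier_poly_ring monomials_def insA)
  define \<Psi> where "\<Psi> = (\<lambda>p. \<exists>a :: nat \<Rightarrow> 'k. (\<forall>i. p i \<le> point_type w A a i) \<and>
    (\<forall>N. profile N = point_type w A a \<longrightarrow> strip_extendable q (w u) d N))"
  have "\<exists>C \<in> column_systems w (set (v0 # vs)). \<Psi> (profile (lengths C)) \<and>
    (\<exists>m \<in> keys g. \<forall>a. lead_exp lt C a \<le> lookup m a)"
  proof (rule vanishing_contains_lead_exp[OF K dist sorted asym])
    show "w v = 1" if "v \<in> set vs" for v using w that by auto
    show "\<Psi> p'" if "\<Psi> p" "\<And>i. p' i \<le> p i" for p p' using that unfolding \<Psi>_def by (meson order_trans)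
    show "keys m \<subseteq> set (v0 # vs)" if mg: "m \<in> keys g" for m
    proof -
      obtain m' where "m' \<in> keys f" "m = drop_var u m'"
        using mg by (auto simp: g_def keys_top_coeff)
      thus ?thesis using fk[of m'] by (auto simp: keys_drop_var A_def)
    qed
    show "g \<noteq> 0" unfolding g_def d_def by (rule top_coeff_nonzero[OF f(2)])
    show "eval_at a g = 0" if "\<not> \<Psi> (point_type w (set (v0 # vs)) a)" for a
    proof (rule ccontr)
      assume "eval_at a g \<noteq> 0"
      hence nz: "eval_except u a f \<noteq> 0"
        unfolding g_def coeff_eval_except[symmetric] by auto
      have "strip_extendable q (w u) d N" if "profile N = point_type w A a" for N
        unfolding d_def by (rule strip_extendable_at_point[OF K asym tot insA uA q f(1) nz that])
      thus False using \<open>\<not> \<Psi> _\<close> unfolding \<Psi>_def A_def by blast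
    qed
  qed
  then obtain C m' where C: "C \<in> column_systems w A" and \<Psi>C: "\<Psi> (profile (lengths C))"
    and m': "m' \<in> keys g" "\<And>a. lead_exp lt C a \<le> lookup m' a"
    unfolding A_def by auto
  obtain m where m: "m \<in> keys f" "lookup m u = d" "m' = drop_var u m"
    using m'(1) by (auto simp: g_def keys_top_coeff)
  obtain a :: "nat \<Rightarrow> 'k" where a: "\<And>i. profile (lengths C) i \<le> point_type w A a i"
    and ext: "\<And>N. profile N = point_type w A a \<Longrightarrow> strip_extendable q (w u) d N"
    using \<Psi>C unfolding \<Psi>_def by blast
  define s where "s = class_size w A a"
  have fin: "finite {x. s x \<noteq> 0}" unfolding s_def by (rule finite_class_size[OF finA])
  have total: "point_type w A a i = sum_mset (lengths C)" if "card {x. s x \<noteq> 0} \<le> i" for i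
    using top_sum_eq_total[OF fin that] sum_all_class_sizes[OF finA, of w a] sum_lengths[OF C finA]
    by (simp add: point_type_def s_def)
  have conc: "concave_profile (point_type w A a)"
    unfolding point_type_def using concave_profile_top_sum[OF fin] by (simp add: s_def)
  have "strip_extendable q (w u) d (lengths C)"
    by (rule dominance_induct[OF conc total a, where Q = "strip_extendable q (w u) d"])
      (use ext strip_extendable_zero strip_extendable_move in blast)+
  then obtain k S U where eq: "lengths C + replicate_mset k 0 = S + U" and S: "size S = w u" "sum_mset S \<le> d"
    and le: "\<And>i. profile (image_mset Suc S + U) i \<le> q i" unfolding strip_extendable_def by auto
  \<comment> \<open>The strip may use empty columns; they are added to the system first.\<close>
  have "lengths (C + replicate_mset k {}) = S + U" using eq by simp
  then obtain CS CU where CSU: "C + replicate_mset k {} = CS + CU" "lengths CS = S" "lengths CU = U"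
    by (metis image_mset_eq_plusD)
  have CSU_in: "CS + CU \<in> column_systems w A"
    unfolding CSU(1)[symmetric] using C by (induction k) (auto simp: column_systems_empty_column)
  have lead_empty: "lead_exp lt (CS + CU) b = lead_exp lt C b" for b
    unfolding CSU(1)[symmetric] by (induction k) (auto simp: lead_exp_def)
  define C2 where "C2 = image_mset (insert u) CS + CU"
  have sz: "size CS = w u" using S(1) CSU(2) by (metis size_image_mset)
  have ltu: "lt b u \<and> \<not> lt u b" if "b \<in> A" for b using max[of b] asym that by (auto simp: A_def)
  have ltuu: "\<not> lt u u" using asym by blast
  note C2 = image_insert_column_system[of CS CU w A u lt, OF CSU_in finA uA sz ltu ltuu, folded C2_def]
  have "C2 \<in> column_systems w {1..n}" using C2(1) insA by simp
  moreover have "profile (lengths C2) i \<le> q i" for i using le[of i] C2(2) CSU by simp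
  moreover have "lead_exp lt C2 b \<le> lookup m b" for b
  proof -
    have "lead_exp lt C2 b = lead_exp lt C b + (if b = u then sum_mset S else 0)"
      using C2(3)[of b] lead_empty[of b] CSU(2) by simp
    also have "\<dots> \<le> lookup m' b + (if b = u then d else 0)"
      using m'(2)[of b] S(2) by (cases "b = u") auto
    also have "\<dots> = lookup m b" using m by (simp add: lookup_drop_var)
    finally show ?thesis .
  qed
  ultimately show ?thesis using m(1) by blast
qed

section \<open>Tableaux and column systems\<close>

definition column :: "nat list \<Rightarrow> (nat \<times> nat \<Rightarrow> nat) \<Rightarrow> nat \<Rightarrow> nat set" where
  "column q T j = {T (i, j) | i. (i, j) \<in> young_diagram q}"

text \<open>
  The second components of the squares of the diagram are the indices of its columns.
\<close>

definition columns :: "nat list \<Rightarrow> (nat \<times> nat \<Rightarrow> nat) \<Rightarrow> nat set multiset" where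
  "columns q T = image_mset (column q T) (mset_set (snd ` young_diagram q))"

definition weight :: "nat \<Rightarrow> nat \<Rightarrow> nat" where
  "weight l a = (if a = 1 then l else 1)"

lemma finite_young_diagram: "finite (young_diagram q)"
proof (rule finite_subset)
  show "young_diagram q \<subseteq> (SIGMA i:{..<length q}. {..<q ! i})" by (auto simp: young_diagram_def)
qed simp

lemma downward_closed_eq_lessThan:
  fixes R :: "nat set"
  assumes fin: "finite R" and down: "\<And>i j. i \<in> R \<Longrightarrow> j \<le> i \<Longrightarrow> j \<in> R"
  shows "R = {..<card R}"
proof -
  have "R \<subseteq> {..<card R}"
  proof
    fix i assume "i \<in> R"
    hence "{..i} \<subseteq> R" using down by auto
    hence "card {..i} \<le> card R" using fin by (rule card_mono[rotated])
    thus "i \<in> {..<card R}" by simp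
  qed
  thus ?thesis by (intro card_subset_eq) auto
qed

lemma count_weight:
  assumes "1 \<le> n"
  shows "count (replicate_mset l 1 + mset_set {2..n}) a = (if a \<in> {1..n} then weight l a else 0)"
  using assms by (auto simp: weight_def count_mset_set')

lemma sum_weight:
  assumes "1 \<le> n"
  shows "(\<Sum>a\<in>{1..n}. weight l a) = n + l - 1"
proof -
  have "{1..n} = insert 1 {2..n}" using assms by auto
  moreover have "(\<Sum>a\<in>{2..n}. weight l a) = (\<Sum>a\<in>{2..n}. 1)" by (intro sum.cong) (auto simp: weight_def)
  ultimately show ?thesis using assms by (simp add: weight_def)
qed

context
  fixes n l :: nat and q :: "nat list" and T :: "nat \<times> nat \<Rightarrow> nat"
  assumes n: "1 \<le> n" and T: "T \<in> Tab n l q"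
begin

lemma tableau_count: "card {c \<in> young_diagram q. T c = a} = (if a \<in> {1..n} then weight l a else 0)"
proof -
  have "card {c \<in> young_diagram q. T c = a} = count (image_mset T (mset_set (young_diagram q))) a"
    by (simp add: count_image_mset' finite_young_diagram eq_commute[of a])
  also have "image_mset T (mset_set (young_diagram q)) = replicate_mset l 1 + mset_set {2..n}"
    using T unfolding Tab_def by blast
  finally show ?thesis unfolding count_weight[OF n] .
qed

lemma tableau_entry: "c \<in> young_diagram q \<Longrightarrow> T c \<in> {1..n}"
proof (rule ccontr)
  assume c: "c \<in> young_diagram q" and out: "T c \<notin> {1..n}"
  have fin: "finite {c' \<in> young_diagram q. T c' = T c}"
    by (rule finite_subset[OF _ finite_young_diagram]) auto
  have "card {c' \<in> young_diagram q. T c' = T c} = 0" unfolding tableau_count by (rule if_not_P[OF out])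
  hence "{c' \<in> young_diagram q. T c' = T c} = {}" using fin by (simp only: card_0_eq)
  thus False using c by blast
qed

lemma tableau_column_inj:
  assumes "(i, j) \<in> young_diagram q" "(i', j) \<in> young_diagram q" "T (i, j) = T (i', j)"
  shows "i = i'"
proof (cases "T (i, j) = 1")
  case True
  have "\<forall>i i' j. (i, j) \<in> young_diagram q \<and> (i', j) \<in> young_diagram q \<and> T (i, j) = 1 \<and> T (i', j) = 1 \<longrightarrow> i = i'"
    using T unfolding Tab_def by blast
  thus ?thesis using assms(1,2) True assms(3)[symmetric] by (metis (no_types))
next
  case False
  have "card {c \<in> young_diagram q. T c = T (i, j)} = 1"
    using tableau_count[of "T (i, j)"] tableau_entry[OF assms(1)] False by (simp add: weight_def)
  then obtain c where "{c \<in> young_diagram q. T c = T (i, j)} = {c}" by (rule card_1_singletonE)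
  moreover have "(i, j) \<in> {c \<in> young_diagram q. T c = T (i, j)}" "(i', j) \<in> {c \<in> young_diagram q. T c = T (i, j)}"
    using assms by auto
  ultimately show ?thesis by auto
qed

lemma columns_in_column_systems: "columns q T \<in> column_systems (weight l) {1..n}"
proof -
  have "X \<subseteq> {1..n}" if "X \<in># columns q T" for X
    using that tableau_entry by (auto simp: columns_def column_def finite_young_diagram)
  moreover have "size {#X \<in># columns q T. a \<in> X#} = weight l a" if a: "a \<in> {1..n}" for a
  proof -
    have "size {#X \<in># columns q T. a \<in> X#} = card {j \<in> snd ` young_diagram q. a \<in> column q T j}"
      by (simp add: columns_def filter_mset_image_mset finite_young_diagram)
    also have "{j \<in> snd ` young_diagram q. a \<in> column q T j} = snd ` {c \<in> young_diagram q. T c = a}"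
      by (force simp: column_def)
    also have "card \<dots> = card {c \<in> young_diagram q. T c = a}"
    proof (rule card_image, rule inj_onI)
      fix c d assume cd: "c \<in> {c \<in> young_diagram q. T c = a}" "d \<in> {c \<in> young_diagram q. T c = a}" "snd c = snd d"
      obtain i j i' where "c = (i, j)" "d = (i', j)" using cd(3) by (cases c, cases d) auto
      thus "c = d" using tableau_column_inj[of i j i'] cd by simp
    qed
    finally show ?thesis using tableau_count[of a] a by simp
  qed
  ultimately show ?thesis by (simp add: column_systems_def)
qed

lemma card_column: "card (column q T j) = card {i. (i, j) \<in> young_diagram q}"
proof -
  have "column q T j = (\<lambda>i. T (i, j)) ` {i. (i, j) \<in> young_diagram q}" by (auto simp: column_def)
  thus ?thesis using tableau_column_inj by (simp add: card_image inj_on_def)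
qed

text \<open>
  The two polynomials contain the same differences, up to the order of the two entries.
\<close>

lemma specht_poly_columns:
  assumes asym: "\<And>a b. lt a b \<Longrightarrow> \<not> lt b a"
    and tot: "\<And>a b. a \<in> {1..n} \<Longrightarrow> b \<in> {1..n} \<Longrightarrow> a \<noteq> b \<Longrightarrow> lt a b \<or> lt b a"
  shows "specht_poly q T = (system_poly lt (columns q T) :: 'k::comm_ring_1 mpoly) \<or>
    specht_poly q T = - (system_poly lt (columns q T) :: 'k mpoly)"
proof -
  have "column_difference_product q T j = (difference_product lt (column q T j) :: 'k mpoly) \<or>
      column_difference_product q T j = - (difference_product lt (column q T j) :: 'k mpoly)" for j
  proof -
    define R where "R = {i. (i, j) \<in> young_diagram q}"
    define t where "t = (\<lambda>i. T (i, j))"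
    have finR: "finite R" unfolding R_def young_diagram_def by simp
    have col: "column q T j = t ` R" by (auto simp: column_def R_def t_def)
    have inj: "inj_on t R" unfolding t_def R_def using tableau_column_inj by (auto simp: inj_on_def)
    have tn: "t i \<in> {1..n}" if "i \<in> R" for i using that tableau_entry by (auto simp: R_def t_def)
    define P where "P = {(i, i'). i < i' \<and> i \<in> R \<and> i' \<in> R}"
    define Q where "Q = (SIGMA a:t ` R. {b \<in> t ` R. lt b a})"
    define \<phi> where "\<phi> = (\<lambda>(i, i'). if lt (t i') (t i) then (t i, t i') else (t i', t i))"
    have ne: "t i \<noteq> t i'" if "(i, i') \<in> P" for i i' using that inj by (auto simp: P_def inj_on_def)
    have lt: "lt (t i) (t i') \<or> lt (t i') (t i)" if "(i, i') \<in> P" for i i'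
      using tot[OF tn tn] ne[OF that] that by (auto simp: P_def)
    have "bij_betw \<phi> P Q"
    proof (rule bij_betwI')
      fix x y assume xy: "x \<in> P" "y \<in> P"
      obtain i i' k k' where x: "x = (i, i')" and y: "y = (k, k')" by (cases x, cases y)
      have "i = k \<and> i' = k'" if "\<phi> x = \<phi> y"
      proof -
        have "{t i, t i'} = {t k, t k'}" using that by (auto simp: \<phi>_def x y split: if_splits)
        hence "t ` {i, i'} = t ` {k, k'}" by auto
        hence "{i, i'} = {k, k'}" using inj xy x y by (subst (asm) inj_on_image_eq_iff) (auto simp: P_def)
        thus ?thesis using xy x y by (auto simp: P_def doubleton_eq_iff)
      qed
      thus "(\<phi> x = \<phi> y) = (x = y)" using x y by auto
    next
      fix x assume "x \<in> P"
      thus "\<phi> x \<in> Q" using lt by (cases x) (auto simp: \<phi>_def P_def Q_def)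
    next
      fix y assume "y \<in> Q"
      then obtain i i' where i: "y = (t i, t i')" "i \<in> R" "i' \<in> R" "lt (t i') (t i)" by (auto simp: Q_def)
      have "i \<noteq> i'" using i(4) asym by blast
      show "\<exists>x\<in>P. y = \<phi> x"
      proof (cases "i < i'")
        case True
        thus ?thesis using i by (intro bexI[of _ "(i, i')"]) (auto simp: \<phi>_def P_def)
      next
        case False
        thus ?thesis using i \<open>i \<noteq> i'\<close> asym[OF i(4)] by (intro bexI[of _ "(i', i)"]) (auto simp: \<phi>_def P_def)
      qed
    qed
    hence "(\<Prod>x\<in>Q. (case x of (a, b) \<Rightarrow> var a - var b) :: 'k mpoly) = (\<Prod>x\<in>P. case \<phi> x of (a, b) \<Rightarrow> var a - var b)"
      by (rule prod.reindex_bij_betw[symmetric])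
    moreover have "difference_product lt (column q T j) = (\<Prod>x\<in>Q. (case x of (a, b) \<Rightarrow> var a - var b) :: 'k mpoly)"
      unfolding difference_product_def col Q_def by (rule prod.Sigma) (use finR in auto)
    moreover have "column_difference_product q T j = (\<Prod>x\<in>P. (case x of (i, i') \<Rightarrow> var (t i) - var (t i')) :: 'k mpoly)"
      unfolding column_difference_product_def P_def R_def t_def by (intro prod.cong) auto
    moreover have "(\<Prod>x\<in>P. (case x of (i, i') \<Rightarrow> var (t i) - var (t i')) :: 'k mpoly) = (\<Prod>x\<in>P. case \<phi> x of (a, b) \<Rightarrow> var a - var b) \<or>
      (\<Prod>x\<in>P. (case x of (i, i') \<Rightarrow> var (t i) - var (t i')) :: 'k mpoly) = - (\<Prod>x\<in>P. case \<phi> x of (a, b) \<Rightarrow> var a - var b)"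
      by (rule prod_up_to_sign) (auto simp: \<phi>_def)
    ultimately show ?thesis by simp
  qed
  hence "specht_poly q T = (\<Prod>j\<in>snd ` young_diagram q. difference_product lt (column q T j) :: 'k mpoly) \<or>
    specht_poly q T = - (\<Prod>j\<in>snd ` young_diagram q. difference_product lt (column q T j) :: 'k mpoly)"
    unfolding specht_poly_def by (intro prod_up_to_sign)
  moreover have "system_poly lt (columns q T) = (\<Prod>j\<in>snd ` young_diagram q. difference_product lt (column q T j) :: 'k mpoly)"
    by (simp add: system_poly_def columns_def prod_unfold_prod_mset image_mset.compositionality o_def)
  ultimately show ?thesis by simp
qed

text \<open>
  Both sides count the squares in the first \<open>k\<close> rows.
\<close>

lemma profile_columns:
  assumes "sorted_wrt (\<ge>) q"
  shows "profile (lengths (columns q T)) k = sum_list (take k q)"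
proof -
  let ?D = "{c \<in> young_diagram q. fst c < k}"
  have "min k (card (column q T j)) = card {c \<in> ?D. snd c = j}" for j
  proof -
    define R where "R = {i. (i, j) \<in> young_diagram q}"
    have finR: "finite R" unfolding R_def young_diagram_def by simp
    have down: "i' \<in> R" if "i \<in> R" "i' \<le> i" for i i'
    proof (cases "i' = i")
      case False
      hence "q ! i \<le> q ! i'" using that assms by (auto simp: R_def young_diagram_def sorted_wrt_iff_nth_less)
      thus ?thesis using that by (auto simp: R_def young_diagram_def)
    qed (use that in simp)
    have "R = {..<card R}" by (rule downward_closed_eq_lessThan[OF finR down])
    moreover have "{c \<in> ?D. snd c = j} = (\<lambda>i. (i, j)) ` (R \<inter> {..<k})" by (force simp: R_def)
    hence "card {c \<in> ?D. snd c = j} = card (R \<inter> {..<k})" by (simp add: card_image inj_on_def)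
    moreover have "{..<card R} \<inter> {..<k} = {..<min (card R) k}" by auto
    ultimately show ?thesis unfolding card_column R_def[symmetric] by (metis card_lessThan min.commute)
  qed
  hence "profile (lengths (columns q T)) k = (\<Sum>j\<in>snd ` young_diagram q. card {c \<in> ?D. snd c = j})"
    by (simp add: columns_def profile_image_mset image_mset.compositionality o_def sum_unfold_sum_mset)
  also have "\<dots> = (\<Sum>j\<in>snd ` young_diagram q. \<Sum>c\<in>{c \<in> ?D. snd c = j}. 1)" by simp
  also have "\<dots> = (\<Sum>c\<in>?D. 1)" by (rule sum.group) (auto simp: finite_young_diagram)
  also have "?D = (SIGMA i:{..<min k (length q)}. {..<q ! i})" by (auto simp: young_diagram_def)
  hence "(\<Sum>c\<in>?D. 1) = (\<Sum>i<min k (length q). q ! i)" by simp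
  also have "\<dots> = sum_list (take k q)" by (simp add: sum_list_sum_nth atLeast0LessThan min.commute)
  finally show ?thesis .
qed

end

text \<open>
  Empty columns, which no tableau has, may be discarded.
\<close>

lemma nonempty_columns:
  "profile (lengths {#X \<in># C. X \<noteq> {}#}) = profile (lengths C)"
  "system_poly lt {#X \<in># C. X \<noteq> {}#} = system_poly lt C"
  "lead_exp lt {#X \<in># C. X \<noteq> {}#} = lead_exp lt C"
proof -
  show "profile (lengths {#X \<in># C. X \<noteq> {}#}) = profile (lengths C)"
    by (rule ext, induction C) auto
  show "system_poly lt {#X \<in># C. X \<noteq> {}#} = system_poly lt C" by (induction C) auto
  show "lead_exp lt {#X \<in># C. X \<noteq> {}#} = lead_exp lt C" by (rule ext, induction C) auto
qed

lemma partial_sums_Suc: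
  "sum_list (take (Suc i) (q :: nat list)) = sum_list (take i q) + (if i < length q then q ! i else 0)"
  by (simp add: take_Suc_conv_app_nth)

lemma concave_profile_partial_sums:
  assumes "sorted_wrt (\<ge>) (q :: nat list)"
  shows "concave_profile (\<lambda>i. sum_list (take i q))"
proof -
  have "mono (\<lambda>i. sum_list (take i q))"
    by (rule mono_iff_le_Suc[THEN iffD2]) (simp add: partial_sums_Suc)
  moreover have "q ! Suc i \<le> q ! i" if "Suc i < length q" for i
    using assms that by (auto simp: sorted_wrt_iff_nth_less)
  ultimately show ?thesis by (auto simp: concave_profile_def partial_sums_Suc)
qed

lemma partial_sums_inject:
  fixes p q :: "nat list"
  assumes pos: "\<forall>a\<in>set p. 0 < a" "\<forall>a\<in>set q. 0 < a"
    and eq: "\<And>i. sum_list (take i p) = sum_list (take i q)"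
  shows "p = q"
proof -
  have e: "(if i < length p then p ! i else 0) = (if i < length q then q ! i else 0)" for i
    using eq[of i] eq[of "Suc i"] by (simp only: partial_sums_Suc)
  have "i < length p \<longleftrightarrow> i < length q" for i
    using e[of i] pos nth_mem[of i p] nth_mem[of i q] by (metis less_numeral_extra(3))
  hence "length p = length q" by (metis linorder_neqE_nat less_irrefl)
  show ?thesis
  proof (rule nth_equalityI[OF \<open>length p = length q\<close>])
    fix i assume "i < length p"
    thus "p ! i = q ! i" using e[of i] \<open>length p = length q\<close> by simp
  qed
qed

text \<open>
  Beyond the shorter of the two lengths the comparison is automatic, since both partitions have the
  same sum.
\<close>

lemma dominated_iff:
  assumes "q \<in> partitions m" "p \<in> partitions m"
  shows "dominated q p \<longleftrightarrow> (\<forall>i. sum_list (take i q) \<le> sum_list (take i p))"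
proof
  assume dom: "dominated q p"
  have mono: "sum_list (take i p) \<le> sum_list (take j p)" if "i \<le> j" for i j
    using concave_profile_mono[OF concave_profile_partial_sums that] assms by (auto simp: partitions_def)
  have le: "sum_list (take i q) \<le> m" for i
  proof -
    have "sum_list (take i q) + sum_list (drop i q) = sum_list q" by (simp flip: sum_list_append)
    thus ?thesis using assms(1) by (simp add: partitions_def)
  qed
  show "\<forall>i. sum_list (take i q) \<le> sum_list (take i p)"
  proof
    fix i
    consider "i = 0" | "1 \<le> i" "i \<le> length q" "i \<le> length p" | "length p \<le> i" | "length q < i" "i < length p" by linarith
    thus "sum_list (take i q) \<le> sum_list (take i p)"
    proof cases
      case 2
      thus ?thesis using dom by (auto simp: dominated_def)
    next
      case 3
      thus ?thesis using le[of i] assms(2) by (simp add: partitions_def)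
    next
      case 4
      have "sum_list (take i q) = sum_list (take (length q) q)" using 4 by simp
      also have "\<dots> \<le> sum_list (take (length q) p)"
      proof (cases "length q = 0")
        case False
        hence "length q \<in> {1..min (length q) (length p)}" using 4 by (simp add: Suc_le_eq)
        thus ?thesis using dom unfolding dominated_def by blast
      qed simp
      also have "\<dots> \<le> sum_list (take i p)" using 4 by (intro mono) simp
      finally show ?thesis .
    qed simp
  qed
qed (simp add: dominated_def)

text \<open>
  Sort the nonempty columns by decreasing size and write the entries of each one in increasing order.
\<close>

lemma tableau_of_columns:
  assumes n: "1 \<le> n" and l: "1 \<le> l" and C: "C \<in> column_systems (weight l) {1..n}"
  obtains q T where "q \<in> partitions_ge (n + l - 1) l" "T \<in> Tab n l q"
    "columns q T = {#X \<in># C. X \<noteq> {}#}"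
proof -
  define C' where "C' = {#X \<in># C. X \<noteq> {}#}"
  obtain ys where ys: "mset ys = C'" using ex_mset by blast
  define Xs where "Xs = rev (sort_key card ys)"
  have msXs: "mset Xs = C'" by (simp add: Xs_def ys)
  define k where "k = length Xs"
  have desc: "card (Xs ! j') \<le> card (Xs ! j)" if "j \<le> j'" "j' < k" for j j'
  proof -
    have s: "sorted (map card (sort_key card ys))" by simp
    have "length (sort_key card ys) = k" by (simp add: k_def Xs_def)
    thus ?thesis using sorted_nth_mono[OF s, of "k - Suc j'" "k - Suc j"] that
      by (simp add: Xs_def rev_nth)
  qed
  have Xs_in: "X \<in># C" "X \<noteq> {}" "X \<subseteq> {1..n}" "finite X" if "X \<in> set Xs" for X
  proof -
    have "X \<in># C'" using that msXs by (metis set_mset_mset)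
    thus "X \<in># C" "X \<noteq> {}" by (auto simp: C'_def)
    thus "X \<subseteq> {1..n}" using C by (auto simp: column_systems_def)
    thus "finite X" using finite_subset by auto
  qed
  have size_C': "size {#X \<in># C'. a \<in> X#} = weight l a" if "a \<in> {1..n}" for a
  proof -
    have "{#X \<in># C'. a \<in> X#} = {#X \<in># C. a \<in> X#}"
      unfolding C'_def filter_filter_mset by (rule filter_mset_cong) auto
    thus ?thesis using C that by (simp add: column_systems_def)
  qed
  have card_C': "size {#X \<in># C'. P X#} = card {j. j < k \<and> P (Xs ! j)}" for P
    unfolding msXs[symmetric] mset_filter[symmetric] size_mset k_def by (rule length_filter_conv_card)
  have lk: "l \<le> k"
  proof -
    have "size {#X \<in># C'. 1 \<in> X#} \<le> size C'" by (rule size_filter_mset_lesseq)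
    also have "size C' = k" by (simp add: msXs[symmetric] k_def)
    finally show ?thesis using size_C'[of 1] n by (simp add: weight_def)
  qed
  define row where "row = (\<lambda>i. {j. j < k \<and> i < card (Xs ! j)})"
  have row_eq: "row i = {..<card (row i)}" for i
  proof (rule downward_closed_eq_lessThan)
    show "finite (row i)" by (simp add: row_def)
    show "j' \<in> row i" if "j \<in> row i" "j' \<le> j" for j j'
      using that desc[of j' j] by (auto simp: row_def)
  qed
  define q where "q = map (\<lambda>i. card (row i)) [0..<card (Xs ! 0)]"
  have D: "(i, j) \<in> young_diagram q \<longleftrightarrow> j < k \<and> i < card (Xs ! j)" for i j
  proof -
    have "(i, j) \<in> young_diagram q \<longleftrightarrow> i < card (Xs ! 0) \<and> j < card (row i)"
      by (auto simp: young_diagram_def q_def)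
    also have "j < card (row i) \<longleftrightarrow> j \<in> row i" using row_eq[of i] by auto
    also have "i < card (Xs ! 0) \<and> j \<in> row i \<longleftrightarrow> j < k \<and> i < card (Xs ! j)"
      using desc[of 0 j] by (auto simp: row_def)
    finally show ?thesis .
  qed
  define T where "T = restrict (\<lambda>(i, j). sorted_list_of_set (Xs ! j) ! i) (young_diagram q)"
  have T: "T (i, j) = sorted_list_of_set (Xs ! j) ! i" if "(i, j) \<in> young_diagram q" for i j
    using that by (simp add: T_def)
  have Xj: "finite (Xs ! j)" "Xs ! j \<noteq> {}" if "j < k" for j
    using Xs_in[of "Xs ! j"] that by (auto simp: k_def)
  have col: "column q T j = Xs ! j" if "j < k" for j
  proof -
    have "column q T j = (\<lambda>i. sorted_list_of_set (Xs ! j) ! i) ` {i. i < card (Xs ! j)}"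
      using that T by (force simp: column_def D)
    also have "{i. i < card (Xs ! j)} = {..<length (sorted_list_of_set (Xs ! j))}" by auto
    also have "(\<lambda>i. sorted_list_of_set (Xs ! j) ! i) ` \<dots> = set (sorted_list_of_set (Xs ! j))"
      by (metis lessThan_atLeast0 list.set_map map_nth set_upt)
    finally show ?thesis using Xj[OF that] by simp
  qed
  have inj: "i = i'" if "(i, j) \<in> young_diagram q" "(i', j) \<in> young_diagram q" "T (i, j) = T (i', j)" for i i' j
    using that T[OF that(1)] T[OF that(2)] by (auto simp: D nth_eq_iff_index_eq)
  have cols: "snd ` young_diagram q = {..<k}"
  proof
    show "snd ` young_diagram q \<subseteq> {..<k}" using D by auto
    show "{..<k} \<subseteq> snd ` young_diagram q"
    proof
      fix j assume j: "j \<in> {..<k}"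
      hence "(0, j) \<in> young_diagram q" using Xj[of j] by (simp add: D card_gt_0_iff)
      thus "j \<in> snd ` young_diagram q" by force
    qed
  qed
  have colsC: "columns q T = C'"
  proof -
    have "columns q T = image_mset (\<lambda>j. Xs ! j) (mset_set {..<k})"
      unfolding columns_def cols using col by (intro image_mset_cong) auto
    also have "\<dots> = mset (map (\<lambda>j. Xs ! j) [0..<k])" by (simp add: lessThan_atLeast0)
    also have "\<dots> = C'" unfolding k_def map_nth by (rule msXs)
    finally show ?thesis .
  qed
  have "card {c \<in> young_diagram q. T c = a} = (if a \<in> {1..n} then weight l a else 0)" for a
  proof -
    have "card {c \<in> young_diagram q. T c = a} = card (snd ` {c \<in> young_diagram q. T c = a})"
    proof (rule card_image[symmetric], rule inj_onI)
      fix c d assume cd: "c \<in> {c \<in> young_diagram q. T c = a}" "d \<in> {c \<in> young_diagram q. T c = a}" "snd c = snd d"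
      obtain i j i' where "c = (i, j)" "d = (i', j)" using cd(3) by (cases c, cases d) auto
      thus "c = d" using inj[of i j i'] cd by simp
    qed
    also have "snd ` {c \<in> young_diagram q. T c = a} = {j. j < k \<and> a \<in> column q T j}"
    proof -
      have "j \<in> snd ` {c \<in> young_diagram q. T c = a} \<longleftrightarrow> j < k \<and> a \<in> column q T j" for j
        by (force simp: column_def D)
      thus ?thesis by auto
    qed
    also have "\<dots> = {j. j < k \<and> a \<in> Xs ! j}" using col by auto
    also have "card \<dots> = size {#X \<in># C'. a \<in> X#}" by (rule card_C'[symmetric])
    also have "\<dots> = (if a \<in> {1..n} then weight l a else 0)"
    proof (cases "a \<in> {1..n}")
      case False
      have "{#X \<in># C'. a \<in> X#} = {#X \<in># C'. False#}"
        using False C by (intro filter_mset_cong) (use atLeastAtMost_iff in \<open>auto 0 3 simp: C'_def column_systems_def simp del: atLeastAtMost_iff\<close>)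
      thus ?thesis using False by auto
    qed (simp add: size_C')
    finally show ?thesis .
  qed
  hence "image_mset T (mset_set (young_diagram q)) = replicate_mset l 1 + mset_set {2..n}"
    unfolding multiset_eq_iff count_weight[OF n] count_image_mset'
    by (simp add: finite_young_diagram eq_commute[of _ "T _"])
  moreover have "T \<in> extensional (young_diagram q)" by (simp add: T_def)
  ultimately have Tab: "T \<in> Tab n l q" unfolding Tab_def using inj by auto
  have sorted: "sorted_wrt (\<ge>) q"
  proof -
    have "card (row i') \<le> card (row i)" if "i < i'" for i i'
      using that by (intro card_mono) (auto simp: row_def)
    thus ?thesis by (simp add: q_def sorted_wrt_iff_nth_less)
  qed
  have k0: "0 < k" using lk l by simp
  have pos: "0 < a" if aq: "a \<in> set q" for a
  proof -
    obtain i where "i < card (Xs ! 0)" "a = card (row i)" using aq by (auto simp: q_def)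
    moreover have "0 \<in> row i" if "i < card (Xs ! 0)" for i using that k0 by (simp add: row_def)
    ultimately show ?thesis by (auto simp: card_gt_0_iff row_def)
  qed
  have c0: "0 < card (Xs ! 0)" using Xj[OF k0] by (simp add: card_gt_0_iff)
  hence "q \<noteq> []" "hd q = card (row 0)" by (auto simp: q_def upt_rec)
  moreover have "row 0 = {..<k}" using Xj by (auto simp: row_def card_gt_0_iff)
  ultimately have hd: "q \<noteq> []" "l \<le> hd q" using lk by auto
  have "sum_list q = n + l - 1"
  proof -
    define N where "N = lengths (columns q T)"
    \<comment> \<open>Any bound beyond the length of \<open>q\<close> and the lengths of the columns will do.\<close>
  define i where "i = length q + sum_mset N"
    have "sum_list q = sum_list (take i q)" by (simp add: i_def)
    also have "\<dots> = profile N i" unfolding N_def by (rule profile_columns[OF n Tab sorted, symmetric])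
    also have "\<dots> = sum_mset N"
    proof (rule profile_eq_sum)
      fix c assume "c \<in># N"
      hence "c \<le> sum_mset N" by (metis le_add1 multi_member_split sum_mset.add_mset)
      thus "c \<le> i" by (simp add: i_def)
    qed
    also have "\<dots> = n + l - 1"
      unfolding N_def using sum_lengths[OF columns_in_column_systems[OF n Tab]] sum_weight[OF n] by simp
    finally show ?thesis .
  qed
  hence "q \<in> partitions_ge (n + l - 1) l" using sorted pos hd by (auto simp: partitions_ge_def partitions_def)
  thus ?thesis using that Tab colsC by (simp add: C'_def)
qed

section \<open>The Groebner basis\<close>

lemma eval_at_eq_poly: "eval_at a f = poly (eval_except u a f) (a u)"
  by (simp add: poly_eval_except)

lemma finite_partitions: "finite (partitions m)"
proof (rule finite_subset)
  show "partitions m \<subseteq> {q. set q \<subseteq> {..m} \<and> length q \<le> m}"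
  proof
    fix q assume q: "q \<in> partitions m"
    have "a \<le> m" if "a \<in> set q" for a using member_le_sum_list[OF that] q by (simp add: partitions_def)
    moreover have "length q \<le> sum_list q" if "\<forall>a\<in>set q. 0 < a" for q :: "nat list"
      using that by (induction q) auto
    ultimately show "q \<in> {q. set q \<subseteq> {..m} \<and> length q \<le> m}" using q by (auto simp: partitions_def)
  qed
  show "finite {q. set q \<subseteq> {..m} \<and> length q \<le> m}" by (rule finite_lists_length_le) simp
qed

lemma finite_Tab:
  assumes "1 \<le> n"
  shows "finite (Tab n l q)"
proof (rule finite_subset)
  show "Tab n l q \<subseteq> young_diagram q \<rightarrow>\<^sub>E {1..n}"
  proof
    fix T assume T: "T \<in> Tab n l q"
    have "T \<in> extensional (young_diagram q)" using T by (auto simp: Tab_def)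
    moreover have "\<forall>c\<in>young_diagram q. T c \<in> {1..n}" using tableau_entry[OF assms T] by blast
    ultimately show "T \<in> young_diagram q \<rightarrow>\<^sub>E {1..n}" by (auto simp: PiE_def)
  qed
  show "finite (young_diagram q \<rightarrow>\<^sub>E {1..n})" by (intro finite_PiE finite_young_diagram) simp
qed

context ordered_monomials
begin

lemma sorted_variables_exist:
  assumes "B \<subseteq> {1..n}"
  shows "\<exists>xs. distinct xs \<and> set xs = B \<and> sorted_wrt less_var xs"
proof -
  have "finite B" using assms finite_subset by auto
  thus ?thesis using assms
  proof (induction "card B" arbitrary: B)
    case 0
    thus ?case by (intro exI[of _ "[]"]) auto
  next
    case (Suc k)
    have "var_mon ` B \<subseteq> monomials n" using Suc.prems var_mon_in by auto
    moreover have "B \<noteq> {}" using Suc.hyps(2) by auto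
    ultimately obtain m where "m \<in> var_mon ` B" "\<forall>m'\<in>var_mon ` B. (m', m) \<in> r"
      using finite_max_exists[of "var_mon ` B"] Suc.prems(1) by auto
    then obtain v where v: "v \<in> B" "\<And>b. b \<in> B \<Longrightarrow> (var_mon b, var_mon v) \<in> r" by auto
    obtain xs where xs: "distinct xs" "set xs = B - {v}" "sorted_wrt less_var xs"
    proof -
      have "k = card (B - {v})" "finite (B - {v})" "B - {v} \<subseteq> {1..n}"
        using Suc.hyps(2) Suc.prems v(1) by auto
      thus ?thesis using Suc.hyps(1)[of "B - {v}"] that by blast
    qed
    have "less_var b v" if "b \<in> set xs" for b using that xs(2) v(2) by (auto simp: less_var_def)
    thus ?case using xs v(1) by (intro exI[of _ "xs @ [v]"]) (auto simp: sorted_wrt_append)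
  qed
qed

text \<open>
  If 1 is the only index, its variable is both the smallest and the largest; the first case
  covers this.
\<close>

lemma system_ideal_contains_lead_exp:
  fixes f :: "'k::field mpoly"
  assumes K: "infinite (UNIV :: 'k set)" and n: "1 \<le> n"
    and x1: "(\<forall>i\<in>{1..n}. (var_mon 1, var_mon i) \<in> r) \<or> (\<forall>i\<in>{1..n}. (var_mon i, var_mon 1) \<in> r)"
    and q: "\<And>i. k \<le> i \<Longrightarrow> q i = (\<Sum>b\<in>{1..n}. weight l b)"
    and f: "f \<in> Idl\<^bsub>poly_ring n\<^esub> (shape_generators less_var (weight l) n q)" "f \<noteq> 0"
  shows "\<exists>C \<in> column_systems (weight l) {1..n}. (\<forall>i. profile (lengths C) i \<le> q i) \<and>
    (\<exists>m \<in> keys f. \<forall>a. lead_exp less_var C a \<le> lookup m a)"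
proof -
  obtain xs where xs: "distinct xs" "set xs = {2..n}" "sorted_wrt less_var xs"
    using sorted_variables_exist[of "{2..n}"] by auto
  have set1: "set (1 # xs) = {1..n}" using xs(2) n by auto
  have w: "weight l b = 1" if "b \<in> set xs" for b using that xs(2) by (auto simp: weight_def)
  let ?G = "shape_generators less_var (weight l) n q :: 'k mpoly set"
  have G: "?G \<subseteq> carrier (poly_ring n)" using system_poly_carrier by auto
  show ?thesis
  proof (cases "\<forall>i\<in>{1..n}. (var_mon 1, var_mon i) \<in> r")
    case True
    have "less_var 1 b" if "b \<in> set xs" for b
      using True that xs(2) by (auto simp: less_var_def)
    hence sorted: "sorted_wrt less_var (1 # xs)" using xs(3) by simp
    have "\<exists>C \<in> column_systems (weight l) (set (1 # xs)). (\<forall>i. profile (lengths C) i \<le> q i) \<and>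
      (\<exists>m \<in> keys f. \<forall>a. lead_exp less_var C a \<le> lookup m a)"
    proof (rule vanishing_contains_lead_exp[OF K _ sorted less_var_asym])
      show "distinct (1 # xs)" using xs by auto
      show "\<forall>i. p' i \<le> q i" if "\<forall>i. p i \<le> q i" "\<And>i. p' i \<le> p i" for p p' :: "nat \<Rightarrow> nat"
        using that by (meson le_trans)
      have "f \<in> carrier (poly_ring n)" using f(1) ideal_genideal(1)[OF G] ideal_poly_ring(5) by blast
      thus "keys m \<subseteq> set (1 # xs)" if "m \<in> keys f" for m
        using that unfolding set1 by (auto simp: carrier_poly_ring monomials_def)
      show "eval_at a f = 0" if bad: "\<not> (\<forall>i. point_type (weight l) (set (1 # xs)) a i \<le> q i)" for a
      proof -
        have "eval_except 0 a (system_poly less_var C) = 0"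
          if C: "C \<in> column_systems (weight l) {1..n}" "profile (lengths C) = q" for C
        proof (rule ccontr)
          assume nz: "eval_except 0 a (system_poly less_var C) \<noteq> 0"
          have "inj_on a X" if X: "X \<in># C" for X
          proof -
            have "inj_on a (X - {0})"
              by (rule eval_except_system_poly(1)[OF C(1) finite_atLeastAtMost less_var_asym less_var_total finite.emptyI nz X])
            moreover have "X \<subseteq> {1..n}" using C(1) X unfolding column_systems_def by blast
            hence "0 \<notin> X" by auto
            ultimately show ?thesis by simp
          qed
          hence "point_type (weight l) {1..n} a i \<le> q i" for i
            using point_type_le_profile[OF C(1) finite_atLeastAtMost, of a i] C(2) by simp
          thus False using bad unfolding set1 by blast
        qed
        \<comment> \<open>The index 0 is not a variable of the ring, so here all variables are evaluated.\<close>
        hence "0 dvd eval_except 0 a f" by (intro genideal_eval_except_dvd[OF G _ f(1)]) auto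
        thus ?thesis by (simp add: eval_at_eq_poly[of a f 0])
      qed
    qed (use w f(2) in auto)
    thus ?thesis unfolding set1 .
  next
    case False
    hence max: "\<forall>i\<in>{1..n}. (var_mon i, var_mon 1) \<in> r" using x1 by blast
    have "xs \<noteq> []"
    proof
      assume "xs = []"
      hence eq: "{1..n} = {1}" using set1 by simp
      show False using False max unfolding eq by blast
    qed
    then obtain v0 vs where vs: "xs = v0 # vs" by (cases xs) auto
    show ?thesis
    proof (rule ideal_contains_lead_exp_largest[OF K _ _ less_var_asym less_var_total _ _ _ _ q f])
      show "distinct (v0 # vs)" "sorted_wrt less_var (v0 # vs)" using xs vs by auto
      show "insert 1 (set (v0 # vs)) = {1..n}" using set1 vs by simp
      show "1 \<notin> set (v0 # vs)" using xs(2) vs by simp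
      show "less_var b 1" if "b \<in> set (v0 # vs)" for b
      proof -
        have "b \<in> {2..n}" using that xs(2) unfolding vs by blast
        hence "b \<noteq> 1" "b \<in> {1..n}" by auto
        thus ?thesis using max unfolding less_var_def by blast
      qed
      show "weight l b = 1" if "b \<in> set (v0 # vs)" for b using w vs that by simp
    qed
  qed
qed

end

theorem corollary3p11:
  fixes n l :: nat and p :: "nat list" and r :: "monomial rel"
  assumes "infinite (UNIV :: 'k::field set)"
    and "1 \<le> n" and "1 \<le> l"
    and "p \<in> partitions_ge (n + l - 1) l"
    and "monomial_order n r"
    and "(\<forall>i\<in>{1..n}. (var_mon 1, var_mon i) \<in> r) \<or> (\<forall>i\<in>{1..n}. (var_mon i, var_mon 1) \<in> r)"
  shows "groebner_basis n r
    {specht_poly q T | q T. q \<in> partitions_ge (n + l - 1) l \<and> dominated q p \<and> T \<in> Tab n l q}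
    (specht_ideal n l p :: 'k mpoly set)"
proof -
  interpret ordered_monomials n r by unfold_locales (rule assms(5))
  let ?lt = less_var and ?w = "weight l"
  let ?S = "system_poly ?lt :: nat set multiset \<Rightarrow> 'k mpoly"
  define \<sigma> where "\<sigma> = (\<lambda>i. sum_list (take i p))"
  define G where "G = {specht_poly q T :: 'k mpoly | q T. q \<in> partitions_ge (n + l - 1) l \<and> dominated q p \<and> T \<in> Tab n l q}"
  define I where "I = (specht_ideal n l p :: 'k mpoly set)"
  define dom where "dom = {C \<in> column_systems ?w {1..n}. \<forall>i. profile (lengths C) i \<le> \<sigma> i}"
  have p: "p \<in> partitions (n + l - 1)" "sorted_wrt (\<ge>) p" using assms(4) by (auto simp: partitions_ge_def partitions_def)
  have conc: "concave_profile \<sigma>" unfolding \<sigma>_def by (rule concave_profile_partial_sums[OF p(2)])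
  have total: "\<sigma> i = (\<Sum>b\<in>{1..n}. ?w b)" if "length p \<le> i" for i
    using that p(1) unfolding sum_weight[OF assms(2)] by (simp add: \<sigma>_def partitions_def)
  have specht: "specht_poly q T = ?S (columns q T) \<or> specht_poly q T = - ?S (columns q T)"
    if "T \<in> Tab n l q" for q T
    by (rule specht_poly_columns[OF assms(2) that less_var_asym less_var_total])
  have Cpoly: "?S C \<in> carrier (poly_ring n)" if "C \<in> column_systems ?w {1..n}" for C
    by (rule system_poly_carrier[OF that])
  have specht_carrier: "(specht_poly q T :: 'k mpoly) \<in> carrier (poly_ring n)" if "T \<in> Tab n l q" for q T
    using specht[OF that] Cpoly[OF columns_in_column_systems[OF assms(2) that]] poly_ring_closed(3) by metis
  have gens: "{specht_poly p T | T. T \<in> Tab n l p} \<subseteq> (carrier (poly_ring n) :: 'k mpoly set)"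
    using specht_carrier by auto
  have I: "ideal I (poly_ring n)" "{specht_poly p T | T. T \<in> Tab n l p} \<subseteq> I"
    unfolding I_def specht_ideal_def by (rule ideal_genideal[OF gens])+
  have sign: "- g \<in> J" if "ideal J (poly_ring n)" "g \<in> J" for g :: "'k mpoly" and J
    using ideal_poly_ring(3)[OF that(1) ideal_poly_ring(1)[OF that(1)] that(2)] by simp
  have prof: "profile (lengths (columns q T)) = (\<lambda>i. sum_list (take i q))"
    if "q \<in> partitions_ge (n + l - 1) l" "T \<in> Tab n l q" for q T
    using profile_columns[OF assms(2) that(2)] that(1) by (auto simp: partitions_ge_def partitions_def)
  have in_I: "?S C \<in> I" if "C \<in> dom" for C
  proof (rule system_poly_in_ideal_of_dominating[OF I(1) less_var_asym less_var_total conc total])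
    show "C \<in> column_systems ?w {1..n}" "profile (lengths C) i \<le> \<sigma> i" for i using that by (auto simp: dom_def)
    fix C assume C: "C \<in> column_systems ?w {1..n}" "profile (lengths C) = \<sigma>"
    obtain q T where qT: "q \<in> partitions_ge (n + l - 1) l" "T \<in> Tab n l q" "columns q T = {#X \<in># C. X \<noteq> {}#}"
      by (rule tableau_of_columns[OF assms(2,3) C(1)])
    have "(\<lambda>i. sum_list (take i q)) = \<sigma>"
      using prof[OF qT(1,2)] unfolding qT(3) nonempty_columns(1) C(2) by simp
    hence "q = p"
      using qT(1) p(1) by (intro partial_sums_inject) (auto simp: \<sigma>_def partitions_ge_def partitions_def fun_eq_iff)
    hence "specht_poly q T \<in> I" using I(2) qT(2) by auto
    moreover have "specht_poly q T = ?S C \<or> specht_poly q T = - ?S C"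
      using specht[OF qT(2)] by (simp only: qT(3) nonempty_columns)
    ultimately show "?S C \<in> I" using sign[OF I(1), of "specht_poly q T"] by auto
  qed
  have G_dom: "\<exists>q T. g = specht_poly q T \<and> q \<in> partitions_ge (n + l - 1) l \<and> T \<in> Tab n l q \<and> columns q T \<in> dom"
    if g: "g \<in> G" for g :: "'k mpoly"
  proof -
    obtain q T where qT: "g = specht_poly q T" "q \<in> partitions_ge (n + l - 1) l" "dominated q p" "T \<in> Tab n l q"
      using g by (auto simp: G_def)
    have "\<forall>i. sum_list (take i q) \<le> \<sigma> i"
      using qT(2,3) dominated_iff[of q "n + l - 1" p] p(1) by (auto simp: \<sigma>_def partitions_ge_def)
    hence "columns q T \<in> dom"
      using prof[OF qT(2,4)] columns_in_column_systems[OF assms(2) qT(4)] by (simp add: dom_def)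
    thus ?thesis using qT by blast
  qed
  have initial: "initial_monomial r (specht_poly q T :: 'k mpoly) = lead_monomial (columns q T)"
    "(specht_poly q T :: 'k mpoly) \<noteq> 0" if "T \<in> Tab n l q" for q T
  proof -
    have lead: "has_lead (lead_monomial (columns q T)) (?S (columns q T))" by (rule has_lead_system_poly)
    have "?S (columns q T) \<noteq> 0" using lead by (auto simp: has_lead_def)
    thus "(specht_poly q T :: 'k mpoly) \<noteq> 0" using specht[OF that] by auto
    have "keys (- ?S (columns q T)) = keys (?S (columns q T))" by (auto simp: in_keys_iff)
    hence "initial_monomial r (specht_poly q T :: 'k mpoly) = initial_monomial r (?S (columns q T))"
      using specht[OF that] by (auto simp: initial_monomial_def)
    thus "initial_monomial r (specht_poly q T :: 'k mpoly) = lead_monomial (columns q T)"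
      using initial_monomial_has_lead[OF lead] by simp
  qed
  define M where "M = {m \<in> monomials n. \<exists>C\<in>dom. \<forall>a. lead_exp ?lt C a \<le> lookup m a}"
  have quotient: "\<exists>u\<in>monomials n. m = u + lead_monomial C"
    if "m \<in> monomials n" "C \<in> column_systems ?w {1..n}" "\<forall>a. lead_exp ?lt C a \<le> lookup m a" for m C
  proof
    have look: "lookup (lead_monomial C) a = lead_exp ?lt C a" for a
      by (rule lookup_lead_monomial) (rule finite_column[OF that(2) finite_atLeastAtMost])
    show "m = (m - lead_monomial C) + lead_monomial C"
      by (rule poly_mapping_eqI) (simp add: lookup_add lookup_minus look that(3))
    have "keys (m - lead_monomial C) \<subseteq> keys m"
      by (auto simp: in_keys_iff lookup_minus)
    thus "m - lead_monomial C \<in> monomials n" using that(1) by (auto simp: monomials_def)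
  qed
  have M_lead: "\<exists>g\<in>I. has_lead m g" if m: "m \<in> M" for m
  proof -
    obtain C where C: "m \<in> monomials n" "C \<in> dom" "\<forall>a. lead_exp ?lt C a \<le> lookup m a"
      using m by (auto simp: M_def)
    obtain u where u: "u \<in> monomials n" "m = u + lead_monomial C"
      using quotient[OF C(1) _ C(3)] C(2) by (auto simp: dom_def)
    have "has_lead u (Poly_Mapping.single u (1 :: 'k))"
      using order_refl[OF u(1)] by (simp add: has_lead_def)
    hence "has_lead m (Poly_Mapping.single u 1 * ?S C)"
      unfolding u(2) by (rule has_lead_mult[OF _ has_lead_system_poly])
    moreover have "Poly_Mapping.single u 1 * ?S C \<in> I"
      by (rule ideal_poly_ring(4)[OF I(1) in_I[OF C(2)] single_carrier[OF u(1)]])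
    ultimately show ?thesis by blast
  qed
  have I_sub: "I \<subseteq> Idl\<^bsub>poly_ring n\<^esub> (shape_generators ?lt ?w n \<sigma>)"
  proof -
    let ?J = "Idl\<^bsub>poly_ring n\<^esub> (shape_generators ?lt ?w n \<sigma>) :: 'k mpoly set"
    have J: "ideal ?J (poly_ring n)" "(shape_generators ?lt ?w n \<sigma> :: 'k mpoly set) \<subseteq> ?J"
      by (rule ideal_genideal, use Cpoly in blast)+
    have "specht_poly p T \<in> ?J" if T: "T \<in> Tab n l p" for T
    proof -
      have "profile (lengths (columns p T)) = \<sigma>" using prof[OF assms(4) T] by (simp add: \<sigma>_def)
      hence "?S (columns p T) \<in> ?J" using J(2) columns_in_column_systems[OF assms(2) T] by blast
      hence "?S (columns p T) \<in> ?J" "- ?S (columns p T) \<in> ?J" using sign[OF J(1)] by blast+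
      thus ?thesis using specht[OF T] by (elim disjE) (simp_all only:)
    qed
    thus ?thesis unfolding I_def specht_ideal_def by (intro genideal_subset_ideal[OF J(1)]) auto
  qed
  have meets: "keys h \<inter> M \<noteq> {}" if h: "h \<in> I" "h \<noteq> 0" for h
  proof -
    have "h \<in> Idl\<^bsub>poly_ring n\<^esub> (shape_generators ?lt ?w n \<sigma>)" using h(1) I_sub by blast
    from system_ideal_contains_lead_exp[OF assms(1,2,6) total this h(2)]
    obtain C m where "C \<in> dom" "m \<in> keys h" "\<forall>a. lead_exp ?lt C a \<le> lookup m a"
      unfolding dom_def by blast
    moreover have "keys h \<subseteq> monomials n"
      using ideal_poly_ring(5)[OF I(1)] h(1) by (auto simp: carrier_poly_ring)
    ultimately show ?thesis unfolding M_def by blast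
  qed
  have lead_in_M: "initial_monomial r f \<in> M" if "f \<in> I" "f \<noteq> 0" for f
    by (rule initial_monomial_in_leads[OF I(1) M_lead meets that])
  have GI: "G \<subseteq> I"
  proof
    fix g assume "g \<in> G"
    then obtain q T where qT: "g = specht_poly q T" "T \<in> Tab n l q" "columns q T \<in> dom" using G_dom by blast
    have "?S (columns q T) \<in> I" "- ?S (columns q T) \<in> I" using in_I[OF qT(3)] sign[OF I(1)] by blast+
    thus "g \<in> I" unfolding qT(1) using specht[OF qT(2)] by (elim disjE) (simp_all only:)
  qed
  have G0: "0 \<notin> G"
  proof
    assume "0 \<in> G"
    then obtain q T where "(0 :: 'k mpoly) = specht_poly q T" "T \<in> Tab n l q" using G_dom by blast
    thus False using initial(2) by metis
  qed
  have finG: "finite G"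
  proof (rule finite_subset)
    show "G \<subseteq> (\<lambda>(q, T). specht_poly q T) ` (SIGMA q:partitions (n + l - 1). Tab n l q)"
      by (force simp: G_def partitions_ge_def)
    show "finite ((\<lambda>(q, T). specht_poly q T :: 'k mpoly) ` (SIGMA q:partitions (n + l - 1). Tab n l q))"
      by (intro finite_imageI finite_SigmaI finite_partitions finite_Tab assms(2))
  qed
  define LG where "LG = {Poly_Mapping.single (initial_monomial r f) (1 :: 'k) | f. f \<in> G \<and> f \<noteq> 0}"
  define LI where "LI = {Poly_Mapping.single (initial_monomial r f) (1 :: 'k) | f. f \<in> I \<and> f \<noteq> 0}"
  have "LG \<subseteq> LI" using GI by (auto simp: LG_def LI_def)
  have LI: "LI \<subseteq> carrier (poly_ring n)"
    unfolding LI_def using lead_in_M by (auto intro!: single_carrier simp: M_def)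
  have idG: "ideal (Idl\<^bsub>poly_ring n\<^esub> LG) (poly_ring n)" "LG \<subseteq> Idl\<^bsub>poly_ring n\<^esub> LG"
    by (rule ideal_genideal, use \<open>LG \<subseteq> LI\<close> LI in blast)+
  have "LI \<subseteq> Idl\<^bsub>poly_ring n\<^esub> LG"
  proof
    fix x assume "x \<in> LI"
    then obtain f where f: "f \<in> I" "f \<noteq> 0" "x = Poly_Mapping.single (initial_monomial r f) 1"
      by (auto simp: LI_def)
    obtain C where C: "initial_monomial r f \<in> monomials n" "C \<in> dom"
      "\<forall>a. lead_exp ?lt C a \<le> lookup (initial_monomial r f) a"
      using lead_in_M[OF f(1,2)] by (auto simp: M_def)
    have C': "C \<in> column_systems ?w {1..n}" using C(2) by (simp add: dom_def)
    obtain q T where qT: "q \<in> partitions_ge (n + l - 1) l" "T \<in> Tab n l q" "columns q T = {#X \<in># C. X \<noteq> {}#}"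
      by (rule tableau_of_columns[OF assms(2,3) C'])
    have "\<forall>i. sum_list (take i q) \<le> \<sigma> i"
      using prof[OF qT(1,2)] C(2) unfolding qT(3) nonempty_columns(1) by (simp add: dom_def fun_eq_iff)
    hence "dominated q p"
      using qT(1) p(1) dominated_iff[of q "n + l - 1" p] by (simp add: \<sigma>_def partitions_ge_def)
    hence "specht_poly q T \<in> G" using qT by (auto simp: G_def)
    hence "Poly_Mapping.single (lead_monomial (columns q T)) (1 :: 'k) \<in> LG"
      unfolding LG_def initial(1)[OF qT(2), symmetric] using initial(2)[OF qT(2)] by blast
    hence "Poly_Mapping.single (lead_monomial (columns q T)) (1 :: 'k) \<in> Idl\<^bsub>poly_ring n\<^esub> LG"
      using idG(2) by blast
    moreover have "\<forall>a. lead_exp ?lt (columns q T) a \<le> lookup (initial_monomial r f) a"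
      unfolding qT(3) nonempty_columns(3) by (rule C(3))
    then obtain u where u: "u \<in> monomials n" "initial_monomial r f = u + lead_monomial (columns q T)"
      using quotient[OF C(1) columns_in_column_systems[OF assms(2) qT(2)]] by blast
    ultimately have "Poly_Mapping.single u 1 * Poly_Mapping.single (lead_monomial (columns q T)) 1 \<in> Idl\<^bsub>poly_ring n\<^esub> LG"
      by (intro ideal_poly_ring(4)[OF idG(1)] single_carrier)
    thus "x \<in> Idl\<^bsub>poly_ring n\<^esub> LG" unfolding f(3) u(2) by (simp add: mult_single)
  qed
  hence "Idl\<^bsub>poly_ring n\<^esub> LI \<subseteq> Idl\<^bsub>poly_ring n\<^esub> LG" by (rule genideal_subset_ideal[OF idG(1)])
  moreover have "Idl\<^bsub>poly_ring n\<^esub> LG \<subseteq> Idl\<^bsub>poly_ring n\<^esub> LI"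
    by (rule genideal_subset_ideal[OF ideal_genideal(1)[OF LI]])
      (use \<open>LG \<subseteq> LI\<close> ideal_genideal(2)[OF LI] in blast)
  ultimately have "initial_ideal n r G = initial_ideal n r I"
    unfolding initial_ideal_def LG_def[symmetric] LI_def[symmetric] by blast
  thus ?thesis using finG G0 GI unfolding groebner_basis_def G_def I_def by blast
qed

end
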